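(* Let $F_\lambda$ ($\lambda\in\mathbb S^1$) be the $\mathrm{SU}(2)$-valued extended frame associated with a minimal Lagrangian immersion $f$ into $Q_2$ (see the context). Set $$X^\lambda=(X^\lambda_{ij}):=F_\lambda F_{-i\lambda}^{-1},\qquad Y^\lambda=(Y^\lambda_{ij}):=i\,F_\lambda\,\sigma_3\,F_{-i\lambda}^{-1},\qquad \sigma_3=\begin{pmatrix}1&0\\0&-1\end{pmatrix}.$$ Then the associated family $\{f^\lambda\}$ of $f$ can be represented by $$f^\lambda=\Bigl[\bigl(\operatorname{Re}X^\lambda_{11}+i\operatorname{Re}Y^\lambda_{11},\ \operatorname{Im}X^\lambda_{11}+i\operatorname{Im}Y^\lambda_{11},\ \operatorname{Re}X^\lambda_{12}+i\operatorname{Re}Y^\lambda_{12},\ \operatorname{Im}X^\lambda_{12}+i\operatorname{Im}Y^\lambda_{12}\bigr)\Bigr].$$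
   Context: Let $\langle \boldsymbol z,\boldsymbol w\rangle=\sum_{k=1}^4 z_kw_k$ be the complex bilinear form on $\mathbb C^4$. $\mathbb CP^3$ carries the Fubini–Study metric of constant holomorphic sectional curvature $4$, and $Q_2=\{[\boldsymbol z]\in\mathbb CP^3:\langle\boldsymbol z,\boldsymbol z\rangle=0\}$ carries the induced Kähler structure. Lagrangian means that the Kähler form pulls back to zero; minimal means that the mean curvature vector in $Q_2$ vanishes. $\mathbb D$ is a simply connected domain with conformal coordinate $z=x+iy$, $\partial_z=\frac12(\partial_x-i\partial_y)$, $\partial_{\bar z}=\frac12(\partial_x+i\partial_y)$. Let $2e^u\,\mathrm dz\,\mathrm d\bar z$ be the metric induced by $f$. A horizontal lift of $f$ is a map $\mathfrak f:\mathbb D\to\mathbb S^7\subset\mathbb C^4$ with $f=[\mathfrak f]$ and $\langle\mathfrak f_z,\bar{\mathfrak f}\rangle=\langle\mathfrak f_{\bar z},\bar{\mathfrak f}\rangle=0$. One takes a horizontal lift $\hat{\mathfrak f}$ for which $\hat\beta:=\langle\hat{\mathfrak f}_z,\hat{\mathfrak f}_{\bar z}\rangle$ is a non-negative real function; then $\hat\alpha:=\langle\hat{\mathfrak f}_z,\hat{\mathfrak f}_z\rangle$ is holomorphic, $\hat\beta=\sqrt{e^{2u}-|\hat\alpha|^2}$, and $\hat u:=\log(e^u+\hat\beta)$ satisfies $2e^u=e^{\hat u}+|\hat\alpha|^2e^{-\hat u}$ and $\hat u_{z\bar z}+e^{\hat u}-|\hat\alpha|^2e^{-\hat u}=0$.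 The associated family of $f$ is the family $\{f^\lambda\}_{\lambda\in\mathbb S^1}$ of minimal Lagrangian immersions into $Q_2$ with the same $\hat u$, $\hat\beta$ and induced metric as $f$ and with holomorphic differential $\hat\alpha^\lambda\,\mathrm dz^2=\lambda^{-2}\hat\alpha\,\mathrm dz^2$; $f^\lambda$ is the class of (first column) $+\,i\,$(second column) of the $\mathrm{SO}(4)$-valued extended frame of $f$, and that frame is expressed by the pair $(F_\lambda,F_{-i\lambda})$ through the isomorphism $\mathrm{SO}(4)\cong(\mathrm{SU}(2)\times\mathrm{SU}(2))/\mathbb Z_2$. The extended frame $F_\lambda:\mathbb D\to\mathrm{SU}(2)$, $\lambda\in\mathbb S^1$, is a family with $$F_\lambda^{-1}\mathrm dF_\lambda=\begin{pmatrix}\frac14\hat u_z&-\frac{\sqrt2}{2}\lambda^{-1}e^{\hat u/2}\\ \frac{\sqrt2}{2}\lambda^{-1}\hat\alpha e^{-\hat u/2}&-\frac14\hat u_z\end{pmatrix}\mathrm dz+\begin{pmatrix}-\frac14\hat u_{\bar z}&-\frac{\sqrt2}{2}\lambda\bar{\hat\alpha}e^{-\hat u/2}\\ \frac{\sqrt2}{2}\lambda e^{\hat u/2}&\frac14\hat u_{\bar z}\end{pmatrix}\mathrm d\bar z ,$$ and $F_{-i\lambda}$ denotes the member of the family at parameter $-i\lambda$.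
   Formalization: The displayed maps are identified with the associated family only up to isometries of Q_2, including antiholomorphic ones (literally the display has differential −λ^{-2}α̂); that every associated family, and f itself, arises this way is claimed only when β̂ is not identically zero. *)

theory Defs
  imports "HOL-Analysis.Analysis"
begin

subsection \<open>Smooth maps on open subsets of the plane\<close>

definition partial_x :: "(complex \<Rightarrow> 'a::real_normed_vector) \<Rightarrow> complex \<Rightarrow> 'a" where
  "partial_x g z = frechet_derivative g (at z) 1"

definition partial_y :: "(complex \<Rightarrow> 'a::real_normed_vector) \<Rightarrow> complex \<Rightarrow> 'a" where
  "partial_y g z = frechet_derivative g (at z) \<i>"

primrec Ck_on :: "nat \<Rightarrow> complex set \<Rightarrow> (complex \<Rightarrow> 'a::real_normed_vector) \<Rightarrow> bool" where
  "Ck_on 0 S g \<longleftrightarrow> continuous_on S g"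
| "Ck_on (Suc k) S g \<longleftrightarrow>
     g differentiable_on S \<and> Ck_on k S (partial_x g) \<and> Ck_on k S (partial_y g)"

text \<open>Only used for open \<open>S\<close>.\<close>

definition smooth_on :: "complex set \<Rightarrow> (complex \<Rightarrow> 'a::real_normed_vector) \<Rightarrow> bool" where
  "smooth_on S g \<longleftrightarrow> (\<forall>k. Ck_on k S g)"

definition d_z :: "(complex \<Rightarrow> complex) \<Rightarrow> complex \<Rightarrow> complex" where
  "d_z g z = (partial_x g z - \<i> * partial_y g z) / 2"

definition d_zbar :: "(complex \<Rightarrow> complex) \<Rightarrow> complex \<Rightarrow> complex" where
  "d_zbar g z = (partial_x g z + \<i> * partial_y g z) / 2"

definition vec_d_z :: "(complex \<Rightarrow> complex^4) \<Rightarrow> complex \<Rightarrow> complex^4" where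
  "vec_d_z g z = (\<chi> k. d_z (\<lambda>w. g w $ k) z)"

definition vec_d_zbar :: "(complex \<Rightarrow> complex^4) \<Rightarrow> complex \<Rightarrow> complex^4" where
  "vec_d_zbar g z = (\<chi> k. d_zbar (\<lambda>w. g w $ k) z)"


subsection \<open>The quadric in complex projective 3-space\<close>

definition bil :: "complex^4 \<Rightarrow> complex^4 \<Rightarrow> complex" where
  "bil v w = (\<Sum>k\<in>UNIV. v $ k * w $ k)"

definition vec_cnj :: "complex^4 \<Rightarrow> complex^4" where
  "vec_cnj v = (\<chi> k. cnj (v $ k))"

text \<open>A point of projective space is a complex line; \<open>proj_class v\<close> is \<open>[v]\<close> for \<open>v \<noteq> 0\<close>.\<close>

definition proj_class :: "complex^4 \<Rightarrow> (complex^4) set" where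
  "proj_class v = {c *s v | c. True}"

definition Q2 :: "(complex^4) set set" where
  "Q2 = {proj_class v | v. v \<noteq> 0 \<and> bil v v = 0}"

definition unit_lift :: "complex set \<Rightarrow> (complex \<Rightarrow> (complex^4) set) \<Rightarrow> (complex \<Rightarrow> complex^4) \<Rightarrow> bool"
  where "unit_lift U f g \<longleftrightarrow> smooth_on U g \<and> (\<forall>z\<in>U. norm (g z) = 1 \<and> f z = proj_class (g z))"

definition smooth_CP3 :: "complex set \<Rightarrow> (complex \<Rightarrow> (complex^4) set) \<Rightarrow> bool" where
  "smooth_CP3 D f \<longleftrightarrow> (\<forall>z\<in>D. \<exists>U g. open U \<and> z \<in> U \<and> U \<subseteq> D \<and> unit_lift U f g)"

text \<open>
  The Fubini--Study metric of holomorphic sectional curvature 4 makes the Hopf map from the unit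
  sphere a Riemannian submersion. A tangent vector of projective space at \<open>[g]\<close>, \<open>norm g = 1\<close>, is
  therefore represented by its horizontal lift at \<open>g\<close>: a vector of \<open>\<complex>\<^sup>4\<close> that is Hermitian orthogonal
  to \<open>g\<close>. On horizontal vectors the metric is the real inner product of \<open>\<complex>\<^sup>4\<close>
  (\<open>v \<bullet> w = Re (bil v (vec_cnj w))\<close>) and the complex structure is multiplication by \<open>\<i>\<close>. All notions
  below are invariant under \<open>g \<mapsto> e\<^sup>i\<^sup>\<theta> g\<close> with \<open>\<theta>\<close> a smooth real function.
\<close>

definition horizontal :: "complex^4 \<Rightarrow> complex^4 \<Rightarrow> complex^4" where
  "horizontal p v = v - bil v (vec_cnj p) *s p"

text \<open>Horizontal lift at \<open>g z\<close> of the differential of \<open>[g]\<close> at \<open>z\<close> applied to \<open>h\<close>.\<close>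

definition hdiff :: "(complex \<Rightarrow> complex^4) \<Rightarrow> complex \<Rightarrow> complex \<Rightarrow> complex^4" where
  "hdiff g z h = horizontal (g z) (frechet_derivative g (at z) h)"

definition kaehler_form :: "complex^4 \<Rightarrow> complex^4 \<Rightarrow> real" where
  "kaehler_form v w = (\<i> *s v) \<bullet> w"

text \<open>
  For \<open>norm p = 1\<close> and \<open>bil p p = 0\<close>, the horizontal lift at \<open>p\<close> of the tangent space of \<open>Q2\<close> is
  \<open>{v. bil v (vec_cnj p) = 0 \<and> bil v p = 0}\<close>; this is the orthogonal projection of \<open>\<complex>\<^sup>4\<close> onto it.
\<close>

definition proj_TQ2 :: "complex^4 \<Rightarrow> complex^4 \<Rightarrow> complex^4" where
  "proj_TQ2 p v = v - bil v (vec_cnj p) *s p - bil v p *s vec_cnj p"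

text \<open>
  Covariant derivative in \<open>Q2\<close>, in direction \<open>h\<close>, of a vector field along \<open>[g]\<close> whose horizontal
  lift along \<open>g\<close> is \<open>V\<close>. The second term corrects for \<open>g\<close> not being a horizontal map.
\<close>

definition cov_deriv_Q2 ::
  "(complex \<Rightarrow> complex^4) \<Rightarrow> (complex \<Rightarrow> complex^4) \<Rightarrow> complex \<Rightarrow> complex \<Rightarrow> complex^4" where
  "cov_deriv_Q2 g V z h = proj_TQ2 (g z)
     (frechet_derivative V (at z) h - bil (frechet_derivative g (at z) h) (vec_cnj (g z)) *s V z)"

definition normal_part :: "(complex^4) set \<Rightarrow> complex^4 \<Rightarrow> complex^4" where
  "normal_part T v = (THE n. (\<forall>t\<in>T. n \<bullet> t = 0) \<and> v - n \<in> span T)"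

definition second_fund_form :: "(complex \<Rightarrow> complex^4) \<Rightarrow> complex \<Rightarrow> complex \<Rightarrow> complex \<Rightarrow> complex^4" where
  "second_fund_form g z h k =
     normal_part (range (hdiff g z)) (cov_deriv_Q2 g (\<lambda>w. hdiff g w k) z h)"

text \<open>Half the trace of the second fundamental form with respect to the induced metric.\<close>

definition mean_curvature :: "(complex \<Rightarrow> complex^4) \<Rightarrow> complex \<Rightarrow> complex^4" where
  "mean_curvature g z =
     (let E = hdiff g z 1 \<bullet> hdiff g z 1;
          M = hdiff g z 1 \<bullet> hdiff g z \<i>;
          G = hdiff g z \<i> \<bullet> hdiff g z \<i>
      in (1 / (2 * (E * G - M\<^sup>2))) *\<^sub>R
           (G *\<^sub>R second_fund_form g z 1 1 - (2 * M) *\<^sub>R second_fund_form g z 1 \<i>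
            + E *\<^sub>R second_fund_form g z \<i> \<i>))"

definition local_lift :: "complex set \<Rightarrow> (complex \<Rightarrow> (complex^4) set) \<Rightarrow> complex set \<Rightarrow>
    (complex \<Rightarrow> complex^4) \<Rightarrow> bool" where
  "local_lift D f U g \<longleftrightarrow> open U \<and> U \<subseteq> D \<and> unit_lift U f g"

definition minimal_Lagrangian_immersion :: "complex set \<Rightarrow> (complex \<Rightarrow> (complex^4) set) \<Rightarrow> bool" where
  "minimal_Lagrangian_immersion D f \<longleftrightarrow>
     smooth_CP3 D f \<and> f ` D \<subseteq> Q2 \<and>
     (\<forall>U g. local_lift D f U g \<longrightarrow> (\<forall>z\<in>U.
        inj (hdiff g z) \<and>
        (\<forall>h k. kaehler_form (hdiff g z h) (hdiff g z k) = 0) \<and>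
        mean_curvature g z = 0))"

text \<open>The induced metric is \<open>2 e\<^sup>u dz dz\<close>bar, that is \<open>2 e\<^sup>u (dx\<^sup>2 + dy\<^sup>2)\<close>.\<close>

definition induces_metric :: "complex set \<Rightarrow> (complex \<Rightarrow> (complex^4) set) \<Rightarrow> (complex \<Rightarrow> real) \<Rightarrow> bool"
  where "induces_metric D f u \<longleftrightarrow>
     (\<forall>U g. local_lift D f U g \<longrightarrow>
        (\<forall>z\<in>U. \<forall>h k. hdiff g z h \<bullet> hdiff g z k = 2 * exp (u z) * (h \<bullet> k)))"

definition horizontal_lift :: "complex set \<Rightarrow> (complex \<Rightarrow> (complex^4) set) \<Rightarrow> (complex \<Rightarrow> complex^4) \<Rightarrow> bool"
  where "horizontal_lift D f g \<longleftrightarrow>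
     unit_lift D f g \<and>
     (\<forall>z\<in>D. bil (vec_d_z g z) (vec_cnj (g z)) = 0 \<and> bil (vec_d_zbar g z) (vec_cnj (g z)) = 0)"


subsection \<open>Extended frame and associated family\<close>

definition mat2 :: "complex \<Rightarrow> complex \<Rightarrow> complex \<Rightarrow> complex \<Rightarrow> complex^2^2" where
  "mat2 a b c d = vector [vector [a, b], vector [c, d]]"

definition SU2 :: "(complex^2^2) set" where
  "SU2 = {A. transpose (map_matrix cnj A) ** A = mat 1 \<and> det A = 1}"

definition frame_U :: "(complex \<Rightarrow> real) \<Rightarrow> (complex \<Rightarrow> complex) \<Rightarrow> complex \<Rightarrow> complex \<Rightarrow> complex^2^2" where
  "frame_U uh a l z =
     (let uz = d_z (\<lambda>w. complex_of_real (uh w)) z; s = complex_of_real (sqrt 2 / 2) in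
      mat2 (uz / 4) (- s * inverse l * of_real (exp (uh z / 2)))
           (s * inverse l * a z * of_real (exp (- uh z / 2))) (- uz / 4))"

definition frame_V :: "(complex \<Rightarrow> real) \<Rightarrow> (complex \<Rightarrow> complex) \<Rightarrow> complex \<Rightarrow> complex \<Rightarrow> complex^2^2" where
  "frame_V uh a l z =
     (let uzb = d_zbar (\<lambda>w. complex_of_real (uh w)) z; s = complex_of_real (sqrt 2 / 2) in
      mat2 (- uzb / 4) (- s * l * cnj (a z) * of_real (exp (- uh z / 2)))
           (s * l * of_real (exp (uh z / 2))) (uzb / 4))"

text \<open>\<open>F\<^sup>-\<^sup>1 dF = U dz + V dz\<close>bar, evaluated on the tangent vector \<open>h\<close>.\<close>

definition extended_frame :: "complex set \<Rightarrow> (complex \<Rightarrow> real) \<Rightarrow> (complex \<Rightarrow> complex) \<Rightarrow>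
    (complex \<Rightarrow> complex \<Rightarrow> complex^2^2) \<Rightarrow> bool" where
  "extended_frame D uh a F \<longleftrightarrow>
     (\<forall>l. cmod l = 1 \<longrightarrow> (\<forall>z\<in>D.
        F l z \<in> SU2 \<and> F l differentiable (at z) \<and>
        (\<forall>h. matrix_inv (F l z) ** frechet_derivative (F l) (at z) h
             = map_matrix ((*) h) (frame_U uh a l z) + map_matrix ((*) (cnj h)) (frame_V uh a l z))))"

definition sigma3 :: "complex^2^2" where
  "sigma3 = mat2 1 0 0 (- 1)"

definition frame_X :: "(complex \<Rightarrow> complex \<Rightarrow> complex^2^2) \<Rightarrow> complex \<Rightarrow> complex \<Rightarrow> complex^2^2" where
  "frame_X F l z = F l z ** matrix_inv (F (- \<i> * l) z)"

definition frame_Y :: "(complex \<Rightarrow> complex \<Rightarrow> complex^2^2) \<Rightarrow> complex \<Rightarrow> complex \<Rightarrow> complex^2^2" where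
  "frame_Y F l z = map_matrix ((*) \<i>) (F l z ** sigma3 ** matrix_inv (F (- \<i> * l) z))"

definition XY_class :: "complex^2^2 \<Rightarrow> complex^2^2 \<Rightarrow> (complex^4) set" where
  "XY_class X Y = proj_class (vector
     [of_real (Re (X $ 1 $ 1)) + \<i> * of_real (Re (Y $ 1 $ 1)),
      of_real (Im (X $ 1 $ 1)) + \<i> * of_real (Im (Y $ 1 $ 1)),
      of_real (Re (X $ 1 $ 2)) + \<i> * of_real (Re (Y $ 1 $ 2)),
      of_real (Im (X $ 1 $ 2)) + \<i> * of_real (Im (Y $ 1 $ 2))])"

text \<open>
  The isomorphism of \<open>(SU(2) \<times> SU(2)) / \<int>\<^sub>2\<close> with \<open>SO(4)\<close>: the pair \<open>(P, Q)\<close> acts on \<open>\<real>\<^sup>4\<close>, identified with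
  the quaternions as matrices through \<open>quat\<close>, by \<open>A \<mapsto> P A Q\<^sup>-\<^sup>1\<close>.
\<close>

definition quat :: "real^4 \<Rightarrow> complex^2^2" where
  "quat x = mat2 (Complex (x $ 1) (x $ 2)) (Complex (x $ 3) (x $ 4))
                 (- cnj (Complex (x $ 3) (x $ 4))) (cnj (Complex (x $ 1) (x $ 2)))"

definition quat_inv :: "complex^2^2 \<Rightarrow> real^4" where
  "quat_inv A = vector [Re (A $ 1 $ 1), Im (A $ 1 $ 1), Re (A $ 1 $ 2), Im (A $ 1 $ 2)]"

definition SO4_of :: "complex^2^2 \<Rightarrow> complex^2^2 \<Rightarrow> real^4^4" where
  "SO4_of P Q = matrix (\<lambda>x. quat_inv (P ** quat x ** matrix_inv Q))"

definition SO4 :: "(real^4^4) set" where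
  "SO4 = {A. orthogonal_matrix A \<and> det A = 1}"

definition columns_class :: "real^4^4 \<Rightarrow> (complex^4) set" where
  "columns_class A = proj_class (\<chi> k. Complex (column 1 A $ k) (column 2 A $ k))"

text \<open>
  Since the function \<open>uh\<close> of a member is \<open>ln (exp u + b)\<close>, prescribing \<open>u\<close> and \<open>b\<close> prescribes \<open>uh\<close>.
\<close>

definition associated_family :: "complex set \<Rightarrow> (complex \<Rightarrow> real) \<Rightarrow> (complex \<Rightarrow> complex) \<Rightarrow>
    (complex \<Rightarrow> real) \<Rightarrow> (complex \<Rightarrow> complex \<Rightarrow> (complex^4) set) \<Rightarrow> bool" where
  "associated_family D u a b fam \<longleftrightarrow>
     (\<forall>l. cmod l = 1 \<longrightarrow>
        minimal_Lagrangian_immersion D (fam l) \<and> induces_metric D (fam l) u \<and>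
        (\<exists>g. horizontal_lift D (fam l) g \<and>
           (\<forall>z\<in>D. bil (vec_d_z g z) (vec_d_zbar g z) = of_real (b z) \<and>
                   bil (vec_d_z g z) (vec_d_z g z) = inverse (l\<^sup>2) * a z)))"

text \<open>
  The isometries of \<open>Q2\<close> induced by \<open>v \<mapsto> A v\<close> (holomorphic) and by \<open>v \<mapsto> A v\<close>bar (antiholomorphic),
  with \<open>A\<close> real orthogonal. If \<open>g\<close> is a horizontal lift of a minimal Lagrangian immersion with
  \<open>bil (vec_d_z g z) (vec_d_z g z) = a z\<close> and \<open>bil (vec_d_z g z) (vec_d_zbar g z) = b z \<ge> 0\<close>, \<open>b\<close> not
  identically 0, then \<open>vec_cnj g\<close> is a horizontal lift of the conjugate immersion with the same
  induced metric and the same \<open>b\<close>, and with \<open>a\<close> replaced by \<open>- a\<close>.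
  The extended frame fixes the immersion only up to such an isometry.
\<close>

definition Q2_isometry :: "((complex^4) set \<Rightarrow> (complex^4) set) \<Rightarrow> bool" where
  "Q2_isometry \<sigma> \<longleftrightarrow>
     (\<exists>A :: real^4^4. orthogonal_matrix A \<and>
        (\<sigma> = image (\<lambda>v. map_matrix complex_of_real A *v v) \<or>
         \<sigma> = image (\<lambda>v. map_matrix complex_of_real A *v vec_cnj v)))"

end

theory Submission
  imports Defs "HOL-Complex_Analysis.Conformal_Mappings"
begin

text \<open>
  Extending the identification of \<open>\<real>\<^sup>4\<close> with the quaternions complex linearly to \<open>\<complex>\<^sup>4\<close> and the
  \<open>2 \<times> 2\<close> matrices, the conjugate of (first column) \<open>+ \<i>\<close> (second column) becomes
  \<open>F\<^sub>\<lambda> (1 + \<sigma>\<^sub>3) F\<^sub>\<mu>\<^sup>-\<^sup>1\<close> with \<open>\<mu> = - \<i> \<lambda>\<close>, a matrix of rank one. The frame equations show that a constant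
  multiple of it is a horizontal lift whose Laplacian has no component tangent to the quadric, with the
  prescribed metric and differentials: \<open>\<alpha>\<close> is replaced by \<open>\<lambda>\<^sup>-\<^sup>2 \<alpha>\<close> and \<open>\<beta>\<close> is kept.

  For uniqueness, the vectors \<open>g\<close>, \<open>cnj g\<close>, \<open>g_z\<close>, \<open>g_zbar\<close> of a horizontal lift form an orthogonal frame whose
  structure equations involve only \<open>u\<close>, \<open>\<alpha>\<close>, \<open>\<beta>\<close>. This needs
  \<open>\<langle>g_zbar, g_zbar\<rangle> = - cnj \<alpha>\<close>, which holds where \<open>\<beta> \<noteq> 0\<close> and then everywhere by analytic continuation. The
  matrix that carries the frame of one lift to that of another is therefore constant, and it is real.
\<close>

subsection \<open>Smooth functions of a complex variable\<close>

text \<open>The definitions quantify over all local unit lifts and take normal parts through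
  \<open>THE\<close>, whereas the computations are identities for one global horizontal lift. The
  locale \<open>adapted_lift\<close> mediates: a horizontal lift of a given immersion, with \<beta>
  real, satisfies its identities, and conversely these identities yield every condition on every
  local lift, because two unit lifts of one map differ by a phase.

  Conjugation is a matter of sign. The conjugate of the constructed lift, which represents the
  formula as it stands, has differential \<open>- inverse (l\<^sup>2) * alphahat z\<close>; the
  constructed lift itself has the prescribed one. Hence the isometry in front of the formula is
  antiholomorphic.

  The zeros of \<beta> are the obstacle to uniqueness, since the structure equations contain the
  coefficient of a cubic form. It can be recovered from \<alpha>, \<beta> and u without dividing by
  \<beta>, because \<alpha> and \<beta> have no common zero: the squares of their moduli add up to
  the square of \<open>exp u\<close>.

  The frame is only assumed differentiable in z, so the smoothness of the lift has to be
  bootstrapped from the frame equation.\<close>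

lemma partial_x_at: "(g has_derivative g') (at z) \<Longrightarrow> partial_x g z = g' 1"
  unfolding partial_x_def by (metis frechet_derivative_at)

lemma partial_y_at: "(g has_derivative g') (at z) \<Longrightarrow> partial_y g z = g' \<i>"
  unfolding partial_y_def by (metis frechet_derivative_at)

lemma frechet_derivative_partials:
  assumes "g differentiable (at z)"
  shows "frechet_derivative g (at z) k = Re k *\<^sub>R partial_x g z + Im k *\<^sub>R partial_y g z"
proof -
  interpret bounded_linear "frechet_derivative g (at z)"
    using assms frechet_derivative_works has_derivative_bounded_linear by blast
  have "k = Re k *\<^sub>R 1 + Im k *\<^sub>R \<i>"
    by (simp add: complex_eq_iff)
  then have "frechet_derivative g (at z) k = frechet_derivative g (at z) (Re k *\<^sub>R 1 + Im k *\<^sub>R \<i>)"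
    by simp
  also have "\<dots> = Re k *\<^sub>R frechet_derivative g (at z) 1 + Im k *\<^sub>R frechet_derivative g (at z) \<i>"
    by (simp only: add scaleR)
  finally show ?thesis
    by (simp add: partial_x_def partial_y_def)
qed

text \<open>The predicates from which \<open>frechet_derivative\<close> chooses coincide, so the
  chosen values agree even where neither function is differentiable.\<close>

lemma frechet_derivative_cong_open:
  assumes "open S" "z \<in> S" "\<And>w. w \<in> S \<Longrightarrow> g w = h w"
  shows "frechet_derivative g (at z) = frechet_derivative h (at z)"
proof -
  have "(g has_derivative d) (at z) \<longleftrightarrow> (h has_derivative d) (at z)" for d
    using assms has_derivative_transform_within_open[of g d z UNIV S h]
      has_derivative_transform_within_open[of h d z UNIV S g] by auto
  then show ?thesis
    by (simp add: frechet_derivative_def)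
qed

lemma differentiable_cong_open:
  assumes "open S" "z \<in> S" "\<And>w. w \<in> S \<Longrightarrow> g w = h w"
  shows "g differentiable (at z) \<longleftrightarrow> h differentiable (at z)"
  unfolding differentiable_def
  using assms has_derivative_transform_within_open[of g _ z UNIV S h]
      has_derivative_transform_within_open[of h _ z UNIV S g] by metis

lemma partial_cong_open:
  assumes "open S" "z \<in> S" "\<And>w. w \<in> S \<Longrightarrow> g w = h w"
  shows "partial_x g z = partial_x h z" "partial_y g z = partial_y h z"
  using frechet_derivative_cong_open[OF assms] by (simp_all add: partial_x_def partial_y_def)

lemma differentiable_on_openD:
  "g differentiable_on S \<Longrightarrow> open S \<Longrightarrow> z \<in> S \<Longrightarrow> g differentiable (at z)"
  by (simp add: differentiable_on_eq_differentiable_at)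

lemma Ck_on_cong:
  assumes "open S" "\<And>w. w \<in> S \<Longrightarrow> g w = h w"
  shows "Ck_on k S g \<longleftrightarrow> Ck_on k S h"
  using assms(2)
proof (induction k arbitrary: g h)
  case 0
  then show ?case by (simp cong: continuous_on_cong)
next
  case (Suc k)
  have "g differentiable_on S \<longleftrightarrow> h differentiable_on S"
    using differentiable_cong_open[OF assms(1) _ Suc.prems] assms(1)
    by (simp add: differentiable_on_eq_differentiable_at)
  moreover have "Ck_on k S (partial_x g) \<longleftrightarrow> Ck_on k S (partial_x h)"
    "Ck_on k S (partial_y g) \<longleftrightarrow> Ck_on k S (partial_y h)"
    using partial_cong_open[OF assms(1) _ Suc.prems] by (intro Suc.IH; simp)+
  ultimately show ?case by simp
qed

lemma Ck_on_SucD: "Ck_on (Suc k) S g \<Longrightarrow> Ck_on k S g"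
proof (induction k arbitrary: g)
  case 0
  then show ?case by (simp add: differentiable_imp_continuous_on)
next
  case (Suc k)
  then have "g differentiable_on S" "Ck_on (Suc k) S (partial_x g)" "Ck_on (Suc k) S (partial_y g)"
    unfolding Ck_on.simps(2)[of "Suc k"] by blast+
  then show ?case using Suc.IH unfolding Ck_on.simps(2)[of k S g] by blast
qed

lemma Ck_on_SucE:
  assumes "Ck_on (Suc k) S g" "open S"
  shows "\<And>z. z \<in> S \<Longrightarrow> (g has_derivative frechet_derivative g (at z)) (at z)"
    "Ck_on k S (\<lambda>z. frechet_derivative g (at z) 1)" "Ck_on k S (\<lambda>z. frechet_derivative g (at z) \<i>)"
proof -
  have "partial_x g = (\<lambda>z. frechet_derivative g (at z) 1)" "partial_y g = (\<lambda>z. frechet_derivative g (at z) \<i>)"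
    by (simp_all add: partial_x_def partial_y_def fun_eq_iff)
  then show "Ck_on k S (\<lambda>z. frechet_derivative g (at z) 1)" "Ck_on k S (\<lambda>z. frechet_derivative g (at z) \<i>)"
    using assms(1) by simp_all
  show "(g has_derivative frechet_derivative g (at z)) (at z)" if "z \<in> S" for z
    using differentiable_on_openD[of g S z] assms that frechet_derivative_works[of g] by simp
qed

text \<open>Any formula \<open>g'\<close> for the derivative will do. The closure rules below are
  inductions on \<open>k\<close> in which a derivative rule supplies \<open>g'\<close> and the
  induction hypothesis applies to its terms.\<close>

lemma Ck_on_SucI:
  assumes "open S" "\<And>z. z \<in> S \<Longrightarrow> (g has_derivative g' z) (at z)"
    "Ck_on k S (\<lambda>z. g' z 1)" "Ck_on k S (\<lambda>z. g' z \<i>)"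
  shows "Ck_on (Suc k) S g"
proof -
  have "g differentiable_on S"
    using assms(1,2) by (auto simp: differentiable_on_eq_differentiable_at differentiable_def)
  moreover have "Ck_on k S (partial_x g)" "Ck_on k S (partial_y g)"
    using Ck_on_cong[OF assms(1), of "partial_x g"] Ck_on_cong[OF assms(1), of "partial_y g"]
      partial_x_at[OF assms(2)] partial_y_at[OF assms(2)] assms(3,4) by metis+
  ultimately show ?thesis by simp
qed

lemma Ck_on_const: "Ck_on k S (\<lambda>z. c)"
proof (induction k arbitrary: c)
  case (Suc k)
  have "partial_x (\<lambda>z. c) = (\<lambda>z. 0)" "partial_y (\<lambda>z. c) = (\<lambda>z. 0)"
    by (auto simp: partial_x_def partial_y_def)
  then show ?case using Suc by simp
qed simp

lemma Ck_on_bounded_linear: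
  assumes "bounded_linear L" "open S" "Ck_on k S g"
  shows "Ck_on k S (\<lambda>z. L (g z))"
  using assms(3)
proof (induction k arbitrary: g)
  case 0
  then show ?case
    by (simp add: assms(1) bounded_linear.continuous_on)
next
  case (Suc k)
  note g = Ck_on_SucE[OF Suc.prems assms(2)]
  show ?case
    by (rule Ck_on_SucI[OF assms(2) bounded_linear.has_derivative[OF assms(1) g(1)]])
      (assumption | rule Suc.IH g)+
qed

lemma Ck_on_add:
  assumes "open S" "Ck_on k S g" "Ck_on k S h"
  shows "Ck_on k S (\<lambda>z. g z + h z)"
  using assms(2,3)
proof (induction k arbitrary: g h)
  case 0
  then show ?case by (simp add: continuous_on_add)
next
  case (Suc k)
  note g = Ck_on_SucE[OF Suc.prems(1) assms(1)] and h = Ck_on_SucE[OF Suc.prems(2) assms(1)]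
  show ?case
    by (rule Ck_on_SucI[OF assms(1) has_derivative_add[OF g(1) h(1)]])
      (assumption | rule Suc.IH g h)+
qed

lemma Ck_on_bilinear:
  assumes "bounded_bilinear B" "open S" "Ck_on k S g" "Ck_on k S h"
  shows "Ck_on k S (\<lambda>z. B (g z) (h z))"
  using assms(3,4)
proof (induction k arbitrary: g h)
  case 0
  then show ?case by (simp add: assms(1) bounded_bilinear.continuous_on)
next
  case (Suc k)
  note g = Ck_on_SucE[OF Suc.prems(1) assms(2)] and h = Ck_on_SucE[OF Suc.prems(2) assms(2)]
  show ?case
    by (rule Ck_on_SucI[OF assms(2) bounded_bilinear.FDERIV[OF assms(1) g(1) h(1)]])
      (assumption | rule Ck_on_add Suc.IH g h assms(2) Ck_on_SucD[OF Suc.prems(1)] Ck_on_SucD[OF Suc.prems(2)])+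
qed

text \<open>Differentiation lowers the exponent by one, so the induction runs over all exponents.
  The exponents 1/2 and -1/2 will give \<open>exp (uhat / 2)\<close> and its inverse, and -1 the
  derivative of the logarithm.\<close>

lemma Ck_on_powr:
  fixes g :: "complex \<Rightarrow> real"
  assumes "open S" "Ck_on k S g" "\<And>z. z \<in> S \<Longrightarrow> g z > 0"
  shows "Ck_on k S (\<lambda>z. g z powr r)"
  using assms(2)
proof (induction k arbitrary: r)
  case 0
  then show ?case
    using assms(3) by (auto intro!: continuous_on_powr continuous_on_const dest: less_imp_neq[THEN not_sym])
next
  case (Suc k)
  note g = Ck_on_SucE[OF Suc.prems assms(1)]
  have d: "((\<lambda>z. g z powr r) has_derivative
      (\<lambda>x. r * g z powr (r - 1) * frechet_derivative g (at z) x)) (at z)" if "z \<in> S" for z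
  proof -
    have "((\<lambda>z. g z powr r) has_derivative
       (\<lambda>h. g z powr r * (0 * ln (g z) + frechet_derivative g (at z) h * r / g z))) (at z)"
      using assms(3)[OF that] g(1)[OF that] by (intro has_derivative_powr) auto
    then show ?thesis
      by (rule has_derivative_eq_rhs)
        (use assms(3)[OF that] in \<open>auto simp: powr_diff field_simps\<close>)
  qed
  show ?case
    by (rule Ck_on_SucI[OF assms(1) d])
      (assumption | rule Ck_on_bilinear[OF bounded_bilinear_mult assms(1)] Ck_on_const Suc.IH g
        Ck_on_SucD[OF Suc.prems])+
qed

lemma Ck_on_partial:
  assumes "Ck_on (Suc k) S g"
  shows "Ck_on k S (partial_x g)" "Ck_on k S (partial_y g)"
  using assms by simp_all

lemma smooth_on_partial:
  assumes "smooth_on S g"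
  shows "smooth_on S (partial_x g)" "smooth_on S (partial_y g)"
  using assms Ck_on_partial unfolding smooth_on_def by blast+

lemma smooth_on_differentiable:
  assumes "smooth_on S g" "open S" "z \<in> S"
  shows "g differentiable (at z)"
  using Ck_on_SucE(1)[of 0 S g z] assms unfolding smooth_on_def differentiable_def by blast

lemma smooth_on_cong:
  assumes "open S" "\<And>w. w \<in> S \<Longrightarrow> g w = h w"
  shows "smooth_on S g \<longleftrightarrow> smooth_on S h"
  unfolding smooth_on_def using Ck_on_cong[of S g h, OF assms] by simp

lemma smooth_on_subset:
  assumes "smooth_on S g" "T \<subseteq> S"
  shows "smooth_on T g"
proof -
  have "Ck_on k T g" if "Ck_on k S g" for k and g :: "complex \<Rightarrow> 'a"
    using that
    by (induction k arbitrary: g) (use assms(2) in \<open>auto intro: continuous_on_subset differentiable_on_subset\<close>)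
  then show ?thesis using assms(1) by (simp add: smooth_on_def)
qed

section \<open>Symmetry of second derivatives\<close>

lemma has_real_derivative_along_line:
  fixes f :: "complex \<Rightarrow> real"
  assumes "(f has_derivative f') (at (w + of_real t * c))"
  shows "((\<lambda>t. f (w + of_real t * c)) has_real_derivative f' c) (at t)"
proof -
  have "((\<lambda>t. w + of_real t * c) has_derivative (\<lambda>h. of_real h * c)) (at t)"
    by (auto intro!: derivative_eq_intros)
  from has_derivative_compose[OF this assms]
  have "((\<lambda>t. f (w + of_real t * c)) has_derivative (\<lambda>h. f' (of_real h * c))) (at t)" .
  moreover have "f' (of_real h * c) = f' c * h" for h
    using linear_scale[OF has_derivative_linear[OF assms], of h c] by (simp add: scaleR_conv_of_real mult.commute)
  ultimately show ?thesis
    by (simp add: has_field_derivative_def)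
qed

text \<open>The mean value theorem is applied twice: in direction \<open>c\<close> to the difference
  of \<open>f\<close> along \<open>d\<close>, then in direction \<open>d\<close> to the derivative
  along \<open>c\<close>. The second difference is symmetric in \<open>c\<close> and
  \<open>d\<close>, so exchanging them compares the two mixed derivatives.\<close>

lemma second_difference_mean_value:
  fixes f :: "complex \<Rightarrow> real"
  assumes f: "\<And>w. w \<in> ball z r \<Longrightarrow> (f has_derivative f' w) (at w)"
    and f': "\<And>w. w \<in> ball z r \<Longrightarrow> ((\<lambda>w. f' w c) has_derivative f'' w) (at w)"
    and "norm c \<le> 1" "norm d \<le> 1" "0 < t" "2 * t < r"
  shows "\<exists>w\<in>ball z (2 * t). f (z + of_real t * c + of_real t * d) - f (z + of_real t * c)
      - f (z + of_real t * d) + f z = t\<^sup>2 * f'' w d"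
proof -
  have dst: "dist z (z + x + y) = norm (x + y)" for x y
    by (metis add.assoc add_diff_cancel_left' dist_commute dist_norm)
  have in_ball: "z + of_real a * c + of_real b * d \<in> ball z r"
    if "0 \<le> a" "a \<le> t" "0 \<le> b" "b \<le> t" for a b
  proof -
    have "norm (of_real a * c + of_real b * d) \<le> a * norm c + b * norm d"
      using norm_triangle_ineq[of "of_real a * c" "of_real b * d"] that by (simp add: norm_mult)
    also have "\<dots> \<le> t * 1 + t * 1"
      using that assms by (intro add_mono mult_mono) auto
    finally show ?thesis using assms unfolding mem_ball dst by simp
  qed
  let ?G = "\<lambda>s. f ((z + of_real t * d) + of_real s * c) - f (z + of_real s * c)"
  have "\<exists>s>0. s < t \<and> ?G t - ?G 0 = (t - 0) * (f' ((z + of_real t * d) + of_real s * c) c - f' (z + of_real s * c) c)"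
  proof (rule MVT2[OF \<open>0 < t\<close>])
    fix s assume "0 \<le> s" "s \<le> t"
    then show "(?G has_real_derivative (f' ((z + of_real t * d) + of_real s * c) c - f' (z + of_real s * c) c)) (at s)"
      using in_ball[of s t] in_ball[of s 0] \<open>0 < t\<close>
      by (intro DERIV_diff has_real_derivative_along_line f)
        (simp_all only: add.assoc add.commute[of "of_real t * d"], simp_all)
  qed
  then obtain s where s: "0 < s" "s < t"
    "?G t - ?G 0 = t * (f' ((z + of_real t * d) + of_real s * c) c - f' (z + of_real s * c) c)"
    by auto
  let ?H = "\<lambda>b. f' ((z + of_real s * c) + of_real b * d) c"
  have "\<exists>b>0. b < t \<and> ?H t - ?H 0 = (t - 0) * f'' ((z + of_real s * c) + of_real b * d) d"
  proof (rule MVT2[OF \<open>0 < t\<close>])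
    fix b assume "0 \<le> b" "b \<le> t"
    then show "(?H has_real_derivative f'' ((z + of_real s * c) + of_real b * d) d) (at b)"
      using in_ball[of s b] s by (intro has_real_derivative_along_line[where f = "\<lambda>w. f' w c"] f') auto
  qed
  then obtain b where b: "0 < b" "b < t" "?H t - ?H 0 = t * f'' ((z + of_real s * c) + of_real b * d) d"
    by auto
  let ?w = "z + of_real s * c + of_real b * d"
  have "norm (of_real s * c + of_real b * d) \<le> s * norm c + b * norm d"
    using norm_triangle_ineq[of "of_real s * c" "of_real b * d"] s b by (simp add: norm_mult)
  also have "\<dots> \<le> s * 1 + b * 1"
    using s b assms by (intro add_mono mult_mono) auto
  finally have "?w \<in> ball z (2 * t)"
    using s b unfolding mem_ball dst by simp
  moreover have "?G t - ?G 0 = t\<^sup>2 * f'' ?w d"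
    using s(3) b(3) by (simp add: power2_eq_square add_ac)
  ultimately show ?thesis
    by (intro bexI[of _ ?w]) (simp_all add: add_ac)
qed

lemma Clairaut_real:
  fixes g :: "complex \<Rightarrow> real"
  assumes "open S" "Ck_on 2 S g" "z \<in> S"
  shows "partial_x (partial_y g) z = partial_y (partial_x g) z"
proof (rule ccontr)
  assume neq: "partial_x (partial_y g) z \<noteq> partial_y (partial_x g) z"
  \<comment> \<open>Half the gap: two equal numbers cannot lie within less than \<open>e\<close> of
    the two distinct mixed derivatives.\<close>
  define e where "e = \<bar>partial_x (partial_y g) z - partial_y (partial_x g) z\<bar> / 2"
  have "e > 0" using neq by (simp add: e_def)
  have C: "Ck_on (Suc 1) S g" "Ck_on (Suc 0) S (partial_x g)" "Ck_on (Suc 0) S (partial_y g)"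
    using assms(2) by (simp_all add: numeral_2_eq_2)
  have "continuous_on S (partial_x (partial_y g))" "continuous_on S (partial_y (partial_x g))"
    using C by simp_all
  then have "isCont (partial_x (partial_y g)) z" "isCont (partial_y (partial_x g)) z"
    using assms(1,3) by (simp_all add: continuous_on_eq_continuous_at)
  then obtain d1 d2 where d: "d1 > 0" "d2 > 0"
    "\<And>w. dist w z < d1 \<Longrightarrow> \<bar>partial_x (partial_y g) w - partial_x (partial_y g) z\<bar> < e"
    "\<And>w. dist w z < d2 \<Longrightarrow> \<bar>partial_y (partial_x g) w - partial_y (partial_x g) z\<bar> < e"
    using \<open>e > 0\<close> unfolding continuous_at_eps_delta by (metis dist_real_def)
  obtain r where r: "r > 0" "ball z r \<subseteq> S"
    using assms(1,3) open_contains_ball by blast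
  define t where "t = min r (min d1 d2) / 3"
  have t: "0 < t" "2 * t < r" "2 * t < d1" "2 * t < d2"
    using r d by (auto simp: t_def)
  have gd: "(g has_derivative frechet_derivative g (at w)) (at w)"
    "((\<lambda>w. frechet_derivative g (at w) 1) has_derivative frechet_derivative (partial_x g) (at w)) (at w)"
    "((\<lambda>w. frechet_derivative g (at w) \<i>) has_derivative frechet_derivative (partial_y g) (at w)) (at w)"
    if "w \<in> ball z r" for w
    using Ck_on_SucE(1)[OF C(1) assms(1)] Ck_on_SucE(1)[OF C(2) assms(1)] Ck_on_SucE(1)[OF C(3) assms(1)] that r
    unfolding partial_x_def[abs_def] partial_y_def[abs_def] by blast+
  obtain w1 where w1: "w1 \<in> ball z (2 * t)"
    "g (z + of_real t * 1 + of_real t * \<i>) - g (z + of_real t * 1) - g (z + of_real t * \<i>) + g z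
       = t\<^sup>2 * partial_y (partial_x g) w1"
    using second_difference_mean_value[OF gd(1) gd(2), where d = \<i> and t = t] t unfolding partial_y_def[of "partial_x g"] by force
  obtain w2 where w2: "w2 \<in> ball z (2 * t)"
    "g (z + of_real t * \<i> + of_real t * 1) - g (z + of_real t * \<i>) - g (z + of_real t * 1) + g z
       = t\<^sup>2 * partial_x (partial_y g) w2"
    using second_difference_mean_value[OF gd(1) gd(3), where d = 1 and t = t] t unfolding partial_x_def[of "partial_y g"] by force
  have comm: "z + of_real t * \<i> + of_real t * 1 = z + of_real t * 1 + of_real t * \<i>"
    by simp
  have "t\<^sup>2 * partial_x (partial_y g) w2 = t\<^sup>2 * partial_y (partial_x g) w1"
    using w1(2) w2(2) unfolding comm by linarith
  then have "partial_x (partial_y g) w2 = partial_y (partial_x g) w1"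
    using t by simp
  moreover have "\<bar>partial_x (partial_y g) w2 - partial_x (partial_y g) z\<bar> < e"
    "\<bar>partial_y (partial_x g) w1 - partial_y (partial_x g) z\<bar> < e"
    using d w1(1) w2(1) t by (auto simp: dist_commute)
  moreover have "2 * e = \<bar>partial_x (partial_y g) z - partial_y (partial_x g) z\<bar>"
    by (simp add: e_def)
  ultimately show False
    by (smt (verit))
qed

lemma partial_bounded_linear:
  assumes "bounded_linear L" "g differentiable (at z)"
  shows "partial_x (\<lambda>w. L (g w)) z = L (partial_x g z)" "partial_y (\<lambda>w. L (g w)) z = L (partial_y g z)"
proof -
  have "((\<lambda>w. L (g w)) has_derivative (\<lambda>h. L (frechet_derivative g (at z) h))) (at z)"
    using assms frechet_derivative_works bounded_linear.has_derivative by blast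
  from partial_x_at[OF this] partial_y_at[OF this]
  show "partial_x (\<lambda>w. L (g w)) z = L (partial_x g z)" "partial_y (\<lambda>w. L (g w)) z = L (partial_y g z)"
    by (simp_all add: partial_x_def partial_y_def)
qed

lemma Clairaut:
  fixes g :: "complex \<Rightarrow> complex"
  assumes "open S" "Ck_on 2 S g" "z \<in> S"
  shows "partial_x (partial_y g) z = partial_y (partial_x g) z"
proof -
  have C: "Ck_on (Suc 1) S g" "Ck_on (Suc 0) S (partial_x g)" "Ck_on (Suc 0) S (partial_y g)"
    using assms(2) by (simp_all add: numeral_2_eq_2)
  have d: "g differentiable (at w)" "partial_x g differentiable (at w)" "partial_y g differentiable (at w)"
    if "w \<in> S" for w
    using Ck_on_SucE(1)[OF C(1) assms(1) that] Ck_on_SucE(1)[OF C(2) assms(1) that]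
      Ck_on_SucE(1)[OF C(3) assms(1) that] by (auto simp: differentiable_def)
  have "L (partial_x (partial_y g) z) = L (partial_y (partial_x g) z)"
    if L: "bounded_linear L" for L :: "complex \<Rightarrow> real"
  proof -
    note p = partial_bounded_linear[OF L]
    have "L (partial_x (partial_y g) z) = partial_x (\<lambda>w. L (partial_y g w)) z"
      using p d assms(3) by simp
    also have "\<dots> = partial_x (partial_y (\<lambda>w. L (g w))) z"
      by (rule partial_cong_open[OF assms(1,3)]) (simp add: p d)
    also have "\<dots> = partial_y (partial_x (\<lambda>w. L (g w))) z"
      by (rule Clairaut_real[OF assms(1) Ck_on_bounded_linear[OF L assms(1,2)] assms(3)])
    also have "\<dots> = partial_y (\<lambda>w. L (partial_x g w)) z"
      by (rule partial_cong_open[OF assms(1,3)]) (simp add: p d)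
    also have "\<dots> = L (partial_y (partial_x g) z)"
      using p d assms(3) by simp
    finally show ?thesis .
  qed
  then show ?thesis
    using bounded_linear_Re bounded_linear_Im by (auto simp: complex_eq_iff)
qed

lemma smooth_on_const: "smooth_on S (\<lambda>z. c)"
  by (simp add: smooth_on_def Ck_on_const)

lemma smooth_on_bounded_linear:
  "bounded_linear L \<Longrightarrow> open S \<Longrightarrow> smooth_on S g \<Longrightarrow> smooth_on S (\<lambda>z. L (g z))"
  by (simp add: smooth_on_def Ck_on_bounded_linear)

lemma smooth_on_add:
  "open S \<Longrightarrow> smooth_on S g \<Longrightarrow> smooth_on S h \<Longrightarrow> smooth_on S (\<lambda>z. g z + h z)"
  by (simp add: smooth_on_def Ck_on_add)

lemma smooth_on_mult:
  fixes g h :: "complex \<Rightarrow> 'a::real_normed_algebra"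
  shows "open S \<Longrightarrow> smooth_on S g \<Longrightarrow> smooth_on S h \<Longrightarrow> smooth_on S (\<lambda>z. g z * h z)"
  by (simp add: smooth_on_def Ck_on_bilinear[OF bounded_bilinear_mult])

lemma smooth_on_minus: "open S \<Longrightarrow> smooth_on S g \<Longrightarrow> smooth_on S (\<lambda>z. - g z)"
  by (rule smooth_on_bounded_linear[OF bounded_linear_minus[OF bounded_linear_ident]])

lemma smooth_on_diff:
  "open S \<Longrightarrow> smooth_on S g \<Longrightarrow> smooth_on S h \<Longrightarrow> smooth_on S (\<lambda>z. g z - h z)"
  using smooth_on_add[OF _ _ smooth_on_minus] by simp

lemma smooth_on_cnj: "open S \<Longrightarrow> smooth_on S g \<Longrightarrow> smooth_on S (\<lambda>z. cnj (g z))"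
  by (rule smooth_on_bounded_linear[OF bounded_linear_cnj])

lemma smooth_on_of_real:
  "open S \<Longrightarrow> smooth_on S g \<Longrightarrow> smooth_on S (\<lambda>z. complex_of_real (g z))"
  by (rule smooth_on_bounded_linear[OF bounded_linear_of_real])

lemma smooth_on_Re: "open S \<Longrightarrow> smooth_on S g \<Longrightarrow> smooth_on S (\<lambda>z. Re (g z))"
  by (rule smooth_on_bounded_linear[OF bounded_linear_Re])

lemma smooth_on_powr:
  fixes g :: "complex \<Rightarrow> real"
  shows "open S \<Longrightarrow> smooth_on S g \<Longrightarrow> (\<And>z. z \<in> S \<Longrightarrow> g z > 0) \<Longrightarrow> smooth_on S (\<lambda>z. g z powr r)"
  unfolding smooth_on_def by (intro allI Ck_on_powr) auto

lemma smooth_on_vec_nth: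
  fixes g :: "complex \<Rightarrow> 'a::real_normed_vector^'n"
  shows "open S \<Longrightarrow> smooth_on S g \<Longrightarrow> smooth_on S (\<lambda>z. g z $ k)"
  by (rule smooth_on_bounded_linear[OF bounded_linear_vec_nth])

lemma bounded_linear_axis: "bounded_linear (axis k :: 'a::real_normed_vector \<Rightarrow> 'a^'n)"
  by (rule bounded_linear_intro[of _ 1])
    (auto simp: axis_def vec_eq_iff norm_vec_def L2_set_def if_distrib[of "\<lambda>x. (norm x)\<^sup>2"] cong: if_cong)

lemma vec_eq_sum_axis: "v = (\<Sum>k\<in>UNIV. axis k (v $ k))" for v :: "'a::comm_monoid_add^'n"
  by (simp add: vec_eq_iff axis_def)

lemma smooth_on_sum:
  "open S \<Longrightarrow> (\<And>k. k \<in> I \<Longrightarrow> smooth_on S (g k)) \<Longrightarrow> smooth_on S (\<lambda>z. \<Sum>k\<in>I. g k z)"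
  by (induction I rule: infinite_finite_induct) (auto intro: smooth_on_add smooth_on_const)

lemma smooth_on_vecI:
  fixes g :: "complex \<Rightarrow> 'a::real_normed_vector^'n"
  assumes "open S" "\<And>k. smooth_on S (\<lambda>z. g z $ k)"
  shows "smooth_on S g"
proof -
  have "smooth_on S (\<lambda>z. \<Sum>k\<in>UNIV. axis k (g z $ k))"
    using assms by (intro smooth_on_sum smooth_on_bounded_linear[OF bounded_linear_axis])
  then show ?thesis
    using vec_eq_sum_axis[of "g _"] by simp
qed

lemma differentiable_vec_nth:
  fixes g :: "complex \<Rightarrow> 'a::real_normed_vector^'n"
  assumes "g differentiable (at z)"
  shows "(\<lambda>w. g w $ k) differentiable (at z)"
  using assms bounded_linear.has_derivative[OF bounded_linear_vec_nth]
  unfolding differentiable_def by blast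

lemma differentiable_vecI:
  fixes g :: "complex \<Rightarrow> 'a::real_normed_vector^'n"
  assumes "\<And>k. (\<lambda>w. g w $ k) differentiable (at z)"
  shows "g differentiable (at z)"
proof -
  have "(\<lambda>w. axis k (g w $ k) :: 'a^'n) differentiable (at z)" for k
    using assms[of k] bounded_linear.has_derivative[OF bounded_linear_axis]
    unfolding differentiable_def by blast
  then have "(\<lambda>w. \<Sum>k\<in>UNIV. axis k (g w $ k)) differentiable (at z)"
    by (intro differentiable_sum) auto
  then show ?thesis
    using vec_eq_sum_axis[of "g _"] by simp
qed

lemma differentiable_cnj: "g differentiable (at z) \<Longrightarrow> (\<lambda>w. cnj (g w)) differentiable (at z)"
  unfolding differentiable_def using has_derivative_cnj by blast

lemma differentiable_vec_cnj:
  fixes g :: "complex \<Rightarrow> complex^4"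
  shows "g differentiable (at z) \<Longrightarrow> (\<lambda>w. vec_cnj (g w)) differentiable (at z)"
  by (rule differentiable_vecI) (simp add: vec_cnj_def differentiable_cnj differentiable_vec_nth)

lemma differentiable_vec_scale:
  fixes g :: "complex \<Rightarrow> complex^4"
  assumes "c differentiable (at z)" "g differentiable (at z)"
  shows "(\<lambda>w. c w *s g w) differentiable (at z)"
  using assms by (intro differentiable_vecI) (simp add: differentiable_vec_nth)

subsection \<open>Wirtinger derivatives\<close>

lemma has_derivative_Wirtinger:
  assumes "g differentiable (at z)"
  shows "(g has_derivative (\<lambda>h. h * d_z g z + cnj h * d_zbar g z)) (at z)"
proof -
  have "frechet_derivative g (at z) h = h * d_z g z + cnj h * d_zbar g z" for h
    unfolding frechet_derivative_partials[OF assms] d_z_def d_zbar_def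
    by (simp add: scaleR_conv_of_real field_simps complex_eq_iff)
  then show ?thesis
    using assms frechet_derivative_works by (metis (no_types, lifting) has_derivative_eq_rhs ext)
qed

text \<open>The coefficients of \<open>h\<close> and \<open>cnj h\<close> in a real linear map are
  unique, so the Wirtinger forms of the sum, product and conjugation rules can be read off from the
  real derivative.\<close>

lemma Wirtinger_unique:
  assumes "(g has_derivative (\<lambda>h. h * a + cnj h * b)) (at z)"
  shows "d_z g z = a" "d_zbar g z = b"
  unfolding d_z_def d_zbar_def partial_x_at[OF assms] partial_y_at[OF assms]
  by (simp_all add: field_simps)

lemma
  assumes "g differentiable (at z)" "h differentiable (at z)"
  shows d_z_add: "d_z (\<lambda>w. g w + h w) z = d_z g z + d_z h z"
    and d_zbar_add: "d_zbar (\<lambda>w. g w + h w) z = d_zbar g z + d_zbar h z"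
    and d_z_diff: "d_z (\<lambda>w. g w - h w) z = d_z g z - d_z h z"
    and d_zbar_diff: "d_zbar (\<lambda>w. g w - h w) z = d_zbar g z - d_zbar h z"
    and d_z_mult: "d_z (\<lambda>w. g w * h w) z = d_z g z * h z + g z * d_z h z"
    and d_zbar_mult: "d_zbar (\<lambda>w. g w * h w) z = d_zbar g z * h z + g z * d_zbar h z"
proof -
  note gh = assms[THEN has_derivative_Wirtinger]
  have "((\<lambda>w. g w + h w) has_derivative
      (\<lambda>k. k * (d_z g z + d_z h z) + cnj k * (d_zbar g z + d_zbar h z))) (at z)"
    by (rule has_derivative_eq_rhs[OF has_derivative_add[OF gh]]) (simp add: algebra_simps)
  from Wirtinger_unique[OF this]
  show "d_z (\<lambda>w. g w + h w) z = d_z g z + d_z h z"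
    "d_zbar (\<lambda>w. g w + h w) z = d_zbar g z + d_zbar h z" .
  have "((\<lambda>w. g w - h w) has_derivative
      (\<lambda>k. k * (d_z g z - d_z h z) + cnj k * (d_zbar g z - d_zbar h z))) (at z)"
    by (rule has_derivative_eq_rhs[OF has_derivative_diff[OF gh]]) (simp add: algebra_simps)
  from Wirtinger_unique[OF this]
  show "d_z (\<lambda>w. g w - h w) z = d_z g z - d_z h z"
    "d_zbar (\<lambda>w. g w - h w) z = d_zbar g z - d_zbar h z" .
  have "((\<lambda>w. g w * h w) has_derivative
      (\<lambda>k. k * (d_z g z * h z + g z * d_z h z) + cnj k * (d_zbar g z * h z + g z * d_zbar h z))) (at z)"
    by (rule has_derivative_eq_rhs[OF has_derivative_mult[OF gh]]) (simp add: algebra_simps)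
  from Wirtinger_unique[OF this]
  show "d_z (\<lambda>w. g w * h w) z = d_z g z * h z + g z * d_z h z"
    "d_zbar (\<lambda>w. g w * h w) z = d_zbar g z * h z + g z * d_zbar h z" .
qed

lemma
  assumes "g differentiable (at z)"
  shows d_z_cnj: "d_z (\<lambda>w. cnj (g w)) z = cnj (d_zbar g z)"
    and d_zbar_cnj: "d_zbar (\<lambda>w. cnj (g w)) z = cnj (d_z g z)"
proof -
  have "((\<lambda>w. cnj (g w)) has_derivative
      (\<lambda>k. k * cnj (d_zbar g z) + cnj k * cnj (d_z g z))) (at z)"
    by (rule has_derivative_eq_rhs[OF has_derivative_cnj[OF has_derivative_Wirtinger[OF assms]]])
      (simp add: algebra_simps)
  from Wirtinger_unique[OF this]
  show "d_z (\<lambda>w. cnj (g w)) z = cnj (d_zbar g z)" "d_zbar (\<lambda>w. cnj (g w)) z = cnj (d_z g z)" .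
qed

lemma d_z_const [simp]: "d_z (\<lambda>w. c) z = 0" "d_zbar (\<lambda>w. c) z = 0"
  by (simp_all add: d_z_def d_zbar_def partial_x_def partial_y_def)

lemma Wirtinger_cong:
  assumes "open S" "z \<in> S" "\<And>w. w \<in> S \<Longrightarrow> g w = h w"
  shows "d_z g z = d_z h z" "d_zbar g z = d_zbar h z"
  using partial_cong_open[OF assms] by (simp_all add: d_z_def d_zbar_def)

lemma vec_Wirtinger_nth [simp]:
  "vec_d_z g z $ k = d_z (\<lambda>w. g w $ k) z" "vec_d_zbar g z $ k = d_zbar (\<lambda>w. g w $ k) z"
  by (simp_all add: vec_d_z_def vec_d_zbar_def)

lemma vec_cnj_nth [simp]: "vec_cnj v $ k = cnj (v $ k)"
  by (simp add: vec_cnj_def)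

lemma
  assumes "g differentiable (at z)"
  shows vec_d_z_cnj: "vec_d_z (\<lambda>w. vec_cnj (g w)) z = vec_cnj (vec_d_zbar g z)"
    and vec_d_zbar_cnj: "vec_d_zbar (\<lambda>w. vec_cnj (g w)) z = vec_cnj (vec_d_z g z)"
  using differentiable_vec_nth[OF assms] by (simp_all add: vec_eq_iff d_z_cnj d_zbar_cnj)

lemma
  assumes "g differentiable (at z)" "h differentiable (at z)"
  shows vec_d_z_add: "vec_d_z (\<lambda>w. g w + h w) z = vec_d_z g z + vec_d_z h z"
    and vec_d_zbar_add: "vec_d_zbar (\<lambda>w. g w + h w) z = vec_d_zbar g z + vec_d_zbar h z"
    and d_z_bil: "d_z (\<lambda>w. bil (g w) (h w)) z = bil (vec_d_z g z) (h z) + bil (g z) (vec_d_z h z)"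
    and d_zbar_bil: "d_zbar (\<lambda>w. bil (g w) (h w)) z = bil (vec_d_zbar g z) (h z) + bil (g z) (vec_d_zbar h z)"
  using assms[THEN differentiable_vec_nth]
  by (simp_all add: vec_eq_iff d_z_add d_zbar_add bil_def sum_4 d_z_mult d_zbar_mult)

lemma
  assumes "c differentiable (at z)" "g differentiable (at z)"
  shows vec_d_z_scale: "vec_d_z (\<lambda>w. c w *s g w) z = d_z c z *s g z + c z *s vec_d_z g z"
    and vec_d_zbar_scale: "vec_d_zbar (\<lambda>w. c w *s g w) z = d_zbar c z *s g z + c z *s vec_d_zbar g z"
  using assms(1) differentiable_vec_nth[OF assms(2)] by (simp_all add: vec_eq_iff d_z_mult d_zbar_mult)

lemma frechet_derivative_vec:
  assumes "g differentiable (at z)"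
  shows "frechet_derivative g (at z) h = h *s vec_d_z g z + cnj h *s vec_d_zbar g z"
proof -
  have "((\<lambda>w. g w $ k) has_derivative (\<lambda>h. frechet_derivative g (at z) h $ k)) (at z)" for k
    using assms frechet_derivative_works bounded_linear.has_derivative[OF bounded_linear_vec_nth] by blast
  from has_derivative_unique[OF this has_derivative_Wirtinger[OF differentiable_vec_nth[OF assms]]]
  show ?thesis by (simp add: vec_eq_iff fun_eq_iff)
qed

lemma smooth_on_d_z:
  assumes "open S" "smooth_on S g"
  shows "smooth_on S (d_z g)" "smooth_on S (d_zbar g)"
proof -
  have "smooth_on S (\<lambda>z. (partial_x g z - \<i> * partial_y g z) * (1/2))"
    "smooth_on S (\<lambda>z. (partial_x g z + \<i> * partial_y g z) * (1/2))"
    by (intro smooth_on_mult smooth_on_diff smooth_on_const smooth_on_partial assms)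
      (intro smooth_on_mult smooth_on_add smooth_on_const smooth_on_partial assms)
  then show "smooth_on S (d_z g)" "smooth_on S (d_zbar g)"
    by (simp_all add: d_z_def[abs_def] d_zbar_def[abs_def])
qed

lemma smooth_on_vec_d_z:
  assumes "open S" "smooth_on S g"
  shows "smooth_on S (vec_d_z g)" "smooth_on S (vec_d_zbar g)"
  by (rule smooth_on_vecI[OF assms(1)], simp, rule smooth_on_d_z[OF assms(1) smooth_on_vec_nth[OF assms]])+

lemma smooth_on_bil: "open S \<Longrightarrow> smooth_on S g \<Longrightarrow> smooth_on S h \<Longrightarrow> smooth_on S (\<lambda>z. bil (g z) (h z))"
  unfolding bil_def by (intro smooth_on_sum smooth_on_mult smooth_on_vec_nth)

lemma smooth_on_vec_cnj: "open S \<Longrightarrow> smooth_on S g \<Longrightarrow> smooth_on S (\<lambda>z. vec_cnj (g z))"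
  by (rule smooth_on_vecI) (simp_all add: smooth_on_cnj smooth_on_vec_nth)

text \<open>Equality of the mixed partials makes the imaginary cross terms cancel. This ties the
  trace of the second fundamental form, which is built from x and y derivatives, to the single
  vector \<open>vec_d_zbar (vec_d_z g)\<close>.\<close>

lemma laplacian_Wirtinger:
  assumes "open S" "smooth_on S g" "z \<in> S"
  shows "4 * d_zbar (d_z g) z = partial_x (partial_x g) z + partial_y (partial_y g) z"
    and "4 * d_z (d_zbar g) z = partial_x (partial_x g) z + partial_y (partial_y g) z"
proof -
  have d: "partial_x g differentiable (at z)" "partial_y g differentiable (at z)"
    using smooth_on_partial[OF assms(2)] by (simp_all add: smooth_on_differentiable[OF _ assms(1,3)])
  have sym: "partial_x (partial_y g) z = partial_y (partial_x g) z"
    using Clairaut[OF assms(1) _ assms(3)] assms(2) unfolding smooth_on_def by blast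
  have "partial_x (\<lambda>w. partial_x g w * a + partial_y g w * b) z = partial_x (partial_x g) z * a + partial_x (partial_y g) z * b"
    "partial_y (\<lambda>w. partial_x g w * a + partial_y g w * b) z = partial_y (partial_x g) z * a + partial_y (partial_y g) z * b" for a b
  proof -
    have "((\<lambda>w. partial_x g w * a + partial_y g w * b) has_derivative
       (\<lambda>h. frechet_derivative (partial_x g) (at z) h * a + frechet_derivative (partial_y g) (at z) h * b)) (at z)"
      using d frechet_derivative_works by (intro has_derivative_add has_derivative_mult_left) auto
    from partial_x_at[OF this] partial_y_at[OF this]
    show "partial_x (\<lambda>w. partial_x g w * a + partial_y g w * b) z = partial_x (partial_x g) z * a + partial_x (partial_y g) z * b"
      "partial_y (\<lambda>w. partial_x g w * a + partial_y g w * b) z = partial_y (partial_x g) z * a + partial_y (partial_y g) z * b"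
      by (simp_all add: partial_x_def[of "partial_x g"] partial_x_def[of "partial_y g"]
          partial_y_def[of "partial_x g"] partial_y_def[of "partial_y g"])
  qed
  note * = this
  have g: "d_z g = (\<lambda>w. partial_x g w * (1/2) + partial_y g w * (-\<i>/2))"
    "d_zbar g = (\<lambda>w. partial_x g w * (1/2) + partial_y g w * (\<i>/2))"
    by (auto simp: d_z_def d_zbar_def fun_eq_iff field_simps)
  show "4 * d_zbar (d_z g) z = partial_x (partial_x g) z + partial_y (partial_y g) z"
    unfolding g(1) d_zbar_def * by (simp add: sym field_simps)
  show "4 * d_z (d_zbar g) z = partial_x (partial_x g) z + partial_y (partial_y g) z"
    unfolding g(2) d_z_def * by (simp add: sym field_simps)
qed

lemma d_z_d_zbar_commute:
  "open S \<Longrightarrow> smooth_on S g \<Longrightarrow> z \<in> S \<Longrightarrow> d_z (d_zbar g) z = d_zbar (d_z g) z"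
  using laplacian_Wirtinger[of S g z] by (metis mult_cancel_left zero_neq_numeral)

lemma vec_d_z_d_zbar_commute:
  "open S \<Longrightarrow> smooth_on S g \<Longrightarrow> z \<in> S \<Longrightarrow> vec_d_z (vec_d_zbar g) z = vec_d_zbar (vec_d_z g) z"
  by (simp add: vec_eq_iff d_z_d_zbar_commute[OF _ smooth_on_vec_nth])

lemma vec_laplacian_Wirtinger:
  assumes "open S" "smooth_on S g" "z \<in> S"
  shows "partial_x (partial_x g) z + partial_y (partial_y g) z = 4 *s vec_d_zbar (vec_d_z g) z"
proof -
  note L = partial_bounded_linear[OF bounded_linear_vec_nth]
  have g: "g differentiable (at w)" "partial_x g differentiable (at w)" "partial_y g differentiable (at w)"
    if "w \<in> S" for w
    using smooth_on_differentiable[OF _ assms(1) that] smooth_on_partial[OF assms(2)] assms(2) by blast+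
  have "partial_x (partial_x g) z $ k = partial_x (partial_x (\<lambda>w. g w $ k)) z"
    "partial_y (partial_y g) z $ k = partial_y (partial_y (\<lambda>w. g w $ k)) z" for k
    unfolding L[OF g(2)[OF assms(3)], symmetric] L[OF g(3)[OF assms(3)], symmetric]
    by (rule partial_cong_open[OF assms(1,3)]; simp add: L g)+
  then show ?thesis
    using laplacian_Wirtinger(1)[OF assms(1) smooth_on_vec_nth[OF assms(1,2)] assms(3)]
    by (simp add: vec_eq_iff)
qed

subsection \<open>Horizontal lifts of minimal Lagrangian immersions\<close>

lemma bil_add_left: "bil (v + v') w = bil v w + bil v' w"
  and bil_add_right: "bil v (w + w') = bil v w + bil v w'"
  and bil_diff_left: "bil (v - v') w = bil v w - bil v' w"
  and bil_diff_right: "bil v (w - w') = bil v w - bil v w'"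
  and bil_scale_left: "bil (c *s v) w = c * bil v w"
  and bil_scale_right: "bil v (c *s w) = c * bil v w"
  and bil_minus_left: "bil (- v) w = - bil v w"
  and bil_minus_right: "bil v (- w) = - bil v w"
  and bil_zero_left: "bil 0 w = 0"
  and bil_zero_right: "bil v 0 = 0"
  by (simp_all add: bil_def sum_4 algebra_simps)

lemmas bil_simps = bil_add_left bil_add_right bil_diff_left bil_diff_right bil_scale_left
  bil_scale_right bil_minus_left bil_minus_right bil_zero_left bil_zero_right

lemma bil_commute: "bil v w = bil w v"
  by (simp add: bil_def mult.commute)

lemma vec_cnj_vec_cnj [simp]: "vec_cnj (vec_cnj v) = v"
  and vec_cnj_add: "vec_cnj (v + w) = vec_cnj v + vec_cnj w"
  and vec_cnj_diff: "vec_cnj (v - w) = vec_cnj v - vec_cnj w"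
  and vec_cnj_scale: "vec_cnj (c *s v) = cnj c *s vec_cnj v"
  and vec_cnj_minus: "vec_cnj (- v) = - vec_cnj v"
  and vec_cnj_zero [simp]: "vec_cnj 0 = 0"
  by (simp_all add: vec_eq_iff)

lemmas vec_cnj_simps = vec_cnj_add vec_cnj_diff vec_cnj_scale vec_cnj_minus

lemma cnj_bil: "cnj (bil v w) = bil (vec_cnj v) (vec_cnj w)"
  by (simp add: bil_def)

lemma cnj_bil_vec_cnj: "cnj (bil v (vec_cnj w)) = bil w (vec_cnj v)"
  by (simp add: cnj_bil bil_commute)

lemma inner_bil: "v \<bullet> w = Re (bil v (vec_cnj w))"
  by (simp add: bil_def inner_vec_def inner_complex_def)

lemma kaehler_form_bil: "kaehler_form v w = - Im (bil v (vec_cnj w))"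
  by (simp add: kaehler_form_def inner_bil bil_scale_left)

lemma bil_vec_cnj_self: "bil v (vec_cnj v) = of_real ((norm v)\<^sup>2)"
proof -
  have "Im (bil v (vec_cnj v)) = 0"
    by (simp add: bil_def mult.commute)
  then show ?thesis
    by (simp add: complex_eq_iff power2_norm_eq_inner inner_bil)
qed

text \<open>The Hermitian product has the metric as real part and minus the Kaehler form as
  imaginary part; on a Lagrangian tangent plane it is therefore real and equal to the
  metric.\<close>

lemma bil_vec_cnj_eqI:
  "bil v (vec_cnj w) = of_real r" if "v \<bullet> w = r" "kaehler_form v w = 0"
  using that by (simp add: complex_eq_iff inner_bil kaehler_form_bil)

lemma proj_TQ2_add: "proj_TQ2 p (v + w) = proj_TQ2 p v + proj_TQ2 p w"
  and proj_TQ2_diff: "proj_TQ2 p (v - w) = proj_TQ2 p v - proj_TQ2 p w"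
  and proj_TQ2_scale: "proj_TQ2 p (c *s v) = c *s proj_TQ2 p v"
  by (simp_all add: proj_TQ2_def bil_simps vec_eq_iff algebra_simps)

lemma proj_class_self: "v \<in> proj_class v"
  unfolding proj_class_def by (metis (mono_tags, lifting) mem_Collect_eq vector_smult_lid)

lemma normal_part_unique:
  fixes T :: "(complex^4) set"
  assumes "\<forall>t\<in>T. n \<bullet> t = 0" "v - n \<in> span T" "\<forall>t\<in>T. m \<bullet> t = 0" "v - m \<in> span T"
  shows "m = n"
proof -
  have "(v - n) - (v - m) \<in> span T"
    by (rule span_diff[OF assms(2,4)])
  then have "m - n \<in> span T" by simp
  moreover have "orthogonal (m - n) t" if "t \<in> T" for t
    using assms that by (simp add: orthogonal_def inner_diff_left)
  ultimately have "orthogonal (m - n) (m - n)"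
    by (rule orthogonal_to_span)
  then show ?thesis by (simp add: orthogonal_def)
qed

text \<open>Orthogonal decomposition gives existence; together with uniqueness it makes the definite
  description in \<open>normal_part\<close> denote.\<close>

lemma normal_part:
  shows "\<forall>t\<in>T. normal_part T v \<bullet> t = 0" "v - normal_part T v \<in> span T"
proof -
  obtain y z where "y \<in> span T" "\<And>w. w \<in> span T \<Longrightarrow> orthogonal z w" "v = y + z"
    using orthogonal_subspace_decomp_exists[of T v] by metis
  then have "(\<forall>t\<in>T. z \<bullet> t = 0) \<and> v - z \<in> span T"
    by (auto simp: orthogonal_def span_base)
  then have "\<exists>!n. (\<forall>t\<in>T. n \<bullet> t = 0) \<and> v - n \<in> span T"
    using normal_part_unique by blast
  from theI'[OF this] show "\<forall>t\<in>T. normal_part T v \<bullet> t = 0" "v - normal_part T v \<in> span T"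
    by (simp_all add: normal_part_def)
qed

text \<open>Enough linearity for minimality: the two covariant derivatives in the trace will be
  opposite vectors.\<close>

lemma normal_part_minus: "normal_part T (- v) = - normal_part T v"
proof (rule normal_part_unique)
  show "- v - - normal_part T v \<in> span T"
    using span_neg[OF normal_part(2)[of v T]] by simp
qed (use normal_part in auto)

lemma mean_curvature_conformal:
  assumes "hdiff g z 1 \<bullet> hdiff g z 1 = c" "hdiff g z 1 \<bullet> hdiff g z \<i> = 0"
    "hdiff g z \<i> \<bullet> hdiff g z \<i> = c" "c \<noteq> 0"
  shows "mean_curvature g z = 0 \<longleftrightarrow> second_fund_form g z 1 1 + second_fund_form g z \<i> \<i> = 0"
  using assms by (simp add: mean_curvature_def Let_def flip: scaleR_add_right)

text \<open>The two norm conditions and \<open>orthogonal_z_zbar\<close> say together that the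
  Hermitian product of real tangent vectors is real and conformal, that is, the Lagrangian condition
  and the induced metric at once; \<open>harmonic\<close> stands for minimality. No local lift and
  no normal projection occurs.\<close>

locale adapted_lift =
  fixes D :: "complex set" and g :: "complex \<Rightarrow> complex^4" and u :: "complex \<Rightarrow> real"
    and a :: "complex \<Rightarrow> complex" and b :: "complex \<Rightarrow> real"
  assumes open_D: "open D"
    and smooth: "smooth_on D g"
    and unit: "z \<in> D \<Longrightarrow> bil (g z) (vec_cnj (g z)) = 1"
    and null: "z \<in> D \<Longrightarrow> bil (g z) (g z) = 0"
    and horizontal_z: "z \<in> D \<Longrightarrow> bil (vec_d_z g z) (vec_cnj (g z)) = 0"
    and horizontal_zbar: "z \<in> D \<Longrightarrow> bil (vec_d_zbar g z) (vec_cnj (g z)) = 0"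
    and norm_z: "z \<in> D \<Longrightarrow> bil (vec_d_z g z) (vec_cnj (vec_d_z g z)) = of_real (exp (u z))"
    and norm_zbar: "z \<in> D \<Longrightarrow> bil (vec_d_zbar g z) (vec_cnj (vec_d_zbar g z)) = of_real (exp (u z))"
    and orthogonal_z_zbar: "z \<in> D \<Longrightarrow> bil (vec_d_z g z) (vec_cnj (vec_d_zbar g z)) = 0"
    and harmonic: "z \<in> D \<Longrightarrow> proj_TQ2 (g z) (vec_d_zbar (vec_d_z g) z) = 0"
    and bil_z_z: "z \<in> D \<Longrightarrow> bil (vec_d_z g z) (vec_d_z g z) = a z"
    and bil_z_zbar: "z \<in> D \<Longrightarrow> bil (vec_d_z g z) (vec_d_zbar g z) = of_real (b z)"

lemma null_Wirtinger:
  assumes "open D" "smooth_on D g" "\<And>z. z \<in> D \<Longrightarrow> bil (g z) (g z) = 0" "z \<in> D"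
  shows "bil (vec_d_z g z) (g z) = 0" "bil (vec_d_zbar g z) (g z) = 0"
proof -
  have g: "g differentiable (at z)"
    using smooth_on_differentiable[OF assms(2,1,4)] .
  have "d_z (\<lambda>w. bil (g w) (g w)) z = 0" "d_zbar (\<lambda>w. bil (g w) (g w)) z = 0"
    using Wirtinger_cong[of D z "\<lambda>w. bil (g w) (g w)" "\<lambda>w. 0"] assms by simp_all
  then show "bil (vec_d_z g z) (g z) = 0" "bil (vec_d_zbar g z) (g z) = 0"
    using bil_commute[of "g z"] by (simp_all add: d_z_bil[OF g g] d_zbar_bil[OF g g])
qed

text \<open>Minimality by itself says only that the projected Laplacian is tangent to the image.
  Conformality and the Lagrangian condition exclude a tangential part, which gives the stronger
  \<open>harmonic\<close>.\<close>

lemma adapted_liftI: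
  assumes "open D" "minimal_Lagrangian_immersion D f" "induces_metric D f u" "horizontal_lift D f g"
    and a: "\<And>z. z \<in> D \<Longrightarrow> bil (vec_d_z g z) (vec_d_z g z) = a z"
    and b: "\<And>z. z \<in> D \<Longrightarrow> bil (vec_d_z g z) (vec_d_zbar g z) = of_real (b z)"
  shows "adapted_lift D g u a b"
proof -
  let ?P = "vec_d_z g" and ?Q = "vec_d_zbar g"
  have lift: "local_lift D f D g" and smooth: "smooth_on D g"
    and ng: "\<And>z. z \<in> D \<Longrightarrow> norm (g z) = 1" and f: "\<And>z. z \<in> D \<Longrightarrow> f z = proj_class (g z)"
    and hor: "\<And>z. z \<in> D \<Longrightarrow> bil (?P z) (vec_cnj (g z)) = 0" "\<And>z. z \<in> D \<Longrightarrow> bil (?Q z) (vec_cnj (g z)) = 0"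
    using assms(1,4) by (auto simp: horizontal_lift_def local_lift_def unit_lift_def)
  note smooth' = smooth_on_vec_d_z[OF assms(1) smooth]
  note diff = smooth_on_differentiable[OF _ assms(1)]
  have null: "bil (g z) (g z) = 0" if z: "z \<in> D" for z
  proof -
    have "f z \<in> Q2" using assms(2) z by (auto simp: minimal_Lagrangian_immersion_def)
    then obtain v where "proj_class (g z) = proj_class v" "bil v v = 0"
      using f[OF z] by (auto simp: Q2_def)
    then obtain c where "g z = c *s v" using proj_class_self[of "g z"] by (auto simp: proj_class_def)
    then show ?thesis using \<open>bil v v = 0\<close> by (simp add: bil_simps)
  qed
  have null': "bil (?P z) (g z) = 0" "bil (?Q z) (g z) = 0" if "z \<in> D" for z
    using null_Wirtinger[OF assms(1) smooth null that] by simp_all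
  have hdiff: "hdiff g z k = k *s ?P z + cnj k *s ?Q z" if "z \<in> D" for z k
    using diff[OF smooth that] hor[OF that]
    by (simp add: hdiff_def frechet_derivative_vec horizontal_def bil_simps)
  have H: "bil (hdiff g z h) (vec_cnj (hdiff g z k)) = of_real (2 * exp (u z) * (h \<bullet> k))" if "z \<in> D" for z h k
    using assms(2,3) lift that
    by (intro bil_vec_cnj_eqI) (auto simp: induces_metric_def minimal_Lagrangian_immersion_def)
  have P: "?P z = (1/2) *s (hdiff g z 1 - \<i> *s hdiff g z \<i>)"
    and Q: "?Q z = (1/2) *s (hdiff g z 1 + \<i> *s hdiff g z \<i>)" if "z \<in> D" for z
    by (simp_all add: hdiff[OF that] vec_eq_iff field_simps)
  have PP: "bil (?P z) (vec_cnj (?P z)) = of_real (exp (u z))"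
    and QQ: "bil (?Q z) (vec_cnj (?Q z)) = of_real (exp (u z))"
    and PQ: "bil (?P z) (vec_cnj (?Q z)) = 0" if "z \<in> D" for z
    unfolding P[OF that] Q[OF that]
    by (simp_all add: bil_simps vec_cnj_simps H[OF that] inner_complex_def)
  have harm: "proj_TQ2 (g z) (vec_d_zbar ?P z) = 0" if z: "z \<in> D" for z
  proof -
    let ?R = "vec_d_zbar ?P z"
    note g = diff[OF smooth] diff[OF smooth'(1) z] diff[OF smooth'(2) z]
    have cov: "cov_deriv_Q2 g (\<lambda>w. hdiff g w k) z k
        = proj_TQ2 (g z) (frechet_derivative (\<lambda>w. frechet_derivative g (at w) k) (at z) k)" for k
    proof -
      have "frechet_derivative (\<lambda>w. hdiff g w k) (at z) = frechet_derivative (\<lambda>w. frechet_derivative g (at w) k) (at z)"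
        by (rule frechet_derivative_cong_open[OF assms(1) z]) (simp add: hdiff frechet_derivative_vec g)
      then show ?thesis
        using hor[OF z] by (simp add: cov_deriv_Q2_def frechet_derivative_vec[OF g(1)[OF z]] bil_simps)
    qed
    let ?v1 = "cov_deriv_Q2 g (\<lambda>w. hdiff g w 1) z 1" and ?v2 = "cov_deriv_Q2 g (\<lambda>w. hdiff g w \<i>) z \<i>"
    let ?T = "range (hdiff g z)"
    have "?v1 + ?v2 = proj_TQ2 (g z) (partial_x (partial_x g) z + partial_y (partial_y g) z)"
      by (simp add: cov proj_TQ2_add partial_x_def[abs_def] partial_y_def[abs_def])
    then have v: "?v1 + ?v2 = 4 *s proj_TQ2 (g z) ?R"
      by (simp add: vec_laplacian_Wirtinger[OF assms(1) smooth z] proj_TQ2_scale)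
    have "mean_curvature g z = 0"
      using assms(2) lift z by (auto simp: minimal_Lagrangian_immersion_def)
    moreover have "hdiff g z 1 \<bullet> hdiff g z 1 = 2 * exp (u z)" "hdiff g z 1 \<bullet> hdiff g z \<i> = 0"
      "hdiff g z \<i> \<bullet> hdiff g z \<i> = 2 * exp (u z)"
      by (simp_all add: inner_bil H[OF z])
    ultimately have "normal_part ?T ?v1 + normal_part ?T ?v2 = 0"
      using mean_curvature_conformal[of g z "2 * exp (u z)"] by (simp add: second_fund_form_def)
    \<comment> \<open>Since the normal parts cancel, the sum equals the sum of the tangential parts
      and stays in the tangent plane.\<close>
    then have "?v1 + ?v2 = (?v1 - normal_part ?T ?v1) + (?v2 - normal_part ?T ?v2)"
      by (simp add: algebra_simps)
    also have "\<dots> \<in> span ?T"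
      by (intro span_add normal_part(2))
    also have "span ?T = ?T"
    proof -
      have "linear (hdiff g z)"
        by (rule linearI) (simp_all add: hdiff[OF z] vec_eq_iff algebra_simps scaleR_conv_of_real[where 'a = complex])
      then show ?thesis
        by (metis linear_subspace_image span_eq_iff subspace_UNIV)
    qed
    \<comment> \<open>The tangent plane is only a real subspace: its elements have conjugate
      coefficients with respect to \<open>?P z\<close> and \<open>?Q z\<close>.\<close>
    finally obtain \<kappa> where \<kappa>: "4 *s proj_TQ2 (g z) ?R = \<kappa> *s ?P z + cnj \<kappa> *s ?Q z"
      using v hdiff[OF z] by auto
    have c0: "bil (g z) (vec_cnj (?P z)) = 0" "bil (g z) (vec_cnj (?Q z)) = 0"
      "bil (vec_cnj (g z)) (vec_cnj (?P z)) = 0" "bil (vec_cnj (g z)) (vec_cnj (?Q z)) = 0"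
      using cnj_bil_vec_cnj[of "?P z" "g z"] cnj_bil_vec_cnj[of "?Q z" "g z"]
        cnj_bil[of "g z" "?P z"] cnj_bil[of "g z" "?Q z"] hor[OF z] null'[OF z]
      by (simp_all add: bil_commute[of "g z"])
    have RP: "4 * bil ?R (vec_cnj (?P z)) = \<kappa> * of_real (exp (u z))"
      using arg_cong[OF \<kappa>, of "\<lambda>v. bil v (vec_cnj (?P z))"] PP[OF z] PQ[OF z] cnj_bil_vec_cnj[of "?P z" "?Q z"]
      by (simp add: proj_TQ2_def bil_simps c0)
    have RQ: "4 * bil ?R (vec_cnj (?Q z)) = cnj \<kappa> * of_real (exp (u z))"
      using arg_cong[OF \<kappa>, of "\<lambda>v. bil v (vec_cnj (?Q z))"] QQ[OF z] PQ[OF z]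
      by (simp add: proj_TQ2_def bil_simps c0)
    \<comment> \<open>This differentiates the orthogonality of \<open>?P\<close> and
      \<open>?Q\<close>. Both second derivatives that arise are \<open>?R\<close>, because mixed
      derivatives commute. Together with \<open>RP\<close> and \<open>RQ\<close> it says that
      \<open>cnj \<kappa>\<close> times twice the conformal factor vanishes.\<close>
    have sum0: "bil ?R (vec_cnj (?Q z)) + bil (?P z) (vec_cnj ?R) = 0"
    proof -
      have "d_zbar (\<lambda>w. bil (?P w) (vec_cnj (?Q w))) z = 0"
        using Wirtinger_cong(2)[OF assms(1) z, of "\<lambda>w. bil (?P w) (vec_cnj (?Q w))" "\<lambda>w. 0"] PQ by simp
      then show ?thesis
        by (simp add: d_zbar_bil[OF g(2) differentiable_vec_cnj[OF g(3)]] vec_d_zbar_cnj[OF g(3)]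
            vec_d_z_d_zbar_commute[OF assms(1) smooth z])
    qed
    have "4 * bil (?P z) (vec_cnj ?R) = cnj \<kappa> * of_real (exp (u z))"
      using arg_cong[OF RP, of cnj] by (simp add: cnj_bil_vec_cnj)
    then have "cnj \<kappa> * of_real (exp (u z)) + cnj \<kappa> * of_real (exp (u z)) = 4 * 0"
      unfolding RQ[symmetric] sum0[symmetric] by (simp add: algebra_simps)
    then have "cnj \<kappa> = 0"
      by (simp flip: mult_2)
    then have "4 *s proj_TQ2 (g z) ?R = 0"
      unfolding \<kappa> by simp
    then show ?thesis by simp
  qed
  show ?thesis
  proof
    show "bil (g z) (vec_cnj (g z)) = 1" if "z \<in> D" for z
      by (simp add: bil_vec_cnj_self ng that)
  qed (use assms(1) smooth null hor PP QQ PQ harm a b in auto)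
qed

context adapted_lift
begin

abbreviation (input) "P \<equiv> vec_d_z g"
abbreviation (input) "Q \<equiv> vec_d_zbar g"

lemma smooth_P: "smooth_on D P" and smooth_Q: "smooth_on D Q"
  using smooth_on_vec_d_z[OF open_D smooth] .

lemma differentiable_g: "z \<in> D \<Longrightarrow> g differentiable (at z)"
  and differentiable_P: "z \<in> D \<Longrightarrow> P differentiable (at z)"
  and differentiable_Q: "z \<in> D \<Longrightarrow> Q differentiable (at z)"
  using smooth_on_differentiable[OF _ open_D] smooth smooth_P smooth_Q by blast+

lemma vec_d_z_Q: "z \<in> D \<Longrightarrow> vec_d_z Q z = vec_d_zbar P z"
  by (rule vec_d_z_d_zbar_commute[OF open_D smooth])

lemma norm_g: "z \<in> D \<Longrightarrow> norm (g z) = 1"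
  using unit[of z] unfolding bil_vec_cnj_self by (metis norm_ge_zero of_real_eq_1_iff power2_eq_1_iff
      one_power2 power2_eq_iff_nonneg zero_le_one)

lemma unit_lift: "(\<And>z. z \<in> D \<Longrightarrow> f z = proj_class (g z)) \<Longrightarrow> unit_lift D f g"
  using smooth norm_g by (simp add: unit_lift_def)

section \<open>Invariance under a change of phase\<close>

definition phase_change :: "complex set \<Rightarrow> (complex \<Rightarrow> complex) \<Rightarrow> (complex \<Rightarrow> complex^4) \<Rightarrow> bool" where
  "phase_change U \<phi> h \<longleftrightarrow> open U \<and> U \<subseteq> D \<and>
     (\<forall>z\<in>U. h z = \<phi> z *s g z \<and> \<phi> z * cnj (\<phi> z) = 1 \<and> \<phi> differentiable (at z))"

lemma phase_changeD:
  assumes "phase_change U \<phi> h"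
  shows "open U" "z \<in> U \<Longrightarrow> z \<in> D" "z \<in> U \<Longrightarrow> h z = \<phi> z *s g z" "z \<in> U \<Longrightarrow> \<phi> z * cnj (\<phi> z) = 1"
    "z \<in> U \<Longrightarrow> \<phi> differentiable (at z)"
  using assms by (auto simp: phase_change_def)

text \<open>Both lifts span the same line, and the factor between them is their Hermitian product;
  hence it is as smooth as the lifts themselves.\<close>

lemma local_lift_phase_change:
  assumes "\<And>z. z \<in> D \<Longrightarrow> f z = proj_class (g z)" "local_lift D f U h"
  shows "\<exists>\<phi>. phase_change U \<phi> h"
proof -
  have U: "open U" "U \<subseteq> D" "smooth_on U h" "\<And>z. z \<in> U \<Longrightarrow> norm (h z) = 1" "\<And>z. z \<in> U \<Longrightarrow> f z = proj_class (h z)"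
    using assms(2) by (auto simp: local_lift_def unit_lift_def)
  define \<phi> where "\<phi> = (\<lambda>z. bil (h z) (vec_cnj (g z)))"
  have h: "h z = \<phi> z *s g z" if "z \<in> U" for z
  proof -
    have "h z \<in> proj_class (g z)"
      using proj_class_self[of "h z"] U(5)[OF that] assms(1)[of z] that U(2) by auto
    then obtain c where "h z = c *s g z" by (auto simp: proj_class_def)
    then show ?thesis using unit[of z] that U(2) by (auto simp: \<phi>_def bil_simps)
  qed
  have "\<phi> z * cnj (\<phi> z) = 1" if "z \<in> U" for z
  proof -
    have "bil (h z) (vec_cnj (h z)) = 1"
      using U(4)[OF that] by (simp add: bil_vec_cnj_self)
    moreover have "bil (g z) (vec_cnj (g z)) = 1"
      using unit that U(2) by auto
    ultimately show ?thesis unfolding h[OF that]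
      by (simp add: bil_simps vec_cnj_simps mult.commute)
  qed
  moreover have "smooth_on U \<phi>"
    unfolding \<phi>_def using U smooth_on_subset[OF smooth] by (intro smooth_on_bil smooth_on_vec_cnj) auto
  ultimately have "phase_change U \<phi> h"
    using U(1,2) h smooth_on_differentiable[OF _ U(1)] unfolding phase_change_def by blast
  then show ?thesis by blast
qed

lemma bil_P_g: "z \<in> D \<Longrightarrow> bil (P z) (g z) = 0" and bil_Q_g: "z \<in> D \<Longrightarrow> bil (Q z) (g z) = 0"
  using null_Wirtinger[OF open_D smooth null, of z] by simp_all

lemma norm_tangent:
  "bil (h *s P z + cnj h *s Q z) (vec_cnj (k *s P z + cnj k *s Q z)) = of_real (2 * exp (u z) * (h \<bullet> k))"
  if "z \<in> D"
  using norm_z[OF that] norm_zbar[OF that] orthogonal_z_zbar[OF that] cnj_bil_vec_cnj[of "P z" "Q z"]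
  by (simp add: bil_simps vec_cnj_simps complex_eq_iff inner_complex_def algebra_simps)

text \<open>Differentiating the phase contributes only a multiple of \<open>g z\<close>, which the
  horizontal projection removes.\<close>

lemma hdiff_phase_change:
  assumes "phase_change U \<phi> h" "z \<in> U"
  shows "frechet_derivative h (at z) k = (k * d_z \<phi> z + cnj k * d_zbar \<phi> z) *s g z + \<phi> z *s (k *s P z + cnj k *s Q z)"
    and "hdiff h z k = \<phi> z *s (k *s P z + cnj k *s Q z)"
proof -
  note \<phi> = phase_changeD[OF assms(1)]
  have z: "z \<in> D" using \<phi>(2) assms(2) .
  note W = \<phi>(5)[OF assms(2)] differentiable_g[OF z]
  have "frechet_derivative h (at z) = frechet_derivative (\<lambda>w. \<phi> w *s g w) (at z)"
    by (rule frechet_derivative_cong_open[OF \<phi>(1) assms(2)]) (rule \<phi>(3))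
  then show fr: "frechet_derivative h (at z) k = (k * d_z \<phi> z + cnj k * d_zbar \<phi> z) *s g z + \<phi> z *s (k *s P z + cnj k *s Q z)"
    unfolding frechet_derivative_vec[OF differentiable_vec_scale[OF W]] vec_d_z_scale[OF W] vec_d_zbar_scale[OF W]
    by (simp add: frechet_derivative_vec[OF differentiable_vec_scale[OF W]] vec_d_z_scale[OF W] vec_d_zbar_scale[OF W]
        vec_eq_iff algebra_simps)
  let ?c = "k * d_z \<phi> z + cnj k * d_zbar \<phi> z"
  have c: "bil (frechet_derivative h (at z) k) (vec_cnj (h z)) = cnj (\<phi> z) * ?c"
    using unit[OF z] horizontal_z[OF z] horizontal_zbar[OF z]
    by (simp add: fr \<phi>(3)[OF assms(2)] bil_simps vec_cnj_simps)
  have "bil (frechet_derivative h (at z) k) (vec_cnj (h z)) *s h z = (\<phi> z * cnj (\<phi> z)) *s (?c *s g z)"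
    unfolding c by (simp add: \<phi>(3)[OF assms(2)] vec_eq_iff algebra_simps)
  then show "hdiff h z k = \<phi> z *s (k *s P z + cnj k *s Q z)"
    unfolding hdiff_def horizontal_def fr \<phi>(4)[OF assms(2)] by simp
qed

text \<open>The derivative of the phase reappears as a multiple of the tangent field, and the
  correction term in \<open>cov_deriv_Q2\<close> cancels exactly this multiple. What remains is the
  second derivative of \<open>g\<close> in direction \<open>k\<close>.\<close>

lemma cov_deriv_phase_change:
  assumes "phase_change U \<phi> h" "z \<in> U"
  shows "cov_deriv_Q2 h (\<lambda>w. hdiff h w k) z k = proj_TQ2 (h z)
     (\<phi> z *s ((k * k) *s vec_d_z P z + (2 * k * cnj k) *s vec_d_zbar P z + (cnj k * cnj k) *s vec_d_zbar Q z))"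
proof -
  note \<phi> = phase_changeD[OF assms(1)]
  have z: "z \<in> D" using \<phi>(2) assms(2) .
  have "(\<lambda>w. k) differentiable (at z)" "(\<lambda>w. cnj k) differentiable (at z)" by simp_all
  note d = this[THEN differentiable_vec_scale, OF differentiable_P[OF z]]
    this[THEN differentiable_vec_scale, OF differentiable_Q[OF z]]
  let ?V = "\<lambda>w. k *s P w + cnj k *s Q w"
  have V: "?V differentiable (at z)"
    by (rule differentiable_add[OF d(1,4)])
  have Vz: "vec_d_z ?V z = k *s vec_d_z P z + cnj k *s vec_d_zbar P z"
    "vec_d_zbar ?V z = k *s vec_d_zbar P z + cnj k *s vec_d_zbar Q z"
    using differentiable_P[OF z] differentiable_Q[OF z]
    by (simp_all add: vec_d_z_add[OF d(1,4)] vec_d_zbar_add[OF d(1,4)] vec_d_z_scale vec_d_zbar_scale vec_d_z_Q[OF z])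
  note W = \<phi>(5)[OF assms(2)] V
  have "frechet_derivative (\<lambda>w. hdiff h w k) (at z) = frechet_derivative (\<lambda>w. \<phi> w *s ?V w) (at z)"
    by (rule frechet_derivative_cong_open[OF \<phi>(1) assms(2)]) (rule hdiff_phase_change(2)[OF assms(1)])
  then have "frechet_derivative (\<lambda>w. hdiff h w k) (at z) k = k *s (d_z \<phi> z *s ?V z + \<phi> z *s vec_d_z ?V z)
       + cnj k *s (d_zbar \<phi> z *s ?V z + \<phi> z *s vec_d_zbar ?V z)"
    by (simp only: frechet_derivative_vec[OF differentiable_vec_scale[OF W]] vec_d_z_scale[OF W] vec_d_zbar_scale[OF W])
  then have fr: "frechet_derivative (\<lambda>w. hdiff h w k) (at z) k
     = (k * d_z \<phi> z + cnj k * d_zbar \<phi> z) *s ?V z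
      + \<phi> z *s ((k * k) *s vec_d_z P z + (2 * k * cnj k) *s vec_d_zbar P z + (cnj k * cnj k) *s vec_d_zbar Q z)"
    unfolding Vz by (simp add: vec_eq_iff algebra_simps)
  have c: "bil (frechet_derivative h (at z) k) (vec_cnj (h z)) = cnj (\<phi> z) * (k * d_z \<phi> z + cnj k * d_zbar \<phi> z)"
    using unit[OF z] horizontal_z[OF z] horizontal_zbar[OF z]
    by (simp add: hdiff_phase_change(1)[OF assms] \<phi>(3)[OF assms(2)] bil_simps vec_cnj_simps)
  have "bil (frechet_derivative h (at z) k) (vec_cnj (h z)) *s hdiff h z k
      = (\<phi> z * cnj (\<phi> z)) *s ((k * d_z \<phi> z + cnj k * d_zbar \<phi> z) *s ?V z)"
    unfolding c hdiff_phase_change(2)[OF assms] by (simp add: vec_eq_iff)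
  then show ?thesis
    unfolding cov_deriv_Q2_def fr by (simp add: \<phi>(4)[OF assms(2)])
qed

lemma
  assumes f: "\<And>z. z \<in> D \<Longrightarrow> f z = proj_class (g z)"
  shows minimal_Lagrangian_immersion: "minimal_Lagrangian_immersion D f"
    and induces_metric: "induces_metric D f u"
    and horizontal_lift: "horizontal_lift D f g"
proof -
  show "horizontal_lift D f g"
    by (simp add: horizontal_lift_def unit_lift f horizontal_z horizontal_zbar)
  have bil_hdiff: "bil (hdiff h z k) (vec_cnj (hdiff h z l)) = of_real (2 * exp (u z) * (k \<bullet> l))"
    if lift: "local_lift D f U h" and z: "z \<in> U" for U h z k l
  proof -
    obtain \<phi> where \<phi>: "phase_change U \<phi> h"
      using local_lift_phase_change[OF f lift] by auto
    have "bil (hdiff h z k) (vec_cnj (hdiff h z l)) = (\<phi> z * cnj (\<phi> z)) *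
       bil (k *s P z + cnj k *s Q z) (vec_cnj (l *s P z + cnj l *s Q z))"
      unfolding hdiff_phase_change(2)[OF \<phi> z] bil_scale_left vec_cnj_scale bil_scale_right by simp
    then show ?thesis
      using norm_tangent[OF phase_changeD(2)[OF \<phi> z]] phase_changeD(4)[OF \<phi> z] by simp
  qed
  show "induces_metric D f u"
    by (auto simp: induces_metric_def inner_bil bil_hdiff local_lift_def)
  have "inj (hdiff h z) \<and> (\<forall>k l. kaehler_form (hdiff h z k) (hdiff h z l) = 0) \<and> mean_curvature h z = 0"
    if lift: "local_lift D f U h" and zU: "z \<in> U" for U h z
  proof (intro conjI allI)
    note bh = bil_hdiff[OF lift zU]
    show "kaehler_form (hdiff h z k) (hdiff h z l) = 0" for k l
      by (simp add: kaehler_form_bil bh)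
    obtain \<phi> where \<phi>: "phase_change U \<phi> h"
      using local_lift_phase_change[OF f lift] by auto
    note \<phi>' = phase_changeD[OF \<phi>]
    have z: "z \<in> D" using \<phi>'(2) zU .
    show "inj (hdiff h z)"
    proof (rule injI)
      fix k l assume kl: "hdiff h z k = hdiff h z l"
      have "hdiff h z (k - l) = hdiff h z k - hdiff h z l"
        by (simp add: hdiff_phase_change(2)[OF \<phi> zU] vec_eq_iff algebra_simps)
      then have "hdiff h z (k - l) = 0" using kl by simp
      then have "bil (hdiff h z (k - l)) (vec_cnj (hdiff h z (k - l))) = 0"
        by (simp add: bil_simps)
      then show "k = l" by (simp add: bh)
    qed
    let ?v1 = "cov_deriv_Q2 h (\<lambda>w. hdiff h w 1) z 1" and ?v2 = "cov_deriv_Q2 h (\<lambda>w. hdiff h w \<i>) z \<i>"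
    \<comment> \<open>The coefficients \<open>k * k\<close> and \<open>cnj k * cnj k\<close> are 1
      for the first direction and -1 for the second, while \<open>k * cnj k\<close> is 1 for both;
      only the mixed derivative survives.\<close>
    have "?v1 + ?v2 = proj_TQ2 (h z) ((4 * \<phi> z) *s vec_d_zbar P z)"
      unfolding cov_deriv_phase_change[OF \<phi> zU] proj_TQ2_add[symmetric]
      by (rule arg_cong[where f = "proj_TQ2 (h z)"]) (simp add: vec_eq_iff algebra_simps)
    also have "\<dots> = (4 * \<phi> z) *s proj_TQ2 (h z) (vec_d_zbar P z)"
      by (rule proj_TQ2_scale)
    also have "proj_TQ2 (h z) v = proj_TQ2 (g z) v" for v
    proof -
      have "proj_TQ2 (h z) v = v - (\<phi> z * cnj (\<phi> z)) *s (bil v (vec_cnj (g z)) *s g z)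
          - (\<phi> z * cnj (\<phi> z)) *s (bil v (g z) *s vec_cnj (g z))"
        by (simp add: proj_TQ2_def \<phi>'(3)[OF zU] bil_simps vec_cnj_simps vec_eq_iff mult_ac)
      then show ?thesis
        unfolding \<phi>'(4)[OF zU] by (simp add: proj_TQ2_def)
    qed
    finally have "?v2 = - ?v1"
      using harmonic[OF z] by (simp add: eq_neg_iff_add_eq_0 add.commute)
    then have "second_fund_form h z 1 1 + second_fund_form h z \<i> \<i> = 0"
      by (simp add: second_fund_form_def normal_part_minus)
    then show "mean_curvature h z = 0"
      using mean_curvature_conformal[of h z "2 * exp (u z)"] by (simp add: inner_bil bh)
  qed
  moreover have "smooth_CP3 D f"
    unfolding smooth_CP3_def using open_D unit_lift[OF f] by blast
  moreover have "f ` D \<subseteq> Q2"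
  proof -
    have "g z \<noteq> 0" if "z \<in> D" for z
      using norm_g[OF that] by auto
    then show ?thesis
      using null by (auto simp: Q2_def f)
  qed
  ultimately show "minimal_Lagrangian_immersion D f"
    by (auto simp: minimal_Lagrangian_immersion_def)
qed

end

subsection \<open>Structure equations and congruence\<close>

lemma vector_4 [simp]:
  "(vector [w, x, y, z] :: 'a::zero^4) $ 1 = w"
  "(vector [w, x, y, z] :: 'a::zero^4) $ 2 = x"
  "(vector [w, x, y, z] :: 'a::zero^4) $ 3 = y"
  "(vector [w, x, y, z] :: 'a::zero^4) $ 4 = z"
  unfolding vector_def by simp_all

text \<open>\<open>M\<close> has the vectors as rows and \<open>N\<close> is its adjoint weighted by
  \<open>1 / c\<close>. Orthogonality says that \<open>N\<close> is a right inverse of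
  \<open>M\<close>; a right inverse of a square matrix is a left inverse, and that is the
  expansion.\<close>

lemma orthogonal_expansion:
  fixes w :: "4 \<Rightarrow> complex^4"
  assumes orth: "\<And>i j. bil (w i) (vec_cnj (w j)) = (if i = j then c j else 0)"
    and c: "\<And>i. c i \<noteq> 0"
  shows "v = (\<Sum>i\<in>UNIV. (bil v (vec_cnj (w i)) / c i) *s w i)"
proof -
  define M :: "complex^4^4" where "M = (\<chi> i j. w i $ j)"
  define N :: "complex^4^4" where "N = (\<chi> j i. cnj (w i $ j) / c i)"
  have "(M ** N) $ i $ k = mat 1 $ i $ k" for i k
  proof -
    have "(M ** N) $ i $ k = bil (w i) (vec_cnj (w k)) / c k"
      by (simp add: M_def N_def matrix_matrix_mult_def bil_def sum_divide_distrib)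
    then show ?thesis using orth c by (simp add: mat_def)
  qed
  then have "N ** M = mat 1"
    using matrix_left_right_inverse[of N M] by (simp add: vec_eq_iff)
  then have "v v* (N ** M) = v" by simp
  moreover have "(v v* (N ** M)) $ k = (\<Sum>i\<in>UNIV. (bil v (vec_cnj (w i)) / c i) *s w i) $ k" for k
    unfolding vector_matrix_mul_assoc[symmetric]
    by (simp add: vector_matrix_mult_def M_def N_def bil_def sum_divide_distrib mult.commute)
  ultimately show ?thesis by (simp add: vec_eq_iff)
qed

context adapted_lift
begin

abbreviation (input) "E z \<equiv> complex_of_real (exp (u z))"
abbreviation (input) "c z \<equiv> bil (Q z) (Q z)"

lemma bil_zbar_z: "z \<in> D \<Longrightarrow> bil (Q z) (P z) = of_real (b z)"
  using bil_z_zbar by (simp add: bil_commute)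

lemma orthogonal_zbar_z: "z \<in> D \<Longrightarrow> bil (Q z) (vec_cnj (P z)) = 0"
  using orthogonal_z_zbar cnj_bil_vec_cnj[of "P z" "Q z"] by simp

lemma frame_orthogonal:
  assumes "z \<in> D"
  shows "bil (g z) (vec_cnj (P z)) = 0" "bil (g z) (vec_cnj (Q z)) = 0"
    "bil (vec_cnj (g z)) (vec_cnj (P z)) = 0" "bil (vec_cnj (g z)) (vec_cnj (Q z)) = 0"
    "bil (vec_cnj (g z)) (vec_cnj (g z)) = 0" "bil (g z) (P z) = 0" "bil (g z) (Q z) = 0"
    "bil (vec_cnj (g z)) (P z) = 0" "bil (vec_cnj (g z)) (Q z) = 0"
    "bil (vec_cnj (g z)) (g z) = 1"
    "bil (vec_cnj (P z)) (g z) = 0" "bil (vec_cnj (Q z)) (g z) = 0"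
    "bil (vec_cnj (P z)) (vec_cnj (g z)) = 0" "bil (vec_cnj (Q z)) (vec_cnj (g z)) = 0"
proof -
  show gP: "bil (g z) (P z) = 0" and gQ: "bil (g z) (Q z) = 0"
    and "bil (vec_cnj (g z)) (P z) = 0" "bil (vec_cnj (g z)) (Q z) = 0" "bil (vec_cnj (g z)) (g z) = 1"
    using horizontal_z[OF assms] horizontal_zbar[OF assms] bil_P_g[OF assms] bil_Q_g[OF assms] unit[OF assms]
    by (metis bil_commute)+
  show gP': "bil (g z) (vec_cnj (P z)) = 0" and gQ': "bil (g z) (vec_cnj (Q z)) = 0"
    and cP': "bil (vec_cnj (g z)) (vec_cnj (P z)) = 0" and cQ': "bil (vec_cnj (g z)) (vec_cnj (Q z)) = 0"
    and "bil (vec_cnj (g z)) (vec_cnj (g z)) = 0"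
    using cnj_bil_vec_cnj[of "P z" "g z"] cnj_bil_vec_cnj[of "Q z" "g z"] cnj_bil[of "g z" "P z"]
      cnj_bil[of "g z" "Q z"] cnj_bil[of "g z" "g z"] horizontal_z[OF assms] horizontal_zbar[OF assms]
      gP gQ null[OF assms] by simp_all
  show "bil (vec_cnj (P z)) (g z) = 0" "bil (vec_cnj (Q z)) (g z) = 0"
    "bil (vec_cnj (P z)) (vec_cnj (g z)) = 0" "bil (vec_cnj (Q z)) (vec_cnj (g z)) = 0"
    using gP' gQ' cP' cQ' by (metis bil_commute)+
qed

lemma frame_expansion:
  assumes z: "z \<in> D"
  shows "v = bil v (vec_cnj (g z)) *s g z + bil v (g z) *s vec_cnj (g z)
     + (bil v (vec_cnj (P z)) / E z) *s P z + (bil v (vec_cnj (Q z)) / E z) *s Q z"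
proof -
  define w :: "4 \<Rightarrow> complex^4" where
    "w = (\<lambda>i. if i = 1 then g z else if i = 2 then vec_cnj (g z) else if i = 3 then P z else Q z)"
  define e :: "4 \<Rightarrow> complex" where "e = (\<lambda>i. if i = 1 \<or> i = 2 then 1 else E z)"
  have w: "w 1 = g z" "w 2 = vec_cnj (g z)" "w 3 = P z" "w 4 = Q z"
    and e: "e 1 = 1" "e 2 = 1" "e 3 = E z" "e 4 = E z"
    by (simp_all add: w_def e_def)
  have "\<forall>i j. bil (w i) (vec_cnj (w j)) = (if i = j then e j else 0)"
    unfolding forall_4 w e using frame_orthogonal[OF z] horizontal_z[OF z] horizontal_zbar[OF z] bil_P_g[OF z] bil_Q_g[OF z]
      null[OF z] unit[OF z] norm_z[OF z] norm_zbar[OF z] orthogonal_z_zbar[OF z] orthogonal_zbar_z[OF z]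
    by simp
  moreover have "\<forall>i. e i \<noteq> 0"
    unfolding forall_4 e by simp
  ultimately have "v = (\<Sum>i\<in>UNIV. (bil v (vec_cnj (w i)) / e i) *s w i)"
    by (intro orthogonal_expansion) auto
  then show ?thesis
    by (simp add: sum_4 w e)
qed

text \<open>The completeness relation dual to the orthogonality of the frame, obtained by expanding
  the coordinate vectors. It will make the transfer matrix between two frames unitary.\<close>

lemma frame_complete:
  assumes z: "z \<in> D"
  shows "g z $ j * cnj (g z $ k) + cnj (g z $ j) * g z $ k
     + (P z $ j * cnj (P z $ k) + Q z $ j * cnj (Q z $ k)) / E z = (if j = k then 1 else 0)"
proof -
  have bil_axis: "bil (axis k 1) w = w $ k" for w
    by (simp add: bil_def axis_def if_distrib[of "\<lambda>x. x * _"] cong: if_cong)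
  show ?thesis
    using arg_cong[OF frame_expansion[OF z, of "axis k 1"], of "\<lambda>v. v $ j"] unfolding bil_axis
    by (simp add: axis_def add_divide_distrib mult.commute eq_commute[of j k] del: vec_Wirtinger_nth)
qed

text \<open>The tangent plane of the quadric, the Hermitian complement of \<open>g z\<close> and its
  conjugate, is stable under conjugation. Hence the conjugates of \<open>P z\<close> and
  \<open>Q z\<close> involve only \<open>P z\<close> and \<open>Q z\<close>, with coefficients from
  the bilinear products.\<close>

lemma vec_cnj_P: "vec_cnj (P z) = (cnj (a z) / E z) *s P z + (of_real (b z) / E z) *s Q z"
  and vec_cnj_Q: "vec_cnj (Q z) = (of_real (b z) / E z) *s P z + (cnj (c z) / E z) *s Q z"
  if z: "z \<in> D"
proof -
  have "bil (vec_cnj (P z)) (vec_cnj (P z)) = cnj (a z)" "bil (vec_cnj (P z)) (vec_cnj (Q z)) = of_real (b z)"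
    "bil (vec_cnj (Q z)) (vec_cnj (P z)) = of_real (b z)"
    unfolding cnj_bil[symmetric] by (simp_all add: bil_z_z[OF z] bil_z_zbar[OF z] bil_zbar_z[OF z])
  moreover have "bil (vec_cnj (Q z)) (vec_cnj (Q z)) = cnj (c z)"
    unfolding cnj_bil[symmetric] ..
  ultimately show "vec_cnj (P z) = (cnj (a z) / E z) *s P z + (of_real (b z) / E z) *s Q z"
    "vec_cnj (Q z) = (of_real (b z) / E z) *s P z + (cnj (c z) / E z) *s Q z"
    using frame_expansion[OF z, of "vec_cnj (P z)"] frame_expansion[OF z, of "vec_cnj (Q z)"] frame_orthogonal[OF z]
    by simp_all
qed

text \<open>Pairing the expansion of the conjugate of \<open>P z\<close> with \<open>P z\<close>
  recovers the norm. In particular \<open>a\<close> and \<open>b\<close> never vanish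
  together.\<close>

lemma norm_relation: "a z * cnj (a z) + (of_real (b z))\<^sup>2 = (E z)\<^sup>2" if z: "z \<in> D"
proof -
  have "bil (P z) ((cnj (a z) / E z) *s P z + (of_real (b z) / E z) *s Q z) = E z"
    using norm_z[OF z] unfolding vec_cnj_P[OF z] .
  then show ?thesis
    by (simp add: bil_simps bil_z_z[OF z] bil_z_zbar[OF z] field_simps power2_eq_square)
qed

text \<open>The same expansion paired with \<open>Q z\<close> must vanish. It determines
  \<open>c\<close> only where \<open>b\<close> is nonzero.\<close>

lemma b_mult_c: "of_real (b z) * (cnj (a z) + c z) = 0" if z: "z \<in> D"
proof -
  have "bil ((cnj (a z) / E z) *s P z + (of_real (b z) / E z) *s Q z) (Q z) = 0"
    using orthogonal_zbar_z[OF z] unfolding vec_cnj_P[OF z] by (simp add: bil_commute)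
  then have "(of_real (b z) * (cnj (a z) + c z)) / E z = 0"
    by (simp add: bil_simps bil_z_zbar[OF z] add_divide_distrib algebra_simps)
  then show ?thesis by simp
qed

text \<open>By \<open>harmonic\<close> there is no component tangent to the quadric; the two others
  come from differentiating the orthogonality of \<open>P\<close> to \<open>g\<close> and to its
  conjugate.\<close>

lemma vec_d_zbar_P: "vec_d_zbar P z = - E z *s g z - of_real (b z) *s vec_cnj (g z)" if z: "z \<in> D"
proof -
  note dg = differentiable_g[OF z] and dP = differentiable_P[OF z]
  have "d_zbar (\<lambda>w. bil (P w) (g w)) z = 0" "d_zbar (\<lambda>w. bil (P w) (vec_cnj (g w))) z = 0"
    using Wirtinger_cong(2)[OF open_D z, of _ "\<lambda>w. 0"] bil_P_g horizontal_z by simp_all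
  then have "bil (vec_d_zbar P z) (g z) = - of_real (b z)" "bil (vec_d_zbar P z) (vec_cnj (g z)) = - E z"
    by (simp_all add: d_zbar_bil[OF dP dg] d_zbar_bil[OF dP differentiable_vec_cnj[OF dg]] vec_d_zbar_cnj[OF dg]
        norm_z[OF z] bil_z_zbar[OF z] eq_neg_iff_add_eq_0)
  moreover have "vec_d_zbar P z = proj_TQ2 (g z) (vec_d_zbar P z)
      + bil (vec_d_zbar P z) (vec_cnj (g z)) *s g z + bil (vec_d_zbar P z) (g z) *s vec_cnj (g z)"
    by (simp add: proj_TQ2_def)
  ultimately show ?thesis
    unfolding harmonic[OF z] by (simp add: vec_eq_iff)
qed

lemma bil_vec_d_zbar_P:
  assumes z: "z \<in> D"
  shows "bil (vec_d_zbar P z) (P z) = 0" "bil (vec_d_zbar P z) (Q z) = 0"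
    "bil (vec_d_zbar P z) (vec_cnj (P z)) = 0" "bil (vec_d_zbar P z) (vec_cnj (Q z)) = 0"
    "bil (P z) (vec_cnj (vec_d_zbar P z)) = 0" "bil (Q z) (vec_cnj (vec_d_zbar P z)) = 0"
  unfolding vec_d_zbar_P[OF z] using horizontal_z[OF z] horizontal_zbar[OF z] bil_P_g[OF z] bil_Q_g[OF z]
  by (simp_all add: bil_simps vec_cnj_simps frame_orthogonal[OF z])

lemma differentiable_E: "z \<in> D \<Longrightarrow> E differentiable (at z)"
  and differentiable_b: "z \<in> D \<Longrightarrow> (\<lambda>w. complex_of_real (b w)) differentiable (at z)"
  and differentiable_a: "z \<in> D \<Longrightarrow> a differentiable (at z)"
  and smooth_a: "smooth_on D a"
  and smooth_E: "smooth_on D E"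
  and smooth_b: "smooth_on D (\<lambda>w. complex_of_real (b w))"
proof -
  note s = smooth_P smooth_Q smooth_on_vec_cnj[OF open_D smooth_P]
  show a: "smooth_on D a"
    using smooth_on_cong[OF open_D, of "\<lambda>z. bil (P z) (P z)" a] bil_z_z smooth_on_bil[OF open_D s(1,1)] by simp
  show E: "smooth_on D E"
    using smooth_on_cong[OF open_D, of "\<lambda>z. bil (P z) (vec_cnj (P z))" E] norm_z smooth_on_bil[OF open_D s(1,3)] by simp
  show b: "smooth_on D (\<lambda>w. complex_of_real (b w))"
    using smooth_on_cong[OF open_D, of "\<lambda>z. bil (P z) (Q z)" "\<lambda>w. complex_of_real (b w)"] bil_z_zbar
      smooth_on_bil[OF open_D s(1,2)] by simp
  show "z \<in> D \<Longrightarrow> E differentiable (at z)"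
    by (rule smooth_on_differentiable[OF E open_D])
  show "z \<in> D \<Longrightarrow> (\<lambda>w. complex_of_real (b w)) differentiable (at z)"
    by (rule smooth_on_differentiable[OF b open_D])
  show "z \<in> D \<Longrightarrow> a differentiable (at z)"
    by (rule smooth_on_differentiable[OF a open_D])
qed

lemma d_zbar_a: "d_zbar a z = 0" and d_z_a: "d_z a z = 2 * bil (vec_d_z P z) (P z)" if z: "z \<in> D"
proof -
  note dP = differentiable_P[OF z]
  have "d_zbar a z = d_zbar (\<lambda>w. bil (P w) (P w)) z" "d_z a z = d_z (\<lambda>w. bil (P w) (P w)) z"
    by (rule Wirtinger_cong[OF open_D z]; simp add: bil_z_z)+
  then show "d_zbar a z = 0" "d_z a z = 2 * bil (vec_d_z P z) (P z)"
    by (simp_all add: d_zbar_bil[OF dP dP] d_z_bil[OF dP dP] bil_commute[of "P z"] bil_vec_d_zbar_P[OF z])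
qed

text \<open>The counterpart of \<open>d_zbar_a\<close>: with \<open>a\<close> holomorphic and
  \<open>c\<close> antiholomorphic, \<open>a + cnj c\<close> is holomorphic, so \<open>c_eq\<close>
  can be continued from the set where \<open>b\<close> is nonzero.\<close>

lemma d_z_c: "d_z c z = 0" if z: "z \<in> D"
  by (simp add: d_z_bil[OF differentiable_Q[OF z] differentiable_Q[OF z]] vec_d_z_Q[OF z]
      bil_commute[of "Q z"] bil_vec_d_zbar_P[OF z])

lemma c_eq:
  assumes "connected D" "\<exists>z\<in>D. b z \<noteq> 0" "z \<in> D"
  shows "c z = - cnj (a z)"
proof -
  let ?k = "\<lambda>z. a z + cnj (c z)"
  have dk: "?k differentiable (at z)" "d_zbar ?k z = 0" if z: "z \<in> D" for z
  proof -
    have c: "c differentiable (at z)"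
      using smooth_on_differentiable[OF smooth_on_bil[OF open_D smooth_Q smooth_Q] open_D z] .
    show "?k differentiable (at z)"
      using differentiable_a[OF z] differentiable_cnj[OF c] by simp
    show "d_zbar ?k z = 0"
      by (simp add: d_zbar_add[OF differentiable_a[OF z] differentiable_cnj[OF c]] d_zbar_cnj[OF c] d_z_c[OF z] d_zbar_a[OF z])
  qed
  have hol: "?k holomorphic_on D"
    unfolding holomorphic_on_def field_differentiable_def
  proof (intro ballI exI)
    fix z assume z: "z \<in> D"
    have "(?k has_derivative (\<lambda>h. d_z ?k z * h)) (at z)"
      using has_derivative_Wirtinger[OF dk(1)[OF z]] dk(2)[OF z] by (simp add: mult.commute)
    then show "(?k has_field_derivative d_z ?k z) (at z within D)"
      by (simp add: has_field_derivative_def has_derivative_at_withinI)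
  qed
  have op: "open {z \<in> D. complex_of_real (b z) \<noteq> 0}"
  proof -
    have "continuous_on D (\<lambda>z. complex_of_real (b z))"
      using differentiable_b open_D
      by (intro differentiable_imp_continuous_on) (simp add: differentiable_on_eq_differentiable_at)
    then have "open (D \<inter> (\<lambda>z. complex_of_real (b z)) -` (- {0}))"
      by (rule continuous_open_preimage) (use open_D in auto)
    also have "D \<inter> (\<lambda>z. complex_of_real (b z)) -` (- {0}) = {z \<in> D. complex_of_real (b z) \<noteq> 0}"
      by auto
    finally show ?thesis .
  qed
  have "?k z = 0"
  proof (rule analytic_continuation_open[OF op open_D _ assms(1) _ hol _ _ assms(3), of "\<lambda>z. 0"])
    show "?k z = 0" if "z \<in> {z \<in> D. complex_of_real (b z) \<noteq> 0}" for z
      using b_mult_c[of z] that by (auto simp: complex_eq_iff)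
  qed (use assms(2) in auto)
  then show ?thesis
    by (metis add_eq_0_iff complex_cnj_add complex_cnj_cnj complex_cnj_minus)
qed

text \<open>The coefficient of the cubic form, \<^term>\<open>bil (vec_d_z P z) (vec_cnj (Q z))\<close>, is determined by
  \<open>a\<close>, \<open>b\<close> and \<open>u\<close> even at zeros of \<open>b\<close>.\<close>

lemma cubic_form:
  assumes "connected D" "\<exists>z\<in>D. b z \<noteq> 0" and z: "z \<in> D"
  shows "bil (vec_d_z P z) (vec_cnj (Q z)) * E z
     = of_real (b z) * d_z a z / 2 - a z * d_z (\<lambda>w. complex_of_real (b w)) z"
    and "vec_d_z P z = - a z *s vec_cnj (g z) + (d_z E z / E z) *s P z + (bil (vec_d_z P z) (vec_cnj (Q z)) / E z) *s Q z"
    and "vec_d_zbar Q z = cnj (a z) *s vec_cnj (g z) - (cnj (bil (vec_d_z P z) (vec_cnj (Q z))) / E z) *s P z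
       + (d_zbar E z / E z) *s Q z"
proof -
  note dg = differentiable_g[OF z] and dP = differentiable_P[OF z] and dQ = differentiable_Q[OF z]
  note dg' = differentiable_vec_cnj[OF dg] and dP' = differentiable_vec_cnj[OF dP] and dQ' = differentiable_vec_cnj[OF dQ]
  note c = c_eq[OF assms]
  let ?B = "bil (vec_d_z P z) (vec_cnj (Q z))"
  have "d_z (\<lambda>w. bil (P w) (vec_cnj (g w))) z = 0" "d_z (\<lambda>w. bil (P w) (g w)) z = 0"
    using Wirtinger_cong(1)[OF open_D z, of _ "\<lambda>w. 0"] bil_P_g horizontal_z by simp_all
  then have Pg: "bil (vec_d_z P z) (vec_cnj (g z)) = 0" "bil (vec_d_z P z) (g z) = - a z"
    by (simp_all add: d_z_bil[OF dP dg'] d_z_bil[OF dP dg] vec_d_z_cnj[OF dg] orthogonal_z_zbar[OF z] bil_z_z[OF z]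
        eq_neg_iff_add_eq_0)
  have "d_zbar (\<lambda>w. bil (Q w) (vec_cnj (g w))) z = 0" "d_zbar (\<lambda>w. bil (Q w) (g w)) z = 0"
    using Wirtinger_cong(2)[OF open_D z, of _ "\<lambda>w. 0"] bil_Q_g horizontal_zbar by simp_all
  then have Qg: "bil (vec_d_zbar Q z) (vec_cnj (g z)) = 0" "bil (vec_d_zbar Q z) (g z) = cnj (a z)"
    by (simp_all add: d_zbar_bil[OF dQ dg'] d_zbar_bil[OF dQ dg] vec_d_zbar_cnj[OF dg] orthogonal_zbar_z[OF z] c)
  have "d_z (\<lambda>w. bil (P w) (vec_cnj (P w))) z = d_z E z"
    by (rule Wirtinger_cong[OF open_D z]) (rule norm_z)
  moreover have "d_zbar (\<lambda>w. bil (Q w) (vec_cnj (Q w))) z = d_zbar E z"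
    by (rule Wirtinger_cong[OF open_D z]) (rule norm_zbar)
  moreover have "d_zbar (\<lambda>w. bil (Q w) (vec_cnj (P w))) z = 0"
    using Wirtinger_cong(2)[OF open_D z, of _ "\<lambda>w. 0"] orthogonal_zbar_z by simp
  ultimately have PP: "bil (vec_d_z P z) (vec_cnj (P z)) = d_z E z" and QQ: "bil (vec_d_zbar Q z) (vec_cnj (Q z)) = d_zbar E z"
    and QP: "bil (vec_d_zbar Q z) (vec_cnj (P z)) = - cnj ?B"
    by (simp_all add: d_z_bil[OF dP dP'] d_zbar_bil[OF dQ dQ'] d_zbar_bil[OF dQ dP'] vec_d_z_cnj[OF dP]
        vec_d_zbar_cnj[OF dP] vec_d_zbar_cnj[OF dQ] vec_d_z_Q[OF z] bil_vec_d_zbar_P[OF z] cnj_bil_vec_cnj eq_neg_iff_add_eq_0)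
  show P_z: "vec_d_z P z = - a z *s vec_cnj (g z) + (d_z E z / E z) *s P z + (?B / E z) *s Q z"
    using frame_expansion[OF z, of "vec_d_z P z"] by (simp add: Pg PP)
  show "vec_d_zbar Q z = cnj (a z) *s vec_cnj (g z) - (cnj ?B / E z) *s P z + (d_zbar E z / E z) *s Q z"
    using frame_expansion[OF z, of "vec_d_zbar Q z"] by (simp add: Qg QP QQ vec_eq_iff)
  have a1: "d_z a z * E z = 2 * (d_z E z * a z + ?B * of_real (b z))"
    using d_z_a[OF z] arg_cong[OF P_z, of "\<lambda>v. bil v (P z)"]
    by (simp add: bil_simps frame_orthogonal[OF z] bil_z_z[OF z] bil_zbar_z[OF z] field_simps)
  have "d_z (\<lambda>w. complex_of_real (b w)) z = d_z (\<lambda>w. bil (P w) (Q w)) z"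
    by (rule Wirtinger_cong[OF open_D z]) (simp add: bil_z_zbar)
  also have "\<dots> = bil (vec_d_z P z) (Q z)"
    by (simp add: d_z_bil[OF dP dQ] vec_d_z_Q[OF z] bil_commute[of "P z"] bil_vec_d_zbar_P[OF z])
  finally have b1: "d_z (\<lambda>w. complex_of_real (b w)) z * E z = d_z E z * of_real (b z) - ?B * cnj (a z)"
    using arg_cong[OF P_z, of "\<lambda>v. bil v (Q z)"]
    by (simp add: bil_simps frame_orthogonal[OF z] bil_z_zbar[OF z] c field_simps)
  \<comment> \<open>\<open>norm_relation\<close> replaces one factor \<open>(E z)\<^sup>2\<close>.
    The resulting combination of \<open>a1\<close> and \<open>b1\<close> is the one in which the
    derivative of \<open>E\<close> drops out, and nothing is divided by \<open>b\<close>.\<close>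
  have "(?B * E z) * E z = ?B * (a z * cnj (a z) + (of_real (b z))\<^sup>2)"
    using norm_relation[OF z] by (simp add: power2_eq_square)
  also have "\<dots> = of_real (b z) * (d_z a z * E z) / 2 - a z * (d_z (\<lambda>w. complex_of_real (b w)) z * E z)"
    unfolding a1 b1 by (simp add: field_simps power2_eq_square)
  also have "\<dots> = (of_real (b z) * d_z a z / 2 - a z * d_z (\<lambda>w. complex_of_real (b w)) z) * E z"
    by (simp add: algebra_simps)
  finally show "?B * E z = of_real (b z) * d_z a z / 2 - a z * d_z (\<lambda>w. complex_of_real (b w)) z"
    by simp
qed

end


text \<open>The candidate for the congruence between two lifts \<open>g\<close>, \<open>h\<close> is the unitary matrix that carries
  the moving frame of \<open>h\<close> to that of \<open>g\<close>; \<open>frame_transfer\<close> is its \<open>j\<close>-th row.\<close>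

definition frame_transfer ::
  "(complex \<Rightarrow> real) \<Rightarrow> (complex \<Rightarrow> complex^4) \<Rightarrow> (complex \<Rightarrow> complex^4) \<Rightarrow> complex \<Rightarrow> 4 \<Rightarrow> complex^4" where
  "frame_transfer u g h z j = g z $ j *s vec_cnj (h z) + cnj (g z $ j) *s h z
     + (vec_d_z g z $ j / of_real (exp (u z))) *s vec_cnj (vec_d_z h z)
     + (vec_d_zbar g z $ j / of_real (exp (u z))) *s vec_cnj (vec_d_zbar h z)"

locale congruent_lifts = g: adapted_lift D g u a b + h: adapted_lift D h u a b for D g h u a b +
  assumes conn: "connected D" and b_nonzero: "\<exists>z\<in>D. b z \<noteq> 0"
begin

abbreviation (input) "E z \<equiv> complex_of_real (exp (u z))"

text \<open>Conjugation acts on the pair formed by the z and zbar derivatives through one symmetric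
  matrix built from \<open>a\<close>, \<open>b\<close> and \<open>E\<close>, the same for both
  lifts. By \<open>norm_relation\<close> this matrix is unitary, so the tangential part of the
  transfer is invariant; the terms with \<open>g\<close> and \<open>h\<close> are visibly
  real.\<close>

lemma frame_transfer_real:
  assumes z: "z \<in> D"
  shows "cnj (frame_transfer u g h z j $ k) = frame_transfer u g h z j $ k"
proof -
  have *: "vec_cnj (vec_d_z f z) = (cnj (a z) / E z) *s vec_d_z f z + (of_real (b z) / E z) *s vec_d_zbar f z"
     "vec_cnj (vec_d_zbar f z) = (of_real (b z) / E z) *s vec_d_z f z - (a z / E z) *s vec_d_zbar f z"
    if "adapted_lift D f u a b" for f
    using adapted_lift.vec_cnj_P[OF that z] adapted_lift.vec_cnj_Q[OF that z] adapted_lift.c_eq[OF that conn b_nonzero z]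
    by simp_all
  have **: "vec_d_z f z $ k = (a z / E z) * cnj (vec_d_z f z $ k) + (of_real (b z) / E z) * cnj (vec_d_zbar f z $ k)"
     "vec_d_zbar f z $ k = (of_real (b z) / E z) * cnj (vec_d_z f z $ k) - (cnj (a z) / E z) * cnj (vec_d_zbar f z $ k)"
     if "adapted_lift D f u a b" for f k
    using arg_cong[OF *(1)[OF that], of "\<lambda>v. cnj (v $ k)"] arg_cong[OF *(2)[OF that], of "\<lambda>v. cnj (v $ k)"]
    by simp_all
  define p q p' q' e \<alpha> \<beta> where "p = vec_d_z g z $ j" and "q = vec_d_zbar g z $ j" and "p' = cnj (vec_d_z h z $ k)"
    and "q' = cnj (vec_d_zbar h z $ k)" and "e = E z" and "\<alpha> = a z" and "\<beta> = complex_of_real (b z)"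
  note defs = this
  have 1: "cnj p = (cnj \<alpha> * p + \<beta> * q) / e" "cnj q = (\<beta> * p - \<alpha> * q) / e"
    using arg_cong[OF *(1)[OF g.adapted_lift_axioms], of "\<lambda>v. v $ j"] arg_cong[OF *(2)[OF g.adapted_lift_axioms], of "\<lambda>v. v $ j"]
    by (simp_all add: defs add_divide_distrib diff_divide_distrib)
  have 2: "cnj p' = (\<alpha> * p' + \<beta> * q') / e" "cnj q' = (\<beta> * p' - cnj \<alpha> * q') / e"
    using **(1)[OF h.adapted_lift_axioms, of k] **(2)[OF h.adapted_lift_axioms, of k]
    by (simp_all add: defs add_divide_distrib diff_divide_distrib)
  have e: "e \<noteq> 0" "\<alpha> * cnj \<alpha> + \<beta> * \<beta> = e * e" "cnj e = e"
    using g.norm_relation[OF z] by (simp_all add: defs power2_eq_square)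
  have "cnj p * cnj p' + cnj q * cnj q' = (p * p' + q * q') * (\<alpha> * cnj \<alpha> + \<beta> * \<beta>) / (e * e)"
    unfolding 1 2 using e(1) by (simp add: field_simps)
  then have "cnj p * cnj p' + cnj q * cnj q' = p * p' + q * q'"
    unfolding e(2) using e(1) by simp
  then have "cnj (p / e * p' + q / e * q') = p / e * p' + q / e * q'"
    by (simp add: e(3) flip: add_divide_distrib)
  then show ?thesis
    by (simp add: frame_transfer_def defs add.commute mult.commute del: vec_Wirtinger_nth)
qed

lemma d_z_frame_transfer:
  assumes z: "z \<in> D"
  shows "(\<lambda>w. frame_transfer u g h w j $ k) differentiable (at z)"
    and "d_z (\<lambda>w. frame_transfer u g h w j $ k) z = 0"
proof -
  let ?F = "\<lambda>w. inverse (E w)"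
  note cf = g.cubic_form[OF conn b_nonzero z] h.cubic_form[OF conn b_nonzero z]
  have dE: "E differentiable (at z)" by (rule g.differentiable_E[OF z])
  have dF: "?F differentiable (at z)"
    using dE by (intro differentiable_inverse) auto
  have "d_z (\<lambda>w. E w * ?F w) z = 0"
    by simp
  then have F: "d_z ?F z = - d_z E z / (E z * E z)"
    unfolding d_z_mult[OF dE dF] by (simp add: field_simps eq_neg_iff_add_eq_0)
  have d: "(\<lambda>w. g w $ j) differentiable (at z)" "(\<lambda>w. h w $ k) differentiable (at z)"
    "(\<lambda>w. vec_d_z g w $ j) differentiable (at z)" "(\<lambda>w. vec_d_zbar g w $ j) differentiable (at z)"
    "(\<lambda>w. vec_d_z h w $ k) differentiable (at z)" "(\<lambda>w. vec_d_zbar h w $ k) differentiable (at z)"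
    using differentiable_vec_nth[OF g.differentiable_g[OF z]] differentiable_vec_nth[OF g.differentiable_P[OF z]]
      differentiable_vec_nth[OF g.differentiable_Q[OF z]] differentiable_vec_nth[OF h.differentiable_g[OF z]]
      differentiable_vec_nth[OF h.differentiable_P[OF z]] differentiable_vec_nth[OF h.differentiable_Q[OF z]]
    by blast+
  note dc = d[THEN differentiable_cnj]
  have K: "(\<lambda>w. frame_transfer u g h w j $ k) = (\<lambda>w. g w $ j * cnj (h w $ k) + cnj (g w $ j) * h w $ k
      + (vec_d_z g w $ j * cnj (vec_d_z h w $ k) + vec_d_zbar g w $ j * cnj (vec_d_zbar h w $ k)) * ?F w)"
    by (simp add: frame_transfer_def fun_eq_iff field_simps del: vec_Wirtinger_nth)
  show "(\<lambda>w. frame_transfer u g h w j $ k) differentiable (at z)"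
    unfolding K using d dc dF by (intro differentiable_add differentiable_mult)
  define p q p' q' e \<alpha> \<beta> where "p = vec_d_z g z $ j" and "q = vec_d_zbar g z $ j" and "p' = cnj (vec_d_z h z $ k)"
    and "q' = cnj (vec_d_zbar h z $ k)" and "e = E z" and "\<alpha> = a z" and "\<beta> = complex_of_real (b z)"
  note defs = this
  define B where "B = bil (vec_d_z (vec_d_z g) z) (vec_cnj (vec_d_zbar g z))"
  have e: "e \<noteq> 0" by (simp add: defs)
  \<comment> \<open>The coefficients of the two cubic forms agree because each, multiplied by
    \<open>E z\<close>, is the same expression in \<open>a\<close>, \<open>b\<close> and their
    derivatives.\<close>
  have B: "bil (vec_d_z (vec_d_z h) z) (vec_cnj (vec_d_zbar h z)) = B"
  proof -
    have "bil (vec_d_z (vec_d_z h) z) (vec_cnj (vec_d_zbar h z)) * E z = B * E z"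
      unfolding B_def cf(1) cf(4) ..
    then show ?thesis by simp
  qed
  define x y Ez where "x = g z $ j" and "y = h z $ k" and "Ez = d_z E z"
  note defs = defs this
  have "cnj (d_zbar E z) = Ez"
    using d_z_cnj[OF dE] by (simp add: defs)
  have vals: "d_z (\<lambda>w. vec_d_z g w $ j) z = - \<alpha> * cnj x + (Ez / e) * p + (B / e) * q"
    "d_z (\<lambda>w. vec_d_zbar g w $ j) z = - e * x - \<beta> * cnj x"
    "d_zbar (\<lambda>w. vec_d_z h w $ k) z = - e * y - \<beta> * cnj y"
    "d_zbar (\<lambda>w. vec_d_zbar h w $ k) z = cnj \<alpha> * cnj y - (cnj B / e) * cnj p' + (cnj Ez / e) * cnj q'"
    using arg_cong[OF cf(2), of "\<lambda>v. v $ j"] arg_cong[OF g.vec_d_z_Q[OF z], of "\<lambda>v. v $ j"]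
      arg_cong[OF g.vec_d_zbar_P[OF z], of "\<lambda>v. v $ j"] arg_cong[OF h.vec_d_zbar_P[OF z], of "\<lambda>v. v $ k"]
      arg_cong[OF cf(6), of "\<lambda>v. v $ k"] \<open>cnj (d_zbar E z) = Ez\<close>[symmetric]
    by (simp_all add: B B_def[symmetric] defs)
  have vals': "d_z (\<lambda>w. g w $ j) z = p" "d_zbar (\<lambda>w. g w $ j) z = q" "d_z (\<lambda>w. h w $ k) z = cnj p'"
    "d_zbar (\<lambda>w. h w $ k) z = cnj q'"
    by (simp_all add: defs)
  have 1: "cnj q = (\<beta> * p - \<alpha> * q) / e" "cnj p' = (\<alpha> * p' + \<beta> * q') / e"
    using arg_cong[OF g.vec_cnj_Q[OF z], of "\<lambda>v. v $ j"] g.c_eq[OF conn b_nonzero z]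
      arg_cong[OF h.vec_cnj_P[OF z], of "\<lambda>v. cnj (v $ k)"]
    by (simp_all add: defs add_divide_distrib diff_divide_distrib)
  have [simp]: "cnj e = e" by (simp add: defs)
  have [simp]: "cnj \<beta> = \<beta>" by (simp add: defs)
  have "d_z (\<lambda>w. frame_transfer u g h w j $ k) z = p * cnj y + x * q' + cnj q * y + cnj x * cnj p'
      + ((- \<alpha> * cnj x + (Ez / e) * p + (B / e) * q) * p' + p * (- e * cnj y - \<beta> * y)
        + (- e * x - \<beta> * cnj x) * q' + q * (\<alpha> * y - (B / e) * p' + (Ez / e) * q')) / e
      - (p * p' + q * q') * Ez / (e * e)"
    unfolding K using d dc dF
    by (simp add: d_z_add d_z_mult d_z_cnj vals vals' F del: vec_Wirtinger_nth)
      (simp add: defs field_simps)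
  \<comment> \<open>Once the conjugates \<open>cnj q\<close> and \<open>cnj p'\<close> are written
    in terms of \<open>p\<close>, \<open>q\<close>, \<open>p'\<close>, \<open>q'\<close>, all terms
    cancel: those with \<open>B\<close> in pairs, those with \<open>Ez\<close> against the
    derivative of \<open>1 / E\<close>.\<close>
  also have "\<dots> = 0"
    unfolding 1 using e by (simp add: field_simps)
  finally show "d_z (\<lambda>w. frame_transfer u g h w j $ k) z = 0" .
qed

lemma frame_transfer_const:
  assumes "z \<in> D" "w \<in> D"
  shows "frame_transfer u g h z j = frame_transfer u g h w j"
proof -
  have "frame_transfer u g h z j $ k = frame_transfer u g h w j $ k" for k
  proof (rule has_derivative_zero_unique_connected[OF g.open_D conn _ assms])
    fix x assume x: "x \<in> D"
    let ?K = "\<lambda>w. frame_transfer u g h w j $ k"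
    note d = d_z_frame_transfer[OF x, of j k]
    \<comment> \<open>The entry is real, so its two Wirtinger derivatives are conjugate to each
      other and both vanish.\<close>
    have "d_zbar ?K x = d_zbar (\<lambda>w. cnj (?K w)) x"
      by (rule Wirtinger_cong[OF g.open_D x]) (simp add: frame_transfer_real)
    also have "\<dots> = 0"
      using d by (simp add: d_zbar_cnj)
    finally show "(?K has_derivative (\<lambda>h. 0)) (at x)"
      using has_derivative_Wirtinger[OF d(1)] d(2) by simp
  qed
  then show ?thesis by (simp add: vec_eq_iff)
qed

text \<open>The orthogonality of the frame of \<open>h\<close> reduces the product of two rows to
  the completeness sum of the frame of \<open>g\<close>.\<close>

lemma bil_frame_transfer:
  assumes z: "z \<in> D"
  shows "bil (frame_transfer u g h z j) (h z) = g z $ j"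
    and "bil (frame_transfer u g h z j) (vec_cnj (frame_transfer u g h z i)) = (if j = i then 1 else 0)"
proof -
  note orth = h.frame_orthogonal[OF z] h.horizontal_z[OF z] h.horizontal_zbar[OF z] h.bil_P_g[OF z]
    h.bil_Q_g[OF z] h.unit[OF z] h.null[OF z]
  show "bil (frame_transfer u g h z j) (h z) = g z $ j"
    by (simp add: frame_transfer_def bil_simps orth del: vec_Wirtinger_nth)
  have orth': "bil (vec_cnj (vec_d_z h z)) (vec_d_z h z) = E z" "bil (vec_cnj (vec_d_zbar h z)) (vec_d_zbar h z) = E z"
    "bil (vec_cnj (vec_d_z h z)) (vec_d_zbar h z) = 0" "bil (vec_cnj (vec_d_zbar h z)) (vec_d_z h z) = 0"
    using h.norm_z[OF z] h.norm_zbar[OF z] h.orthogonal_z_zbar[OF z] h.orthogonal_zbar_z[OF z]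
    by (metis bil_commute)+
  show "bil (frame_transfer u g h z j) (vec_cnj (frame_transfer u g h z i)) = (if j = i then 1 else 0)"
    unfolding g.frame_complete[OF z, symmetric]
    by (simp add: frame_transfer_def bil_simps vec_cnj_simps orth orth' add_divide_distrib mult.commute del: vec_Wirtinger_nth)
qed

lemma congruent:
  "\<exists>A :: real^4^4. orthogonal_matrix A \<and> (\<forall>z\<in>D. g z = map_matrix complex_of_real A *v h z)"
proof -
  obtain z0 where z0: "z0 \<in> D" using b_nonzero by auto
  define A :: "real^4^4" where "A = (\<chi> j k. Re (frame_transfer u g h z0 j $ k))"
  have A: "complex_of_real (A $ j $ k) = frame_transfer u g h z j $ k" if z: "z \<in> D" for z j k
  proof -
    have "Im (frame_transfer u g h z0 j $ k) = 0"
      using frame_transfer_real[OF z0, of j k] by (simp add: complex_eq_iff)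
    then show ?thesis
      unfolding frame_transfer_const[OF z z0] by (simp add: A_def complex_eq_iff)
  qed
  have "g z = map_matrix complex_of_real A *v h z" if z: "z \<in> D" for z
    using bil_frame_transfer(1)[OF z]
    by (simp add: vec_eq_iff matrix_vector_mult_def map_matrix_def A[OF z] bil_def)
  moreover have "A ** transpose A = mat 1"
  proof -
    have "complex_of_real ((A ** transpose A) $ j $ i) = complex_of_real (mat 1 $ j $ i)" for i j
      using bil_frame_transfer(2)[OF z0, of j i]
      by (simp add: matrix_matrix_mult_def transpose_def A[OF z0] bil_def frame_transfer_real[OF z0] mat_def)
    then show ?thesis by (simp add: vec_eq_iff del: of_real_eq_iff) (simp add: of_real_eq_iff)
  qed
  ultimately show ?thesis
    using orthogonal_matrix_def[of A] matrix_left_right_inverse[of A] by blast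
qed

end

subsection \<open>Lifts from solutions of the frame equations\<close>

text \<open>No induction is necessary: the derivative is a product with the power of exponent -1,
  which is already known to be smooth.\<close>

lemma smooth_on_ln:
  fixes g :: "complex \<Rightarrow> real"
  assumes "open S" "smooth_on S g" "\<And>z. z \<in> S \<Longrightarrow> g z > 0"
  shows "smooth_on S (\<lambda>z. ln (g z))"
proof -
  have "Ck_on (Suc k) S (\<lambda>z. ln (g z))" for k
  proof -
    have "Ck_on (Suc k) S g" using assms(2) by (simp add: smooth_on_def)
    note g = Ck_on_SucE[OF this assms(1)]
    have d: "((\<lambda>z. ln (g z)) has_derivative (\<lambda>h. frechet_derivative g (at z) h * g z powr (- 1))) (at z)"
      if "z \<in> S" for z
      by (rule has_derivative_eq_rhs[OF has_derivative_ln[OF assms(3)[OF that] g(1)[OF that]]])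
        (use assms(3)[OF that] in \<open>simp add: powr_minus\<close>)
    have p: "Ck_on k S (\<lambda>z. g z powr (- 1))"
      using smooth_on_powr[OF assms, of "- 1"] unfolding smooth_on_def by blast
    show ?thesis
      by (rule Ck_on_SucI[OF assms(1) d]) (assumption | rule Ck_on_bilinear[OF bounded_bilinear_mult assms(1)] g p)+
  qed
  then show ?thesis
    unfolding smooth_on_def using Ck_on_SucD by blast
qed

lemma d_zbar_exp_of_real:
  fixes v :: "complex \<Rightarrow> real"
  assumes "(\<lambda>w. complex_of_real (v w)) differentiable (at z)"
  shows "d_zbar (\<lambda>w. complex_of_real (exp (c * v w))) z
      = of_real c * of_real (exp (c * v z)) * d_zbar (\<lambda>w. complex_of_real (v w)) z"
proof -
  let ?V = "\<lambda>w. complex_of_real (v w)"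
  have exp: "exp (of_real c * ?V w) = of_real (exp (c * v w))" for w
    by (metis exp_of_real of_real_mult)
  have 1: "((\<lambda>w. of_real c * ?V w) has_derivative (\<lambda>h. of_real c * (h * d_z ?V z + cnj h * d_zbar ?V z))) (at z)"
    by (rule has_derivative_mult_right[OF has_derivative_Wirtinger[OF assms]])
  have 2: "(exp has_derivative (\<lambda>h. exp (of_real c * ?V z) * h)) (at (of_real c * ?V z))"
    using DERIV_exp[of "of_real c * ?V z"] unfolding has_field_derivative_def .
  have "((\<lambda>w. exp (of_real c * ?V w)) has_derivative
      (\<lambda>h. h * (of_real c * of_real (exp (c * v z)) * d_z ?V z)
         + cnj h * (of_real c * of_real (exp (c * v z)) * d_zbar ?V z))) (at z)"
    by (rule has_derivative_eq_rhs[OF has_derivative_compose[OF 1 2]])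
      (simp add: exp fun_eq_iff algebra_simps del: of_real_mult)
  then have 3: "((\<lambda>w. complex_of_real (exp (c * v w))) has_derivative
      (\<lambda>h. h * (of_real c * of_real (exp (c * v z)) * d_z ?V z)
         + cnj h * (of_real c * of_real (exp (c * v z)) * d_zbar ?V z))) (at z)"
    unfolding exp .
  from Wirtinger_unique(2)[OF 3] show ?thesis .
qed

text \<open>The entries \<open>p\<close>, \<open>q\<close> of the first row of a solution in \<open>SU(2)\<close> of the frame equation, with
  \<open>e = exp (uhat / 2)\<close>, \<open>\<omega> = d_z uhat / 4\<close> and \<open>\<kappa> = sqrt 2 / 2 * inverse lam\<close>; the second row is
  \<open>(- cnj q, cnj p)\<close>.\<close>

definition frame_system :: "complex set \<Rightarrow> (complex \<Rightarrow> complex) \<Rightarrow> (complex \<Rightarrow> complex) \<Rightarrow> (complex \<Rightarrow> complex) \<Rightarrow>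
    complex \<Rightarrow> (complex \<Rightarrow> complex) \<Rightarrow> (complex \<Rightarrow> complex) \<Rightarrow> bool" where
  "frame_system D e a \<omega> \<kappa> p q \<longleftrightarrow> (\<forall>z\<in>D. p differentiable (at z) \<and> q differentiable (at z) \<and>
     p z * cnj (p z) + q z * cnj (q z) = 1 \<and>
     d_z p z = \<omega> z * p z + \<kappa> * (a z / e z) * q z \<and>
     d_z q z = - \<kappa> * e z * p z - \<omega> z * q z \<and>
     d_zbar p z = - cnj (\<omega> z) * p z + cnj \<kappa> * e z * q z \<and>
     d_zbar q z = - cnj \<kappa> * (cnj (a z) / e z) * p z + cnj (\<omega> z) * q z)"

lemma frame_systemD:
  assumes "frame_system D e a \<omega> \<kappa> p q" "z \<in> D"
  shows "p differentiable (at z)" "q differentiable (at z)"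
    "p z * cnj (p z) + q z * cnj (q z) = 1"
    "d_z p z = \<omega> z * p z + \<kappa> * (a z / e z) * q z"
    "d_z q z = - \<kappa> * e z * p z - \<omega> z * q z"
    "d_zbar p z = - cnj (\<omega> z) * p z + cnj \<kappa> * e z * q z"
    "d_zbar q z = - cnj \<kappa> * (cnj (a z) / e z) * p z + cnj (\<omega> z) * q z"
  using assms by (auto simp: frame_system_def)

text \<open>The equations express the derivatives of \<open>p\<close> and \<open>q\<close> through
  \<open>p\<close>, \<open>q\<close> and smooth coefficients, so each order of differentiability
  yields the next. Division by \<open>e\<close> enters as multiplication by its inverse, whose
  smoothness is a separate assumption.\<close>

lemma frame_system_smooth:
  assumes D: "open D" and e: "smooth_on D e" and f: "smooth_on D (\<lambda>z. inverse (e z))"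
    and a: "smooth_on D a" and \<omega>: "smooth_on D \<omega>" and sys: "frame_system D e a \<omega> \<kappa> p q"
  shows "smooth_on D p" "smooth_on D q"
proof -
  note s = frame_systemD[OF sys]
  let ?dp = "\<lambda>z h. h * (\<omega> z * p z + \<kappa> * (a z * inverse (e z)) * q z)
      + cnj h * (- (cnj (\<omega> z) * p z) + cnj \<kappa> * e z * q z)"
  let ?dq = "\<lambda>z h. h * (- (\<kappa> * e z * p z) + - (\<omega> z * q z))
      + cnj h * (- (cnj \<kappa> * (cnj (a z) * inverse (e z)) * p z) + cnj (\<omega> z) * q z)"
  have d: "(p has_derivative ?dp z) (at z)" "(q has_derivative ?dq z) (at z)" if "z \<in> D" for z
    by (rule has_derivative_eq_rhs[OF has_derivative_Wirtinger], use s[OF that] in \<open>simp_all add: divide_inverse\<close>)+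
  have C: "Ck_on k D e" "Ck_on k D (\<lambda>z. inverse (e z))" "Ck_on k D a" "Ck_on k D \<omega>"
    "Ck_on k D (\<lambda>z. cnj (a z))" "Ck_on k D (\<lambda>z. cnj (\<omega> z))" for k
    using e f a \<omega> smooth_on_cnj[OF D a] smooth_on_cnj[OF D \<omega>] by (simp_all add: smooth_on_def)
  have "Ck_on k D p \<and> Ck_on k D q" for k
  proof (induction k)
    case 0
    have "p differentiable_on D" "q differentiable_on D"
      using s D by (auto simp: differentiable_on_eq_differentiable_at)
    then show ?case by (simp add: differentiable_imp_continuous_on)
  next
    case (Suc k)
    then have pq: "Ck_on k D p" "Ck_on k D q" by simp_all
    note mult = Ck_on_bilinear[OF bounded_bilinear_mult D]
    note minus = Ck_on_bounded_linear[OF bounded_linear_minus[OF bounded_linear_ident] D]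
    note rules = mult minus Ck_on_add[OF D] Ck_on_const C pq
    have "Ck_on k D (\<lambda>z. ?dp z h)" "Ck_on k D (\<lambda>z. ?dq z h)" for h
      by (assumption | rule rules)+
    then show ?case
      using Ck_on_SucI[OF D d(1)] Ck_on_SucI[OF D d(2)] by blast
  qed
  then show "smooth_on D p" "smooth_on D q" by (simp_all add: smooth_on_def)
qed

text \<open>The vector of \<open>\<complex>\<^sup>4\<close> that the complex linear extension of \<^const>\<open>quat\<close> maps to the matrix
  with entries \<open>x\<^sub>i y\<^sub>j\<close>. Under this extension \<^const>\<open>bil\<close> is the polarisation of the determinant.\<close>

definition tensor :: "complex \<Rightarrow> complex \<Rightarrow> complex \<Rightarrow> complex \<Rightarrow> complex^4" where
  "tensor x1 x2 y1 y2 = vector [(x1 * y1 + x2 * y2) / 2, - \<i> * (x1 * y1 - x2 * y2) / 2,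
     (x1 * y2 - x2 * y1) / 2, - \<i> * (x1 * y2 + x2 * y1) / 2]"

lemma tensor_nth [simp]:
  "tensor x1 x2 y1 y2 $ 1 = (x1 * y1 + x2 * y2) / 2" "tensor x1 x2 y1 y2 $ 2 = - \<i> * (x1 * y1 - x2 * y2) / 2"
  "tensor x1 x2 y1 y2 $ 3 = (x1 * y2 - x2 * y1) / 2" "tensor x1 x2 y1 y2 $ 4 = - \<i> * (x1 * y2 + x2 * y1) / 2"
  by (simp_all add: tensor_def)

lemma bil_tensor:
  "bil (tensor x1 x2 y1 y2) (tensor x1' x2' y1' y2') = (x1 * x2' - x2 * x1') * (y1 * y2' - y2 * y1') / 2"
  by (simp add: bil_def sum_4 field_simps)

text \<open>The real structure of the complexified quaternions is the tensor product of the
  quaternionic structures \<open>(x1, x2) \<mapsto> (cnj x2, - cnj x1)\<close> of the two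
  factors.\<close>

lemma vec_cnj_tensor: "vec_cnj (tensor x1 x2 y1 y2) = tensor (cnj x2) (- cnj x1) (cnj y2) (- cnj y1)"
  by (simp add: vec_eq_iff forall_4 field_simps)

lemma
  assumes "x1 differentiable (at z)" "x2 differentiable (at z)" "y1 differentiable (at z)" "y2 differentiable (at z)"
  shows differentiable_tensor: "(\<lambda>w. tensor (x1 w) (x2 w) (y1 w) (y2 w)) differentiable (at z)"
    and vec_d_z_tensor: "vec_d_z (\<lambda>w. tensor (x1 w) (x2 w) (y1 w) (y2 w)) z
      = tensor (d_z x1 z) (d_z x2 z) (y1 z) (y2 z) + tensor (x1 z) (x2 z) (d_z y1 z) (d_z y2 z)"
    and vec_d_zbar_tensor: "vec_d_zbar (\<lambda>w. tensor (x1 w) (x2 w) (y1 w) (y2 w)) z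
      = tensor (d_zbar x1 z) (d_zbar x2 z) (y1 z) (y2 z) + tensor (x1 z) (x2 z) (d_zbar y1 z) (d_zbar y2 z)"
proof -
  have nth: "tensor (x1 w) (x2 w) (y1 w) (y2 w) $ 1 = (1/2) * (x1 w * y1 w + x2 w * y2 w)"
    "tensor (x1 w) (x2 w) (y1 w) (y2 w) $ 2 = (- \<i>/2) * (x1 w * y1 w - x2 w * y2 w)"
    "tensor (x1 w) (x2 w) (y1 w) (y2 w) $ 3 = (1/2) * (x1 w * y2 w - x2 w * y1 w)"
    "tensor (x1 w) (x2 w) (y1 w) (y2 w) $ 4 = (- \<i>/2) * (x1 w * y2 w + x2 w * y1 w)" for w
    by simp_all
  have "\<forall>k. (\<lambda>w. tensor (x1 w) (x2 w) (y1 w) (y2 w) $ k) differentiable (at z)"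
    unfolding forall_4 nth using assms
    by (intro conjI differentiable_mult differentiable_add differentiable_diff differentiable_const)
  then show "(\<lambda>w. tensor (x1 w) (x2 w) (y1 w) (y2 w)) differentiable (at z)"
    by (intro differentiable_vecI) simp
  note c = differentiable_const[of _ "at z :: complex filter"]
  note d = assms differentiable_mult[OF assms(1,3)] differentiable_mult[OF assms(2,4)]
    differentiable_mult[OF assms(1,4)] differentiable_mult[OF assms(2,3)]
  note d' = d differentiable_add[OF d(5,6)] differentiable_diff[OF d(5,6)] differentiable_diff[OF d(7,8)]
    differentiable_add[OF d(7,8)]
  show "vec_d_z (\<lambda>w. tensor (x1 w) (x2 w) (y1 w) (y2 w)) z
      = tensor (d_z x1 z) (d_z x2 z) (y1 z) (y2 z) + tensor (x1 z) (x2 z) (d_z y1 z) (d_z y2 z)"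
    unfolding vec_eq_iff forall_4 vec_Wirtinger_nth nth d_z_mult[OF c d'(9)] d_z_mult[OF c d'(10)]
      d_z_mult[OF c d'(11)] d_z_mult[OF c d'(12)] d_z_add[OF d(5,6)] d_z_add[OF d(7,8)] d_z_diff[OF d(5,6)]
      d_z_diff[OF d(7,8)] d_z_mult[OF assms(1,3)] d_z_mult[OF assms(2,4)] d_z_mult[OF assms(1,4)] d_z_mult[OF assms(2,3)]
    by (simp add: field_simps)
  show "vec_d_zbar (\<lambda>w. tensor (x1 w) (x2 w) (y1 w) (y2 w)) z
      = tensor (d_zbar x1 z) (d_zbar x2 z) (y1 z) (y2 z) + tensor (x1 z) (x2 z) (d_zbar y1 z) (d_zbar y2 z)"
    unfolding vec_eq_iff forall_4 vec_Wirtinger_nth nth d_zbar_mult[OF c d'(9)] d_zbar_mult[OF c d'(10)]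
      d_zbar_mult[OF c d'(11)] d_zbar_mult[OF c d'(12)] d_zbar_add[OF d(5,6)] d_zbar_add[OF d(7,8)] d_zbar_diff[OF d(5,6)]
      d_zbar_diff[OF d(7,8)] d_zbar_mult[OF assms(1,3)] d_zbar_mult[OF assms(2,4)] d_zbar_mult[OF assms(1,4)] d_zbar_mult[OF assms(2,3)]
    by (simp add: field_simps)
qed


text \<open>The second system carries \<open>\<i> * \<kappa>\<close> because the inverse of
  \<open>- \<i> * l\<close> is \<open>\<i>\<close> times the inverse of \<open>l\<close>. As
  \<open>e\<close> stands for \<open>exp (uhat / 2)\<close>, the last two assumptions say that
  \<open>exp uhat\<close> plus or minus the square of the modulus of \<alpha> times
  \<open>exp (- uhat)\<close> is twice \<open>exp u\<close> or twice \<beta>.\<close>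

locale frame_pair =
  fixes D :: "complex set" and e a \<omega> :: "complex \<Rightarrow> complex" and \<kappa> :: complex
    and p q r t :: "complex \<Rightarrow> complex" and u b :: "complex \<Rightarrow> real"
  assumes open_D: "open D"
    and sys1: "frame_system D e a \<omega> \<kappa> p q" and sys2: "frame_system D e a \<omega> (\<i> * \<kappa>) r t"
    and \<kappa>: "\<kappa> * cnj \<kappa> = 1 / 2"
    and e_nonzero: "\<And>z. z \<in> D \<Longrightarrow> e z \<noteq> 0" and e_real: "\<And>z. z \<in> D \<Longrightarrow> cnj (e z) = e z"
    and smooth_e: "smooth_on D e" and smooth_inverse_e: "smooth_on D (\<lambda>z. inverse (e z))"
    and smooth_a: "smooth_on D a" and smooth_\<omega>: "smooth_on D \<omega>"
    and d_zbar_e: "\<And>z. z \<in> D \<Longrightarrow> d_zbar e z = 2 * cnj (\<omega> z) * e z"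
    and d_zbar_a: "\<And>z. z \<in> D \<Longrightarrow> d_zbar a z = 0"
    and sum_eq: "\<And>z. z \<in> D \<Longrightarrow> e z * e z + a z * cnj (a z) / (e z * e z) = 2 * of_real (exp (u z))"
    and diff_eq: "\<And>z. z \<in> D \<Longrightarrow> e z * e z - a z * cnj (a z) / (e z * e z) = 2 * of_real (b z)"
begin

text \<open>With F and G the two frames, \<open>eij\<close> is the tensor product of column i of F
  with row j of the inverse of G. It corresponds to the conjugate of the elementary matrix with
  entry 1 at (i, j) by the pair (F, G); since 1 + \<sigma>3 is twice the first of these,
  \<open>e11\<close> spans the line of the lift.\<close>

definition "e11 z = tensor (p z) (- cnj (q z)) (cnj (r z)) (- t z)"
definition "e12 z = tensor (p z) (- cnj (q z)) (cnj (t z)) (r z)"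
definition "e21 z = tensor (q z) (cnj (p z)) (cnj (r z)) (- t z)"
definition "e22 z = tensor (q z) (cnj (p z)) (cnj (t z)) (r z)"

lemmas e_defs = e11_def e12_def e21_def e22_def

lemma vec_cnj_e:
  "vec_cnj (e11 z) = e22 z" "vec_cnj (e22 z) = e11 z"
  "vec_cnj (e12 z) = - e21 z" "vec_cnj (e21 z) = - e12 z"
  unfolding e_defs vec_cnj_tensor by (simp_all add: vec_eq_iff forall_4) (simp_all add: field_simps)

text \<open>The two columns of F and the two rows of the inverse of G have determinant 1, and
  \<open>bil_tensor\<close> is half a product of such determinants.\<close>

lemma bil_e:
  assumes z: "z \<in> D"
  shows "bil (e11 z) (e11 z) = 0" "bil (e12 z) (e12 z) = 0" "bil (e21 z) (e21 z) = 0" "bil (e22 z) (e22 z) = 0"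
    "bil (e11 z) (e22 z) = 1 / 2" "bil (e22 z) (e11 z) = 1 / 2"
    "bil (e12 z) (e21 z) = - 1 / 2" "bil (e21 z) (e12 z) = - 1 / 2"
    "bil (e11 z) (e12 z) = 0" "bil (e11 z) (e21 z) = 0" "bil (e12 z) (e11 z) = 0" "bil (e21 z) (e11 z) = 0"
    "bil (e22 z) (e12 z) = 0" "bil (e22 z) (e21 z) = 0" "bil (e12 z) (e22 z) = 0" "bil (e21 z) (e22 z) = 0"
proof -
  have 1: "p z * cnj (p z) + cnj (q z) * q z = 1" "cnj (r z) * r z + t z * cnj (t z) = 1"
    "cnj (t z) * t z + r z * cnj (r z) = 1" "cnj (p z) * p z + q z * cnj (q z) = 1"
    using frame_systemD(3)[OF sys1 z] frame_systemD(3)[OF sys2 z] by (simp_all add: algebra_simps)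
  then have 2: "- (q z * cnj (q z)) - cnj (p z) * p z = - 1" "- (cnj (t z) * t z) - r z * cnj (r z) = - 1"
    by (simp_all add: algebra_simps)
  show "bil (e11 z) (e11 z) = 0" "bil (e12 z) (e12 z) = 0" "bil (e21 z) (e21 z) = 0" "bil (e22 z) (e22 z) = 0"
    "bil (e11 z) (e22 z) = 1 / 2" "bil (e22 z) (e11 z) = 1 / 2"
    "bil (e12 z) (e21 z) = - 1 / 2" "bil (e21 z) (e12 z) = - 1 / 2"
    "bil (e11 z) (e12 z) = 0" "bil (e11 z) (e21 z) = 0" "bil (e12 z) (e11 z) = 0" "bil (e21 z) (e11 z) = 0"
    "bil (e22 z) (e12 z) = 0" "bil (e22 z) (e21 z) = 0" "bil (e12 z) (e22 z) = 0" "bil (e21 z) (e22 z) = 0"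
    unfolding e_defs bil_tensor by (simp_all add: 1 2)
qed

text \<open>If A and A' are the Maurer-Cartan forms of F and G, differentiating F M (inverse of G)
  produces A M - M A' in place of the constant matrix M. The diagonal terms in \<omega> cancel for
  \<open>e11\<close> and double, with opposite signs, for \<open>e21\<close> and
  \<open>e12\<close>.\<close>

lemma d_e:
  assumes z: "z \<in> D"
  shows "vec_d_z e11 z = (\<kappa> * a z / e z) *s e21 z + (\<i> * \<kappa> * e z) *s e12 z"
    and "vec_d_zbar e11 z = (cnj \<kappa> * e z) *s e21 z - (\<i> * cnj \<kappa> * cnj (a z) / e z) *s e12 z"
    and "vec_d_zbar e21 z = (2 * cnj (\<omega> z)) *s e21 z - (cnj \<kappa> * cnj (a z) / e z) *s (e11 z + \<i> *s e22 z)"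
    and "vec_d_zbar e12 z = - (2 * cnj (\<omega> z)) *s e12 z + (cnj \<kappa> * e z) *s (e22 z + \<i> *s e11 z)"
proof -
  note s1 = frame_systemD[OF sys1 z] and s2 = frame_systemD[OF sys2 z]
  note d = s1(1,2) s2(1,2)
  note dc = d[THEN differentiable_cnj]
  note dm = dc(2)[THEN differentiable_minus] d(4)[THEN differentiable_minus]
  have minus: "d_z (\<lambda>w. - f w) z = - d_z f z" "d_zbar (\<lambda>w. - f w) z = - d_zbar f z"
    if "f differentiable (at z)" for f
    using d_z_diff[OF differentiable_const[of 0] that] d_zbar_diff[OF differentiable_const[of 0] that] by simp_all
  note W = s1(4-7) s2(4-7) d_z_cnj[OF d(1)] d_z_cnj[OF d(2)] d_z_cnj[OF d(3)] d_z_cnj[OF d(4)]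
    d_zbar_cnj[OF d(1)] d_zbar_cnj[OF d(2)] d_zbar_cnj[OF d(3)] d_zbar_cnj[OF d(4)]
    minus(1)[OF d(4)] minus(2)[OF d(4)] minus(1)[OF dc(2)] minus(2)[OF dc(2)]
  have e: "cnj (e z) = e z" "e z \<noteq> 0" using e_real[OF z] e_nonzero[OF z] by auto
  show "vec_d_z e11 z = (\<kappa> * a z / e z) *s e21 z + (\<i> * \<kappa> * e z) *s e12 z"
    unfolding e_defs[abs_def] vec_d_z_tensor[OF d(1) dm(1) dc(3) dm(2)] W
    by (simp add: vec_eq_iff forall_4 e) (simp add: field_simps e(2))
  show "vec_d_zbar e11 z = (cnj \<kappa> * e z) *s e21 z - (\<i> * cnj \<kappa> * cnj (a z) / e z) *s e12 z"
    unfolding e_defs[abs_def] vec_d_zbar_tensor[OF d(1) dm(1) dc(3) dm(2)] W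
    by (simp add: vec_eq_iff forall_4 e) (simp add: field_simps e(2))
  show "vec_d_zbar e21 z = (2 * cnj (\<omega> z)) *s e21 z - (cnj \<kappa> * cnj (a z) / e z) *s (e11 z + \<i> *s e22 z)"
    unfolding e_defs[abs_def] vec_d_zbar_tensor[OF d(2) dc(1) dc(3) dm(2)] W
    by (simp add: vec_eq_iff forall_4 e) (simp add: field_simps e(2))
  show "vec_d_zbar e12 z = - (2 * cnj (\<omega> z)) *s e12 z + (cnj \<kappa> * e z) *s (e22 z + \<i> *s e11 z)"
    unfolding e_defs[abs_def] vec_d_zbar_tensor[OF d(1) dm(1) dc(4) d(3)] W
    by (simp add: vec_eq_iff forall_4 e) (simp add: field_simps e(2))
qed

text \<open>The squared modulus 2 of the constant makes the vector unit, since \<open>e11\<close>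
  has squared norm 1/2. The square \<open>2 * \<i>\<close> of the constant turns the value
  \<open>- \<i> * b / 2\<close> of the product of the two derivatives of \<open>e11\<close> into
  \<open>b\<close>.\<close>

definition "lift z = (1 + \<i>) *s e11 z"

lemma d_lift:
  assumes z: "z \<in> D"
  shows "vec_d_z lift z = (1 + \<i>) *s ((\<kappa> * a z / e z) *s e21 z + (\<i> * \<kappa> * e z) *s e12 z)"
    and "vec_d_zbar lift z = (1 + \<i>) *s ((cnj \<kappa> * e z) *s e21 z - (\<i> * cnj \<kappa> * cnj (a z) / e z) *s e12 z)"
proof -
  note s1 = frame_systemD[OF sys1 z] and s2 = frame_systemD[OF sys2 z]
  have "e11 differentiable (at z)"
    unfolding e11_def[abs_def] using s1(1,2) s2(1,2) by (intro differentiable_tensor differentiable_minus differentiable_cnj)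
  note W = differentiable_const[of "1 + \<i>"] this
  show "vec_d_z lift z = (1 + \<i>) *s ((\<kappa> * a z / e z) *s e21 z + (\<i> * \<kappa> * e z) *s e12 z)"
    "vec_d_zbar lift z = (1 + \<i>) *s ((cnj \<kappa> * e z) *s e21 z - (\<i> * cnj \<kappa> * cnj (a z) / e z) *s e12 z)"
    unfolding lift_def[abs_def] vec_d_z_scale[OF W] vec_d_zbar_scale[OF W] d_e[OF z] by simp_all
qed

lemma smooth_lift: "smooth_on D lift"
proof -
  note s = frame_system_smooth[OF open_D smooth_e smooth_inverse_e smooth_a smooth_\<omega>]
  note s' = s[OF sys1] s[OF sys2]
  have nth: "lift z $ 1 = (1 + \<i>) / 2 * (p z * cnj (r z) + cnj (q z) * t z)"
    "lift z $ 2 = - \<i> * (1 + \<i>) / 2 * (p z * cnj (r z) - cnj (q z) * t z)"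
    "lift z $ 3 = (1 + \<i>) / 2 * (cnj (q z) * cnj (r z) - p z * t z)"
    "lift z $ 4 = \<i> * (1 + \<i>) / 2 * (p z * t z + cnj (q z) * cnj (r z))" for z
    by (simp_all add: lift_def e11_def field_simps)
  have "\<forall>k. smooth_on D (\<lambda>z. lift z $ k)"
    unfolding forall_4 nth
    by (rule conjI smooth_on_const smooth_on_mult[OF open_D] smooth_on_add[OF open_D] smooth_on_diff[OF open_D]
        s' smooth_on_cnj[OF open_D])+
  then show ?thesis
    by (intro smooth_on_vecI open_D) simp
qed

text \<open>The derivatives of the coefficients \<open>a / e\<close> and \<open>e\<close> absorb the
  terms in \<omega> of \<open>e21\<close> and \<open>e12\<close>. Only \<open>e11\<close> and its
  conjugate \<open>e22\<close> remain, and they span the complement of the tangent plane of the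
  quadric.\<close>

lemma vec_d_zbar_vec_d_z_lift:
  assumes z: "z \<in> D"
  shows "vec_d_zbar (vec_d_z lift) z = (- (1 + \<i>) / 2) *s
    ((e z * e z + a z * cnj (a z) / (e z * e z)) *s e11 z - (\<i> * (e z * e z - a z * cnj (a z) / (e z * e z))) *s e22 z)"
proof -
  note s1 = frame_systemD[OF sys1 z] and s2 = frame_systemD[OF sys2 z]
  have "e12 differentiable (at z)"
    unfolding e_defs[abs_def] using s1(1,2) s2(1,2) by (intro differentiable_tensor differentiable_minus differentiable_cnj)
  moreover have "e21 differentiable (at z)"
    unfolding e_defs[abs_def] using s1(1,2) s2(1,2) by (intro differentiable_tensor differentiable_minus differentiable_cnj)
  ultimately have d: "e12 differentiable (at z)" "e21 differentiable (at z)" .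
  have de: "e differentiable (at z)" "(\<lambda>w. inverse (e w)) differentiable (at z)" "a differentiable (at z)"
    by (rule smooth_on_differentiable[OF smooth_e open_D z] smooth_on_differentiable[OF smooth_inverse_e open_D z]
        smooth_on_differentiable[OF smooth_a open_D z])+
  have "d_zbar (\<lambda>w. e w * inverse (e w)) z = d_zbar (\<lambda>w. 1) z"
    by (rule Wirtinger_cong[OF open_D z]) (simp add: e_nonzero)
  then have "e z * d_zbar (\<lambda>w. inverse (e w)) z = - 2 * cnj (\<omega> z)"
    using e_nonzero[OF z] by (simp add: d_zbar_mult[OF de(1,2)] d_zbar_e[OF z] eq_neg_iff_add_eq_0 add.commute mult.assoc)
  then have dinv: "d_zbar (\<lambda>w. inverse (e w)) z = - 2 * cnj (\<omega> z) / e z"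
    using e_nonzero[OF z] by (simp add: field_simps)
  let ?c = "(1 + \<i>) * \<kappa>"
  note dc = differentiable_mult[OF differentiable_const[of ?c] differentiable_mult[OF de(3,2)]]
    differentiable_mult[OF differentiable_const[of "\<i> * ?c"] de(1)]
  have c: "d_zbar (\<lambda>w. ?c * (a w * inverse (e w))) z = - ?c * a z * 2 * cnj (\<omega> z) / e z"
    "d_zbar (\<lambda>w. \<i> * ?c * e w) z = \<i> * ?c * 2 * cnj (\<omega> z) * e z"
    using d_zbar_mult[OF differentiable_const[of ?c] differentiable_mult[OF de(3,2)]]
      d_zbar_mult[OF differentiable_const[of "\<i> * ?c"] de(1)]
    by (simp_all add: d_zbar_mult[OF de(3,2)] d_zbar_a[OF z] d_zbar_e[OF z] dinv)
  have "vec_d_zbar (vec_d_z lift) z = vec_d_zbar (\<lambda>w. (?c * (a w * inverse (e w))) *s e21 w + (\<i> * ?c * e w) *s e12 w) z"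
    unfolding vec_eq_iff vec_Wirtinger_nth
    by (intro allI Wirtinger_cong(2)[OF open_D z]) (simp add: d_lift divide_inverse algebra_simps flip: vec_Wirtinger_nth(1))
  also have "\<dots> = (?c * cnj \<kappa>) *s ((- a z * cnj (a z) / (e z * e z)) *s (e11 z + \<i> *s e22 z)
        + (\<i> * e z * e z) *s (e22 z + \<i> *s e11 z))"
    unfolding vec_d_zbar_add[OF differentiable_vec_scale[OF dc(1) d(2)] differentiable_vec_scale[OF dc(2) d(1)]]
      vec_d_zbar_scale[OF dc(1) d(2)] vec_d_zbar_scale[OF dc(2) d(1)] c d_e[OF z]
    using e_nonzero[OF z] by (simp add: vec_eq_iff field_simps del: tensor_nth)
  also have "?c * cnj \<kappa> = (1 + \<i>) / 2"
    using \<kappa> by (simp add: mult.assoc)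
  also have "((1 + \<i>) / 2) *s ((- a z * cnj (a z) / (e z * e z)) *s (e11 z + \<i> *s e22 z)
        + (\<i> * e z * e z) *s (e22 z + \<i> *s e11 z)) = (- (1 + \<i>) / 2) *s
    ((e z * e z + a z * cnj (a z) / (e z * e z)) *s e11 z - (\<i> * (e z * e z - a z * cnj (a z) / (e z * e z))) *s e22 z)"
    using e_nonzero[OF z] by (simp add: vec_eq_iff field_simps)
  finally show ?thesis .
qed

text \<open>In the product of the z derivative with itself only the pair \<open>e12\<close>,
  \<open>e21\<close> contributes; with the square of \<open>1 + \<i>\<close> this gives
  \<open>2 * \<kappa>\<^sup>2 * a z\<close>. For \<open>\<kappa>\<close> equal to
  \<open>sqrt 2 / 2\<close> times \<open>inverse l\<close> it is the prescribed
  differential.\<close>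

lemma adapted_lift: "adapted_lift D lift u (\<lambda>z. 2 * \<kappa>\<^sup>2 * a z) b"
proof
  fix z assume z: "z \<in> D"
  note simps = bil_simps vec_cnj_simps vec_cnj_e bil_e[OF z] d_lift[OF z] e_real[OF z]
  have u: "of_real (exp (u z)) = (e z * e z + a z * cnj (a z) / (e z * e z)) / 2"
    using sum_eq[OF z] by simp
  have b: "of_real (b z) = (e z * e z - a z * cnj (a z) / (e z * e z)) / 2"
    using diff_eq[OF z] by simp
  have \<kappa>': "\<kappa> * (cnj \<kappa> * x) = x / 2" "cnj \<kappa> * (\<kappa> * x) = x / 2" for x
  proof -
    have "\<kappa> * (cnj \<kappa> * x) = (\<kappa> * cnj \<kappa>) * x" "cnj \<kappa> * (\<kappa> * x) = (\<kappa> * cnj \<kappa>) * x"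
      by (simp_all only: mult_ac)
    then show "\<kappa> * (cnj \<kappa> * x) = x / 2" "cnj \<kappa> * (\<kappa> * x) = x / 2"
      unfolding \<kappa> by simp_all
  qed
  show "bil (lift z) (vec_cnj (lift z)) = 1" "bil (lift z) (lift z) = 0"
    "bil (vec_d_z lift z) (vec_cnj (lift z)) = 0" "bil (vec_d_zbar lift z) (vec_cnj (lift z)) = 0"
    "bil (vec_d_z lift z) (vec_cnj (vec_d_zbar lift z)) = 0"
    by (simp_all add: lift_def simps field_simps)
  show "bil (vec_d_z lift z) (vec_cnj (vec_d_z lift z)) = of_real (exp (u z))"
    "bil (vec_d_zbar lift z) (vec_cnj (vec_d_zbar lift z)) = of_real (exp (u z))"
    "bil (vec_d_z lift z) (vec_d_zbar lift z) = of_real (b z)"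
    unfolding u b using e_nonzero[OF z] by (simp_all add: simps field_simps \<kappa>')
  show "bil (vec_d_z lift z) (vec_d_z lift z) = 2 * \<kappa>\<^sup>2 * a z"
    using e_nonzero[OF z] by (simp add: simps field_simps power2_eq_square)
  have "proj_TQ2 (lift z) (e11 z) = 0" "proj_TQ2 (lift z) (e22 z) = 0"
    by (simp_all add: proj_TQ2_def lift_def simps vec_eq_iff field_simps)
  then show "proj_TQ2 (lift z) (vec_d_zbar (vec_d_z lift) z) = 0"
    unfolding vec_d_zbar_vec_d_z_lift[OF z]
    by (simp add: proj_TQ2_scale proj_TQ2_diff proj_TQ2_add)
qed (rule open_D smooth_lift)+

end

subsection \<open>The extended frame\<close>

lemma mat2_nth [simp]:
  "mat2 a b c d $ 1 $ 1 = a" "mat2 a b c d $ 1 $ 2 = b" "mat2 a b c d $ 2 $ 1 = c" "mat2 a b c d $ 2 $ 2 = d"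
  by (simp_all add: mat2_def)

lemma matrix_mul_2_nth: "(A ** B) $ i $ j = A $ i $ 1 * B $ 1 $ j + A $ i $ 2 * B $ 2 $ j"
  for A B :: "complex^2^2"
  by (simp add: matrix_matrix_mult_def sum_2)

lemma matrix_inv_eqI:
  fixes A :: "complex^2^2"
  assumes "B ** A = mat 1"
  shows "matrix_inv A = B" "A ** matrix_inv A = mat 1"
proof -
  have AB: "A ** B = mat 1"
    using assms matrix_left_right_inverse by blast
  have inv: "A ** matrix_inv A = mat 1 \<and> matrix_inv A ** A = mat 1"
    unfolding matrix_inv_def by (rule someI[of _ B]) (simp add: AB assms)
  then show "A ** matrix_inv A = mat 1" ..
  have "matrix_inv A = matrix_inv A ** (A ** B)"
    by (simp add: AB)
  also have "\<dots> = B"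
    using inv by (simp add: matrix_mul_assoc)
  finally show "matrix_inv A = B" .
qed

text \<open>The adjugate and the conjugate transpose are both left inverses; comparing their entries
  gives the quaternionic shape of the matrix.\<close>

lemma SU2_entries:
  assumes "A \<in> SU2"
  shows "A $ 2 $ 1 = - cnj (A $ 1 $ 2)" "A $ 2 $ 2 = cnj (A $ 1 $ 1)"
    "A $ 1 $ 1 * cnj (A $ 1 $ 1) + A $ 1 $ 2 * cnj (A $ 1 $ 2) = 1"
    "matrix_inv A = mat2 (cnj (A $ 1 $ 1)) (- (A $ 1 $ 2)) (cnj (A $ 1 $ 2)) (A $ 1 $ 1)"
    "A ** matrix_inv A = mat 1"
proof -
  have inv: "transpose (map_matrix cnj A) ** A = mat 1" and det: "A $ 1 $ 1 * A $ 2 $ 2 - A $ 1 $ 2 * A $ 2 $ 1 = 1"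
    using assms by (auto simp: SU2_def det_2)
  have "mat2 (A $ 2 $ 2) (- (A $ 1 $ 2)) (- (A $ 2 $ 1)) (A $ 1 $ 1) ** A = mat 1"
    using det by (simp add: vec_eq_iff forall_2 matrix_mul_2_nth mat_def algebra_simps)
  from matrix_inv_eqI(1)[OF this] have eq: "mat2 (A $ 2 $ 2) (- (A $ 1 $ 2)) (- (A $ 2 $ 1)) (A $ 1 $ 1) = transpose (map_matrix cnj A)"
    using matrix_inv_eqI(1)[OF inv] by simp
  from arg_cong[OF eq, of "\<lambda>M. M $ 1 $ 1"] show 22: "A $ 2 $ 2 = cnj (A $ 1 $ 1)"
    by (simp add: transpose_def map_matrix_def)
  from arg_cong[OF eq, of "\<lambda>M. M $ 2 $ 1"] show 21: "A $ 2 $ 1 = - cnj (A $ 1 $ 2)"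
    by (simp add: transpose_def map_matrix_def minus_equation_iff[of "A $ 2 $ 1"])
  show "A $ 1 $ 1 * cnj (A $ 1 $ 1) + A $ 1 $ 2 * cnj (A $ 1 $ 2) = 1"
    using det by (simp add: 21 22)
  show "A ** matrix_inv A = mat 1"
    by (rule matrix_inv_eqI(2)[OF inv])
  show "matrix_inv A = mat2 (cnj (A $ 1 $ 1)) (- (A $ 1 $ 2)) (cnj (A $ 1 $ 2)) (A $ 1 $ 1)"
    unfolding matrix_inv_eqI(1)[OF inv] eq[symmetric] by (simp add: 21 22)
qed

text \<open>Left multiplication by the quaternion with first row \<open>(p, q)\<close> and right multiplication by the
  inverse of the one with first row \<open>(r, t)\<close>, in the coordinates of \<^const>\<open>quat\<close>.\<close>

definition left_mult :: "complex \<Rightarrow> complex \<Rightarrow> real^4^4" where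
  "left_mult p q = vector
    [vector [Re p, - Im p, - Re q, - Im q], vector [Im p, Re p, - Im q, Re q],
     vector [Re q, Im q, Re p, - Im p], vector [Im q, - Re q, Im p, Re p]]"

definition right_mult :: "complex \<Rightarrow> complex \<Rightarrow> real^4^4" where
  "right_mult r t = vector
    [vector [Re r, Im r, Re t, Im t], vector [- Im r, Re r, - Im t, Re t],
     vector [- Re t, Im t, Re r, - Im r], vector [- Im t, - Re t, Im r, Re r]]"

lemma mult_nth:
  "left_mult p q $ 1 = vector [Re p, - Im p, - Re q, - Im q]" "left_mult p q $ 2 = vector [Im p, Re p, - Im q, Re q]"
  "left_mult p q $ 3 = vector [Re q, Im q, Re p, - Im p]" "left_mult p q $ 4 = vector [Im q, - Re q, Im p, Re p]"
  "right_mult p q $ 1 = vector [Re p, Im p, Re q, Im q]" "right_mult p q $ 2 = vector [- Im p, Re p, - Im q, Re q]"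
  "right_mult p q $ 3 = vector [- Re q, Im q, Re p, - Im p]" "right_mult p q $ 4 = vector [- Im q, - Re q, Im p, Re p]"
  by (simp_all add: left_mult_def right_mult_def)

lemma transpose_mult:
  "transpose (left_mult p q) ** left_mult p q = mat ((Re p)\<^sup>2 + (Im p)\<^sup>2 + (Re q)\<^sup>2 + (Im q)\<^sup>2)"
  "transpose (right_mult p q) ** right_mult p q = mat ((Re p)\<^sup>2 + (Im p)\<^sup>2 + (Re q)\<^sup>2 + (Im q)\<^sup>2)"
  by (simp_all add: vec_eq_iff forall_4 matrix_matrix_mult_def sum_4 transpose_def mult_nth mat_def power2_eq_square)

text \<open>Orthogonality leaves the sign of the determinant open; it is settled by expanding over
  the permutations of the four indices.\<close>

lemma det_mult:
  "det (left_mult p q) = ((Re p)\<^sup>2 + (Im p)\<^sup>2 + (Re q)\<^sup>2 + (Im q)\<^sup>2)\<^sup>2"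
  "det (right_mult p q) = ((Re p)\<^sup>2 + (Im p)\<^sup>2 + (Re q)\<^sup>2 + (Im q)\<^sup>2)\<^sup>2"
proof -
  have f: "finite {2::4, 3, 4}" "1 \<notin> {2::4, 3, 4}" "finite {3::4, 4}" "2 \<notin> {3::4, 4}" "finite {4::4}" "3 \<notin> {4::4}"
    by auto
  show "det (left_mult p q) = ((Re p)\<^sup>2 + (Im p)\<^sup>2 + (Re q)\<^sup>2 + (Im q)\<^sup>2)\<^sup>2"
    unfolding det_def UNIV_4
    unfolding sum_over_permutations_insert[OF f(1,2)]
    unfolding sum_over_permutations_insert[OF f(3,4)]
    unfolding sum_over_permutations_insert[OF f(5,6)]
    unfolding permutes_sing
    by (simp add: sign_swap_id permutation_swap_id permutation_compose sign_compose sign_id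
        transpose_eq_iff mult_nth, simp add: power2_eq_square algebra_simps)
  show "det (right_mult p q) = ((Re p)\<^sup>2 + (Im p)\<^sup>2 + (Re q)\<^sup>2 + (Im q)\<^sup>2)\<^sup>2"
    unfolding det_def UNIV_4
    unfolding sum_over_permutations_insert[OF f(1,2)]
    unfolding sum_over_permutations_insert[OF f(3,4)]
    unfolding sum_over_permutations_insert[OF f(5,6)]
    unfolding permutes_sing
    by (simp add: sign_swap_id permutation_swap_id permutation_compose sign_compose sign_id
        transpose_eq_iff mult_nth, simp add: power2_eq_square algebra_simps)
qed

lemma mult_SO4:
  assumes "p * cnj p + q * cnj q = 1"
  shows "left_mult p q \<in> SO4" "right_mult p q \<in> SO4"
proof -
  have 1: "(Re p)\<^sup>2 + (Im p)\<^sup>2 + (Re q)\<^sup>2 + (Im q)\<^sup>2 = 1"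
    using arg_cong[OF assms, of Re] by (simp add: power2_eq_square)
  have "orthogonal_matrix A \<longleftrightarrow> transpose A ** A = mat 1" for A :: "real^4^4"
    unfolding orthogonal_matrix_def using matrix_left_right_inverse[of A] by blast
  then show "left_mult p q \<in> SO4" "right_mult p q \<in> SO4"
    by (simp_all add: SO4_def transpose_mult det_mult 1)
qed

text \<open>Factoring the action into a left and a right multiplication reduces membership in
  \<open>SO4\<close> to two explicit matrices.\<close>

lemma SO4_of_eq:
  assumes "P \<in> SU2" "Q \<in> SU2"
  shows "SO4_of P Q = right_mult (Q $ 1 $ 1) (Q $ 1 $ 2) ** left_mult (P $ 1 $ 1) (P $ 1 $ 2)"
  unfolding SO4_of_def SU2_entries(4)[OF assms(2)]
  by (simp add: vec_eq_iff forall_4 matrix_def matrix_matrix_mult_def sum_4 quat_inv_def quat_def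
      matrix_mul_2_nth[unfolded matrix_matrix_mult_def] left_mult_def right_mult_def axis_def SU2_entries(1,2)[OF assms(1)] sum_2)

lemma SO4_mult: "A \<in> SO4 \<Longrightarrow> B \<in> SO4 \<Longrightarrow> A ** B \<in> SO4"
  by (simp add: SO4_def orthogonal_matrix_mul det_mul)

text \<open>The first two coordinate vectors correspond to the quaternions 1 and \<open>\<i>\<close>
  times \<sigma>3, whose images under the action are X and Y.\<close>

lemma columns_class_SO4_of:
  assumes "P \<in> SU2" "Q \<in> SU2"
  shows "columns_class (SO4_of P Q)
    = XY_class (P ** matrix_inv Q) (map_matrix ((*) \<i>) (P ** sigma3 ** matrix_inv Q))"
proof -
  have quat: "quat (axis 1 1) = mat 1" "quat (axis 2 1) = map_matrix ((*) \<i>) sigma3"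
    by (simp_all add: vec_eq_iff forall_2 quat_def axis_def mat_def sigma3_def map_matrix_def complex_eq_iff)
  have scale: "P ** map_matrix ((*) \<i>) sigma3 ** matrix_inv Q = map_matrix ((*) \<i>) (P ** sigma3 ** matrix_inv Q)"
    by (simp add: vec_eq_iff matrix_mul_2_nth map_matrix_def algebra_simps)
  have column: "column j (SO4_of P Q) = quat_inv (P ** quat (axis j 1) ** matrix_inv Q)" for j
    by (simp add: vec_eq_iff column_def SO4_of_def matrix_def)
  have "column 1 (SO4_of P Q) = quat_inv (P ** matrix_inv Q)"
    "column 2 (SO4_of P Q) = quat_inv (map_matrix ((*) \<i>) (P ** sigma3 ** matrix_inv Q))"
    unfolding column quat scale by simp_all
  then show ?thesis
    unfolding columns_class_def XY_class_def
    by (intro arg_cong[where f = proj_class]) (simp add: vec_eq_iff forall_4 quat_inv_def complex_eq_iff)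
qed


section \<open>From the frame equation to the rank one lift\<close>

lemma cnj_inverse_unit:
  assumes "cmod l = 1"
  shows "cnj (inverse l) = l"
proof -
  have "l * cnj l = 1"
    using assms by (simp add: complex_norm_square[symmetric])
  then have "inverse l = cnj l"
    by (rule inverse_unique)
  then show ?thesis by simp
qed

text \<open>Multiplying the equation by F and reading off the first row gives the system. Its dzbar
  coefficients appear as conjugates because \<open>uh\<close> is real and \<open>l\<close> has
  modulus 1.\<close>

lemma extended_frame_system:
  assumes "extended_frame D uh a F" "cmod l = 1"
    and uh: "\<And>z. z \<in> D \<Longrightarrow> (\<lambda>w. complex_of_real (uh w)) differentiable (at z)"
  shows "frame_system D (\<lambda>z. of_real (exp (uh z / 2))) a (\<lambda>z. d_z (\<lambda>w. complex_of_real (uh w)) z / 4)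
     (of_real (sqrt 2 / 2) * inverse l) (\<lambda>z. F l z $ 1 $ 1) (\<lambda>z. F l z $ 1 $ 2)"
  unfolding frame_system_def
proof (intro ballI)
  fix z assume z: "z \<in> D"
  have SU: "F l z \<in> SU2" and diff: "F l differentiable (at z)"
    and F: "\<And>h. matrix_inv (F l z) ** frechet_derivative (F l) (at z) h
             = map_matrix ((*) h) (frame_U uh a l z) + map_matrix ((*) (cnj h)) (frame_V uh a l z)"
    using assms z by (auto simp: extended_frame_def)
  note S = SU2_entries[OF SU]
  have dF: "frechet_derivative (F l) (at z) h
     = F l z ** (map_matrix ((*) h) (frame_U uh a l z) + map_matrix ((*) (cnj h)) (frame_V uh a l z))" for h
    unfolding F[symmetric] by (simp add: matrix_mul_assoc S(5))
  have W: "((\<lambda>w. F l w $ 1 $ j) has_derivative (\<lambda>h.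
      h * (F l z $ 1 $ 1 * frame_U uh a l z $ 1 $ j + F l z $ 1 $ 2 * frame_U uh a l z $ 2 $ j)
    + cnj h * (F l z $ 1 $ 1 * frame_V uh a l z $ 1 $ j + F l z $ 1 $ 2 * frame_V uh a l z $ 2 $ j))) (at z)" for j
  proof -
    have "(F l has_derivative frechet_derivative (F l) (at z)) (at z)"
      using diff frechet_derivative_works by blast
    then have "((\<lambda>w. F l w $ 1 $ j) has_derivative (\<lambda>h. frechet_derivative (F l) (at z) h $ 1 $ j)) (at z)"
      by (intro bounded_linear.has_derivative[OF bounded_linear_vec_nth])
    then show ?thesis
      by (rule has_derivative_eq_rhs)
        (simp add: dF fun_eq_iff matrix_mul_2_nth map_matrix_def algebra_simps)
  qed
  have d: "(\<lambda>w. F l w $ 1 $ j) differentiable (at z)" for j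
    using W[of j] unfolding differentiable_def by blast
  note cnj_l = cnj_inverse_unit[OF assms(2)]
  have conj_uh: "d_zbar (\<lambda>w. complex_of_real (uh w)) z = cnj (d_z (\<lambda>w. complex_of_real (uh w)) z)"
    using d_zbar_cnj[OF uh[OF z]] by simp
  have exp: "complex_of_real (exp (- (uh z / 2))) = 1 / of_real (exp (uh z / 2))"
    by (simp add: exp_minus inverse_eq_divide)
  show "(\<lambda>z. F l z $ 1 $ 1) differentiable at z \<and> (\<lambda>z. F l z $ 1 $ 2) differentiable at z \<and>
      F l z $ 1 $ 1 * cnj (F l z $ 1 $ 1) + F l z $ 1 $ 2 * cnj (F l z $ 1 $ 2) = 1 \<and>
      d_z (\<lambda>z. F l z $ 1 $ 1) z = d_z (\<lambda>w. complex_of_real (uh w)) z / 4 * F l z $ 1 $ 1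
        + of_real (sqrt 2 / 2) * inverse l * (a z / of_real (exp (uh z / 2))) * F l z $ 1 $ 2 \<and>
      d_z (\<lambda>z. F l z $ 1 $ 2) z = - (of_real (sqrt 2 / 2) * inverse l) * of_real (exp (uh z / 2)) * F l z $ 1 $ 1
        - d_z (\<lambda>w. complex_of_real (uh w)) z / 4 * F l z $ 1 $ 2 \<and>
      d_zbar (\<lambda>z. F l z $ 1 $ 1) z = - cnj (d_z (\<lambda>w. complex_of_real (uh w)) z / 4) * F l z $ 1 $ 1
        + cnj (of_real (sqrt 2 / 2) * inverse l) * of_real (exp (uh z / 2)) * F l z $ 1 $ 2 \<and>
      d_zbar (\<lambda>z. F l z $ 1 $ 2) z = - cnj (of_real (sqrt 2 / 2) * inverse l) * (cnj (a z) / of_real (exp (uh z / 2))) * F l z $ 1 $ 1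
        + cnj (d_z (\<lambda>w. complex_of_real (uh w)) z / 4) * F l z $ 1 $ 2"
    unfolding Wirtinger_unique[OF W] complex_cnj_mult cnj_l
    by (simp add: d S(3) frame_U_def frame_V_def Let_def conj_uh exp del: complex_cnj_inverse of_real_divide)
      (simp add: field_simps)
qed

lemma proj_class_eq_range: "proj_class v = range (\<lambda>c. c *s v)"
  by (auto simp: proj_class_def)

lemma proj_class_scale:
  assumes "c \<noteq> 0"
  shows "proj_class (c *s v) = proj_class v"
proof -
  have "surj (\<lambda>k. k * c)"
    using assms by (intro surjI[of _ "\<lambda>k. k / c"]) simp
  then have "range (\<lambda>k. k *s v) = (\<lambda>k. k *s v) ` range (\<lambda>k. k * c)"
    by simp
  then show ?thesis
    by (simp add: proj_class_eq_range image_image vector_smult_assoc)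
qed

text \<open>Under the identification with matrices, X + i Y is F (1 - \<sigma>3) (inverse of G),
  where F is \<open>P\<close> and G is \<open>Q\<close>. This is twice \<open>e22\<close>, the
  conjugate of \<open>e11\<close>. Since \<open>(1 + \<i>) * cnj (1 + \<i>) = 2\<close>, the
  representing vector is \<open>1 + \<i>\<close> times the conjugate of the lift.\<close>

lemma XY_class_eq:
  assumes "P \<in> SU2" "Q \<in> SU2"
  shows "XY_class (P ** matrix_inv Q) (map_matrix ((*) \<i>) (P ** sigma3 ** matrix_inv Q))
     = proj_class (vec_cnj ((1 + \<i>) *s tensor (P $ 1 $ 1) (- cnj (P $ 1 $ 2)) (cnj (Q $ 1 $ 1)) (- (Q $ 1 $ 2))))"
  (is "_ = proj_class ?v")
proof -
  have "XY_class (P ** matrix_inv Q) (map_matrix ((*) \<i>) (P ** sigma3 ** matrix_inv Q)) = proj_class ((1 + \<i>) *s ?v)"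
    unfolding XY_class_def
    by (intro arg_cong[where f = proj_class],
      simp add: vec_eq_iff forall_4 SU2_entries(4)[OF assms(2)] matrix_mul_2_nth map_matrix_def sigma3_def
        complex_eq_iff algebra_simps, simp add: field_simps)
  also have "1 + \<i> \<noteq> 0"
    by (simp add: complex_eq_iff)
  then have "proj_class ((1 + \<i>) *s ?v) = proj_class ?v"
    by (rule proj_class_scale)
  finally show ?thesis .
qed

text \<open>The map is antilinear, yet it carries a complex line onto a complex line, since the
  conjugated scalars exhaust the complex numbers.\<close>

lemma image_proj_class_cnj:
  "(\<lambda>v. A *v vec_cnj v) ` proj_class v = proj_class (A *v vec_cnj v)" for A :: "complex^4^4"
proof -
  have "A *v vec_cnj (c *s v) = cnj c *s (A *v vec_cnj v)" for c
    by (simp add: vec_cnj_scale matrix_vector_mult_def vec_eq_iff sum_distrib_left mult.left_commute)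
  then have "(\<lambda>v. A *v vec_cnj v) ` proj_class v = (\<lambda>c. c *s (A *v vec_cnj v)) ` range cnj"
    by (simp add: proj_class_eq_range image_image)
  also have "range cnj = UNIV"
    by (metis complex_cnj_cnj surjI)
  finally show ?thesis
    by (simp add: proj_class_eq_range)
qed

context
  fixes D :: "complex set"
    and fhat :: "complex \<Rightarrow> complex^4"
    and u uhat betahat :: "complex \<Rightarrow> real"
    and alphahat :: "complex \<Rightarrow> complex"
    and F :: "complex \<Rightarrow> complex \<Rightarrow> complex^2^2"
  assumes base: "adapted_lift D fhat u alphahat betahat"
    and nonneg: "\<And>z. z \<in> D \<Longrightarrow> betahat z \<ge> 0"
    and uhat: "\<And>z. z \<in> D \<Longrightarrow> uhat z = ln (exp (u z) + betahat z)"
    and frame: "extended_frame D uhat alphahat F"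
begin

interpretation adapted_lift D fhat u alphahat betahat by (rule base)

lemma frame_lift:
  assumes l: "cmod l = 1"
  shows "adapted_lift D (\<lambda>z. (1 + \<i>) *s tensor (F l z $ 1 $ 1) (- cnj (F l z $ 1 $ 2))
      (cnj (F (- \<i> * l) z $ 1 $ 1)) (- (F (- \<i> * l) z $ 1 $ 2))) u (\<lambda>z. inverse (l\<^sup>2) * alphahat z) betahat"
proof -
  let ?w = "\<lambda>z. exp (u z) + betahat z"
  let ?e = "\<lambda>z. complex_of_real (exp (uhat z / 2))"
  let ?\<omega> = "\<lambda>z. d_z (\<lambda>w. complex_of_real (uhat w)) z / 4"
  let ?\<kappa> = "of_real (sqrt 2 / 2) * inverse l"
  have w_pos: "?w z > 0" if "z \<in> D" for z
    using nonneg[OF that] by (simp add: add_pos_nonneg)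
  have "smooth_on D (\<lambda>z. Re (complex_of_real (exp (u z)) + complex_of_real (betahat z)))"
    by (intro smooth_on_Re smooth_on_add smooth_E smooth_b open_D)
  then have smooth_w: "smooth_on D ?w"
    by simp
  have "smooth_on D (\<lambda>z. complex_of_real (ln (?w z)))"
    by (intro smooth_on_of_real smooth_on_ln smooth_w w_pos open_D)
  then have smooth_uhat: "smooth_on D (\<lambda>z. complex_of_real (uhat z))"
    using smooth_on_cong[OF open_D, of "\<lambda>z. complex_of_real (uhat z)" "\<lambda>z. complex_of_real (ln (?w z))"] uhat by simp
  note diff_uhat = smooth_on_differentiable[OF smooth_uhat open_D]
  have e_powr: "exp (c * uhat z) = ?w z powr c" if "z \<in> D" for z c
    using w_pos[OF that] by (simp add: powr_def uhat[OF that])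
  have "smooth_on D (\<lambda>z. complex_of_real (?w z powr c))" for c
    by (intro smooth_on_of_real smooth_on_powr smooth_w w_pos open_D)
  then have smooth_exp: "smooth_on D (\<lambda>z. complex_of_real (exp (c * uhat z)))" for c
    using smooth_on_cong[OF open_D, of "\<lambda>z. complex_of_real (exp (c * uhat z))" "\<lambda>z. complex_of_real (?w z powr c)"] e_powr
    by simp
  have e2: "?e z * ?e z = of_real (?w z)" if "z \<in> D" for z
  proof -
    have "exp (uhat z / 2) * exp (uhat z / 2) = exp (uhat z)"
      by (simp flip: exp_add)
    then show ?thesis
      using w_pos[OF that] by (simp add: uhat[OF that] flip: of_real_mult)
  qed
  \<comment> \<open>\<open>norm_relation\<close> factors the square of the modulus of \<alpha> as
    \<open>exp (u z) - betahat z\<close> times \<open>exp (u z) + betahat z\<close>, and the second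
    factor is the square of \<open>?e z\<close>. Sum and difference then give \<open>exp u\<close>
    and \<beta>.\<close>
  have quot: "alphahat z * cnj (alphahat z) / (?e z * ?e z) = of_real (exp (u z) - betahat z)" if "z \<in> D" for z
  proof -
    have "alphahat z * cnj (alphahat z) = of_real (exp (u z) - betahat z) * of_real (?w z)"
      using norm_relation[OF that] by (simp add: algebra_simps power2_eq_square eq_diff_eq)
    moreover have "complex_of_real (?w z) \<noteq> 0"
      using w_pos[OF that] by (simp only: of_real_eq_0_iff less_imp_neq[THEN not_sym] not_False_eq_True)
    ultimately show ?thesis
      unfolding e2[OF that] by simp
  qed
  have frame_l: "frame_system D ?e alphahat ?\<omega> ?\<kappa> (\<lambda>z. F l z $ 1 $ 1) (\<lambda>z. F l z $ 1 $ 2)"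
    by (rule extended_frame_system[OF frame l diff_uhat])
  have il: "cmod (- \<i> * l) = 1" using l by (simp add: norm_mult)
  have "of_real (sqrt 2 / 2) * inverse (- \<i> * l) = \<i> * ?\<kappa>"
    by (simp add: inverse_mult_distrib)
  then have frame_il: "frame_system D ?e alphahat ?\<omega> (\<i> * ?\<kappa>)
      (\<lambda>z. F (- \<i> * l) z $ 1 $ 1) (\<lambda>z. F (- \<i> * l) z $ 1 $ 2)"
    using extended_frame_system[OF frame il diff_uhat] by (simp only:)
  have "l \<noteq> 0" using l by auto
  have sqrt2: "complex_of_real (sqrt 2 / 2) * complex_of_real (sqrt 2 / 2) = 1 / 2"
    by (simp flip: of_real_mult)
  have "?\<kappa> * cnj ?\<kappa> = (complex_of_real (sqrt 2 / 2) * complex_of_real (sqrt 2 / 2)) * (inverse l * l)"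
    unfolding complex_cnj_mult cnj_inverse_unit[OF l] by simp
  then have \<kappa>: "?\<kappa> * cnj ?\<kappa> = 1 / 2"
    unfolding sqrt2 using \<open>l \<noteq> 0\<close> by simp
  interpret fp: frame_pair D ?e alphahat ?\<omega> ?\<kappa> "\<lambda>z. F l z $ 1 $ 1" "\<lambda>z. F l z $ 1 $ 2"
    "\<lambda>z. F (- \<i> * l) z $ 1 $ 1" "\<lambda>z. F (- \<i> * l) z $ 1 $ 2" u betahat
  proof
    show "smooth_on D ?e" "smooth_on D (\<lambda>z. inverse (?e z))"
      using smooth_exp[of "1/2"] smooth_exp[of "- 1/2"] by (simp_all add: exp_minus)
    show "smooth_on D ?\<omega>"
      using smooth_on_mult[OF open_D smooth_on_d_z(1)[OF open_D smooth_uhat] smooth_on_const[of D "1/4"]] by simp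
    fix z assume z: "z \<in> D"
    show "d_zbar ?e z = 2 * cnj (?\<omega> z) * ?e z"
      using d_zbar_exp_of_real[OF diff_uhat[OF z], of "1/2"] d_zbar_cnj[OF diff_uhat[OF z]] by simp
    show "?e z * ?e z + alphahat z * cnj (alphahat z) / (?e z * ?e z) = 2 * of_real (exp (u z))"
      "?e z * ?e z - alphahat z * cnj (alphahat z) / (?e z * ?e z) = 2 * of_real (betahat z)"
      unfolding quot[OF z] unfolding e2[OF z] by simp_all
  qed (use open_D frame_l frame_il \<kappa> smooth_a d_zbar_a in auto)
  have "2 * ?\<kappa>\<^sup>2 = inverse (l\<^sup>2)"
    using sqrt2 by (simp add: power2_eq_square field_simps)
  then show ?thesis
    using fp.adapted_lift unfolding fp.lift_def[abs_def] fp.e11_def by simp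
qed

end


theorem proposition2p3:
  fixes D :: "complex set"
    and f :: "complex \<Rightarrow> (complex^4) set"
    and fhat :: "complex \<Rightarrow> complex^4"
    and u uhat betahat :: "complex \<Rightarrow> real"
    and alphahat :: "complex \<Rightarrow> complex"
    and F :: "complex \<Rightarrow> complex \<Rightarrow> complex^2^2"
  assumes "open D" and "simply_connected D" and "D \<noteq> {}"
    and "minimal_Lagrangian_immersion D f"
    and "induces_metric D f u"
    and "horizontal_lift D f fhat"
    and "\<And>z. z \<in> D \<Longrightarrow> bil (vec_d_z fhat z) (vec_d_zbar fhat z) = of_real (betahat z)"
    and "\<And>z. z \<in> D \<Longrightarrow> betahat z \<ge> 0"
    and "\<And>z. z \<in> D \<Longrightarrow> alphahat z = bil (vec_d_z fhat z) (vec_d_z fhat z)"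
    and "\<And>z. z \<in> D \<Longrightarrow> uhat z = ln (exp (u z) + betahat z)"
    and "extended_frame D uhat alphahat F"
  shows "(\<forall>lam. cmod lam = 1 \<longrightarrow> (\<forall>z\<in>D.
             SO4_of (F lam z) (F (- \<i> * lam) z) \<in> SO4 \<and>
             columns_class (SO4_of (F lam z) (F (- \<i> * lam) z)) = XY_class (frame_X F lam z) (frame_Y F lam z)))
       \<and> (\<exists>\<sigma>. Q2_isometry \<sigma> \<and>
             associated_family D u alphahat betahat
               (\<lambda>lam z. \<sigma> (XY_class (frame_X F lam z) (frame_Y F lam z))))
       \<and> ((\<exists>z\<in>D. betahat z \<noteq> 0) \<longrightarrow>
            (\<forall>fam. associated_family D u alphahat betahat fam \<longrightarrow>
               (\<forall>lam. cmod lam = 1 \<longrightarrow> (\<exists>\<sigma>. Q2_isometry \<sigma> \<and>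
                  (\<forall>z\<in>D. fam lam z = \<sigma> (XY_class (frame_X F lam z) (frame_Y F lam z)))))))"
proof -
  have base: "adapted_lift D fhat u alphahat betahat"
    using assms(9) by (intro adapted_liftI[OF assms(1,4-6) _ assms(7)]) simp_all
  define g where "g l z = (1 + \<i>) *s tensor (F l z $ 1 $ 1) (- cnj (F l z $ 1 $ 2))
      (cnj (F (- \<i> * l) z $ 1 $ 1)) (- (F (- \<i> * l) z $ 1 $ 2))" for l z
  have lift: "adapted_lift D (g l) u (\<lambda>z. inverse (l\<^sup>2) * alphahat z) betahat" if "cmod l = 1" for l
    unfolding g_def[abs_def] by (rule frame_lift[OF base assms(8,10,11) that])
  have SU2: "F l z \<in> SU2" "F (- \<i> * l) z \<in> SU2" if "cmod l = 1" "z \<in> D" for l z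
    using assms(11) that by (auto simp: extended_frame_def norm_mult)
  have XY: "XY_class (frame_X F l z) (frame_Y F l z) = proj_class (vec_cnj (g l z))" if "cmod l = 1" "z \<in> D" for l z
    unfolding frame_X_def frame_Y_def g_def by (rule XY_class_eq[OF SU2[OF that]])
  define \<sigma> where "\<sigma> A = image (\<lambda>v. map_matrix complex_of_real A *v vec_cnj v)" for A :: "real^4^4"
  have \<sigma>: "\<sigma> A (XY_class (frame_X F l z) (frame_Y F l z)) = proj_class (map_matrix complex_of_real A *v g l z)"
    if "cmod l = 1" "z \<in> D" for A l z
    unfolding \<sigma>_def XY[OF that] image_proj_class_cnj by simp
  have Q2_\<sigma>: "Q2_isometry (\<sigma> A)" if "orthogonal_matrix A" for A
    using that unfolding Q2_isometry_def \<sigma>_def by blast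
  show ?thesis
  proof (intro conjI allI impI ballI)
    fix lam z assume *: "cmod lam = 1" "z \<in> D"
    show "SO4_of (F lam z) (F (- \<i> * lam) z) \<in> SO4"
      unfolding SO4_of_eq[OF SU2[OF *]] by (intro SO4_mult mult_SO4 SU2_entries(3)[OF SU2(1)[OF *]] SU2_entries(3)[OF SU2(2)[OF *]])
    show "columns_class (SO4_of (F lam z) (F (- \<i> * lam) z)) = XY_class (frame_X F lam z) (frame_Y F lam z)"
      unfolding frame_X_def frame_Y_def by (rule columns_class_SO4_of[OF SU2[OF *]])
  next
    \<comment> \<open>With the identity matrix the isometry is plain complex conjugation, the same
      for all members of the family; it carries the formula to the class of the constructed
      lift.\<close>
    have "map_matrix complex_of_real (mat 1 :: real^4^4) = mat 1"
      by (simp add: vec_eq_iff map_matrix_def mat_def)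
    then have \<sigma>1: "\<sigma> (mat 1) (XY_class (frame_X F l z) (frame_Y F l z)) = proj_class (g l z)"
      if "cmod l = 1" "z \<in> D" for l z
      by (simp add: \<sigma>[OF that])
    have "associated_family D u alphahat betahat (\<lambda>lam z. \<sigma> (mat 1) (XY_class (frame_X F lam z) (frame_Y F lam z)))"
      unfolding associated_family_def
    proof (intro allI impI conjI)
      fix l :: complex assume l: "cmod l = 1"
      interpret adapted_lift D "g l" u "\<lambda>z. inverse (l\<^sup>2) * alphahat z" betahat
        by (rule lift[OF l])
      let ?f = "\<lambda>z. \<sigma> (mat 1) (XY_class (frame_X F l z) (frame_Y F l z))"
      show "minimal_Lagrangian_immersion D ?f" "induces_metric D ?f u"
        by (rule minimal_Lagrangian_immersion induces_metric, rule \<sigma>1[OF l], assumption)+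
      show "\<exists>g. horizontal_lift D ?f g \<and> (\<forall>z\<in>D. bil (vec_d_z g z) (vec_d_zbar g z) = of_real (betahat z) \<and>
           bil (vec_d_z g z) (vec_d_z g z) = inverse (l\<^sup>2) * alphahat z)"
        using horizontal_lift[of ?f] \<sigma>1[OF l] bil_z_z bil_z_zbar by blast
    qed
    then show "\<exists>\<sigma>. Q2_isometry \<sigma> \<and>
        associated_family D u alphahat betahat (\<lambda>lam z. \<sigma> (XY_class (frame_X F lam z) (frame_Y F lam z)))"
      using Q2_\<sigma>[OF orthogonal_matrix_id] by blast
  next
    fix fam lam
    assume b: "\<exists>z\<in>D. betahat z \<noteq> 0" and fam: "associated_family D u alphahat betahat fam" and lam: "cmod lam = 1"
    then obtain h where h: "minimal_Lagrangian_immersion D (fam lam)" "induces_metric D (fam lam) u"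
      "horizontal_lift D (fam lam) h"
      "\<And>z. z \<in> D \<Longrightarrow> bil (vec_d_z h z) (vec_d_zbar h z) = of_real (betahat z)"
      "\<And>z. z \<in> D \<Longrightarrow> bil (vec_d_z h z) (vec_d_z h z) = inverse (lam\<^sup>2) * alphahat z"
      unfolding associated_family_def by blast
    have "adapted_lift D h u (\<lambda>z. inverse (lam\<^sup>2) * alphahat z) betahat"
      by (rule adapted_liftI[OF assms(1) h(1-3) h(5) h(4)])
    then have "congruent_lifts D h (g lam) u (\<lambda>z. inverse (lam\<^sup>2) * alphahat z) betahat"
      using lift[OF lam] simply_connected_imp_connected[OF assms(2)] b
      by (simp add: congruent_lifts_def congruent_lifts_axioms_def)
    \<comment> \<open>Each member is compared with the constructed lift separately, so the matrix
      may vary with \<open>lam\<close>.\<close>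
    from congruent_lifts.congruent[OF this] obtain A :: "real^4^4" where A: "orthogonal_matrix A"
      "\<And>z. z \<in> D \<Longrightarrow> h z = map_matrix complex_of_real A *v g lam z"
      by blast
    have "fam lam z = \<sigma> A (XY_class (frame_X F lam z) (frame_Y F lam z))" if "z \<in> D" for z
      using h(3) that unfolding \<sigma>[OF lam that] A(2)[OF that, symmetric]
      by (simp add: horizontal_lift_def unit_lift_def)
    then show "\<exists>\<sigma>. Q2_isometry \<sigma> \<and> (\<forall>z\<in>D. fam lam z = \<sigma> (XY_class (frame_X F lam z) (frame_Y F lam z)))"
      using Q2_\<sigma>[OF A(1)] by blast
  qed
qed

end
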